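(* Let $\mathcal{M}$ and $\mathcal{N}$ be weak Prague spaces. (i) There is a one-to-one correspondence between surjective linear isometries $\mathcal{F}(\mathcal{M})\to\mathcal{F}(\mathcal{N})$ and bijections $\sigma:E_{ext}(\mathcal{M})\to E_{ext}(\mathcal{N})$ satisfying conditions (Sa), (Sb) and (Sc) (stated in the context, with $E_1=E_{ext}(\mathcal{M})$, $E_2=E_{ext}(\mathcal{N})$). (ii) If both $\mathcal{M}$ and $\mathcal{N}$ are moreover Prague spaces, then there is a one-to-one correspondence between surjective linear isometries $\mathcal{F}(\mathcal{M})\to\mathcal{F}(\mathcal{N})$ and bijections $\sigma:E_{ext}(\mathcal{M})\to E_{ext}(\mathcal{N})$ satisfying (Sa) and (Sb). In both cases the correspondence is of the form $\sigma\mapsto T_\sigma$, where $\sigma:E_{ext}(\mathcal{M})\to E_{ext}(\mathcal{N})$ is an appropriate bijection and $T_\sigma:\mathcal{F}(\mathcal{M})\to\mathcal{F}(\mathcal{N})$ is the linear isometry uniquely determined by the condition $T_\sigma(m_e)=m_{\sigma(e)}$ for all $e\in E_{ext}(\mathcal{M})$.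
   Context: For a metric space $(\mathcal{M},d)$, let $\mathcal{F}_0(\mathcal{M})$ be the real vector space of finitely supported functions $x:\mathcal{M}\to\mathbb{R}$ with $\sum_{m}x(m)=0$, normed by $\|x\|=\sup\{|\sum_m x(m)f(m)| : f:\mathcal{M}\to\mathbb{R}\text{ is }1\text{-Lipschitz}\}$. The Lipschitz-free space $\mathcal{F}(\mathcal{M})$ is its completion. For $x\neq y$ in $\mathcal{M}$ put $m_{x,y}=(\chi_{\{x\}}-\chi_{\{y\}})/d(x,y)\in\mathcal{F}(\mathcal{M})$. For an ordered pair $e=(x,y)$ with $x\ne y$ write $s(e)=x$, $r(e)=y$, $-e=(y,x)$, $d(e)=d(x,y)$, $m_e=m_{x,y}$. $E_{ext}(\mathcal{M})$ is the set of ordered pairs $(x,y)$ of distinct points such that $m_{x,y}$ is an extreme point of the closed unit ball of $\mathcal{F}(\mathcal{M})^{**}$ (with $\mathcal F(\mathcal M)\subset\mathcal F(\mathcal M)^{**}$ canonically). Let $E$ be a symmetric set ($-e\in E$ for $e\in E$) of ordered pairs of distinct points of $\mathcal{M}$, and let $V_E$ be the set of points incident with $E$; view $(V_E,E)$ as a directed graph. An $E$-path from $x$ to $y$ is a sequence $e_1,\dots,e_n\in E$ with $s(e_1)=x$, $r(e_n)=y$, $r(e_i)=s(e_{i+1})$ for $i<n$. A (directed) cycle is a set $\{e_1,\dots,e_n\}\subseteq E$ with $r(e_i)=s(e_{i+1})$ for $i<n$ and $r(e_n)=s(e_1)$; it is simple if it is not a concatenation of two proper subcycles (i.e. no vertex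 is repeated). In particular $\{e,-e\}$ is a simple cycle. $E$ is weakly admissible for $\mathcal{M}$ if it is symmetric, $V_E$ is dense in $\mathcal{M}$ and $(V_E,E)$ is connected (there is an $E$-path between any two vertices). $E$ is admissible if moreover for all $x,y\in V_E$, $d(x,y)=\inf\{\sum_{i=1}^n d(e_i): e_1,\dots,e_n\text{ is an }E\text{-path from }x\text{ to }y\}$. $\mathcal{M}$ is a Prague space (resp. weak Prague space) if $E_{ext}(\mathcal{M})$ is admissible (resp. weakly admissible). For metric spaces $(\mathcal{M}_1,d_1),(\mathcal{M}_2,d_2)$ with such edge sets $E_1,E_2$ and a bijection $\sigma:E_1\to E_2$ the conditions are: (Sa) $E'\subset E_1$ is a simple cycle if and only if $\sigma(E')$ is a simple cycle in $E_2$; (Sb) $d_1(e)/d_2(\sigma(e))$ is constant on each simple cycle $E'\subset E_1$; (Sc) for every $E_1$-path $e_1,\dots,e_n$ from $x\in V_{E_1}$ to $y\in V_{E_1}$ and every $E_2$-path $f_1,\dots,f_k$ from $x'\in V_{E_2}$ to $y'\in V_{E_2}$ we have $d_1(x,y)=\|\sum_{i=1}^n d_1(e_i)m_{\sigma(e_i)}\|$ and $d_2(x',y')=\|\sum_{j=1}^k d_2(f_j)m_{\sigma^{-1}(f_j)}\|$.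
   Formalization: The metric spaces M and N are additionally assumed complete (and nonempty); without completeness the claim fails, e.g. for M=[0,1] with d=√|x−y| and N=M∖{1/2}, where the identity isometry F(M)→F(N) is not of the form T_σ. *)

theory Defs
  imports "HOL-Analysis.Analysis" "Graph_Theory.Arc_Walk"
begin

section \<open>The normed space of finitely supported functions of total mass zero\<close>

typedef 'a free0 = "{x :: 'a \<Rightarrow> real. finite {m. x m \<noteq> 0} \<and> (\<Sum>m | x m \<noteq> 0. x m) = 0}"
  morphisms coef Abs_free0
  by (rule exI[of _ "\<lambda>_. 0"]) simp

setup_lifting type_definition_free0

lemma finite_supp [simp]: "finite {m. coef x m \<noteq> 0}"
  by transfer simp

lemma sum_supp_superset:
  fixes x f :: "'a \<Rightarrow> real"
  assumes "finite A" "{m. x m \<noteq> 0} \<subseteq> A"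
  shows "(\<Sum>m | x m \<noteq> 0. x m * f m) = (\<Sum>m\<in>A. x m * f m)"
  by (rule sum.mono_neutral_left) (use assms in auto)

lemma mass_zero_superset:
  fixes x :: "'a \<Rightarrow> real"
  assumes "finite A" "{m. x m \<noteq> 0} \<subseteq> A"
  shows "(\<Sum>m | x m \<noteq> 0. x m) = (\<Sum>m\<in>A. x m)"
  using sum_supp_superset[OF assms, of "\<lambda>_. 1"] by simp

lemma free0I:
  fixes x :: "'a \<Rightarrow> real"
  assumes "finite A" "{m. x m \<noteq> 0} \<subseteq> A" "(\<Sum>m\<in>A. x m) = 0"
  shows "finite {m. x m \<noteq> 0} \<and> (\<Sum>m | x m \<noteq> 0. x m) = 0"
  using assms mass_zero_superset[OF assms(1,2)] finite_subset by auto

instantiation free0 :: (type) real_vector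
begin

lift_definition zero_free0 :: "'a free0" is "\<lambda>_. 0"
  by simp

lift_definition plus_free0 :: "'a free0 \<Rightarrow> 'a free0 \<Rightarrow> 'a free0" is "\<lambda>x y m. x m + y m"
proof -
  fix x y :: "'a \<Rightarrow> real"
  let ?A = "{m. x m \<noteq> 0} \<union> {m. y m \<noteq> 0}"
  assume x: "finite {m. x m \<noteq> 0} \<and> (\<Sum>m | x m \<noteq> 0. x m) = 0"
    and y: "finite {m. y m \<noteq> 0} \<and> (\<Sum>m | y m \<noteq> 0. y m) = 0"
  have "(\<Sum>m\<in>?A. x m) = 0" "(\<Sum>m\<in>?A. y m) = 0"
    using mass_zero_superset[of ?A x] mass_zero_superset[of ?A y] x y by auto
  then show "finite {m. x m + y m \<noteq> 0} \<and> (\<Sum>m | x m + y m \<noteq> 0. x m + y m) = 0"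
    using x y by (intro free0I[of ?A]) (auto simp: sum.distrib)
qed

lift_definition scaleR_free0 :: "real \<Rightarrow> 'a free0 \<Rightarrow> 'a free0" is "\<lambda>c x m. c * x m"
  subgoal for c x
    by (rule free0I[of "{m. x m \<noteq> 0}"]) (auto simp flip: sum_distrib_left)
  done

lift_definition uminus_free0 :: "'a free0 \<Rightarrow> 'a free0" is "\<lambda>x m. - x m"
  by (simp add: sum_negf)

definition minus_free0 :: "'a free0 \<Rightarrow> 'a free0 \<Rightarrow> 'a free0" where
  "minus_free0 x y = x + - y"

instance
  by standard (unfold minus_free0_def, (transfer, auto simp: algebra_simps)+)

end

definition pairing :: "'a free0 \<Rightarrow> ('a \<Rightarrow> real) \<Rightarrow> real" where
  "pairing x f = (\<Sum>m | coef x m \<noteq> 0. coef x m * f m)"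

lemma pairing_superset:
  assumes "finite A" "{m. coef x m \<noteq> 0} \<subseteq> A"
  shows "pairing x f = (\<Sum>m\<in>A. coef x m * f m)"
  unfolding pairing_def using sum_supp_superset[OF assms] .

lemma coef_simps [simp]:
  "coef 0 m = 0" "coef (x + y) m = coef x m + coef y m"
  "coef (c *\<^sub>R x) m = c * coef x m" "coef (- x) m = - coef x m"
  by (transfer; simp)+

lemma sum_coef: "(\<Sum>m | coef x m \<noteq> 0. coef x m) = 0"
  by transfer simp

lemma pairing_zero [simp]: "pairing 0 f = 0"
  by (simp add: pairing_def)

lemma pairing_add: "pairing (x + y) f = pairing x f + pairing y f"
proof -
  let ?A = "{m. coef x m \<noteq> 0} \<union> {m. coef y m \<noteq> 0}"
  have eqs: "pairing x f = (\<Sum>m\<in>?A. coef x m * f m)" "pairing y f = (\<Sum>m\<in>?A. coef y m * f m)"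
    "pairing (x + y) f = (\<Sum>m\<in>?A. coef (x + y) m * f m)"
    by (rule pairing_superset; auto)+
  show ?thesis
    by (simp only: eqs coef_simps distrib_right sum.distrib)
qed

lemma pairing_scaleR: "pairing (c *\<^sub>R x) f = c * pairing x f"
proof -
  have "pairing (c *\<^sub>R x) f = (\<Sum>m | coef x m \<noteq> 0. coef (c *\<^sub>R x) m * f m)"
    by (rule pairing_superset) auto
  then show ?thesis
    by (simp add: pairing_def sum_distrib_left mult.assoc)
qed

lemma bdd_above_pairing:
  fixes x :: "'a::metric_space free0"
  shows "bdd_above ((\<lambda>f. \<bar>pairing x f\<bar>) ` {f. 1-lipschitz_on UNIV f})"
proof (rule bdd_aboveI2)
  fix f :: "'a \<Rightarrow> real"
  fix o' :: 'a
  assume "f \<in> {f. 1-lipschitz_on UNIV f}"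
  then have L: "\<bar>f m - f o'\<bar> \<le> dist m o'" for m
    by (auto simp: lipschitz_on_def dist_real_def)
  have "pairing x f = (\<Sum>m | coef x m \<noteq> 0. coef x m * (f m - f o'))"
    using sum_coef[of x]
    by (simp add: pairing_def right_diff_distrib sum_subtractf flip: sum_distrib_right)
  also have "\<bar>\<dots>\<bar> \<le> (\<Sum>m | coef x m \<noteq> 0. \<bar>coef x m * (f m - f o')\<bar>)"
    by (rule sum_abs)
  also have "\<dots> \<le> (\<Sum>m | coef x m \<noteq> 0. \<bar>coef x m\<bar> * dist m o')"
    by (intro sum_mono) (auto simp: abs_mult intro!: mult_left_mono L)
  finally show "\<bar>pairing x f\<bar> \<le> (\<Sum>m | coef x m \<noteq> 0. \<bar>coef x m\<bar> * dist m o')" .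
qed

lemma lipschitz_1_zero: "1-lipschitz_on (UNIV :: 'a::metric_space set) (\<lambda>_. 0 :: real)"
  by (auto simp: lipschitz_on_def)

instantiation free0 :: (metric_space) real_normed_vector
begin

definition norm_free0 :: "'a free0 \<Rightarrow> real" where
  "norm_free0 x = (SUP f\<in>{f. 1-lipschitz_on UNIV f}. \<bar>pairing x f\<bar>)"

definition dist_free0 :: "'a free0 \<Rightarrow> 'a free0 \<Rightarrow> real" where
  "dist_free0 x y = norm (x - y)"

definition sgn_free0 :: "'a free0 \<Rightarrow> 'a free0" where
  "sgn_free0 x = x /\<^sub>R norm x"

definition uniformity_free0 :: "('a free0 \<times> 'a free0) filter" where
  "uniformity_free0 = (INF e\<in>{0 <..}. principal {(x, y). dist x y < e})"

definition open_free0 :: "'a free0 set \<Rightarrow> bool" where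
  "open_free0 U = (\<forall>x\<in>U. \<forall>\<^sub>F (x', y) in uniformity. x' = x \<longrightarrow> y \<in> U)"

lemma pairing_le_norm:
  fixes x :: "'a free0"
  assumes "1-lipschitz_on UNIV f"
  shows "\<bar>pairing x f\<bar> \<le> norm x"
  unfolding norm_free0_def using assms by (intro cSUP_upper bdd_above_pairing) auto

lemma norm_free0_least:
  fixes x :: "'a free0"
  assumes "\<And>f. 1-lipschitz_on UNIV f \<Longrightarrow> \<bar>pairing x f\<bar> \<le> K"
  shows "norm x \<le> K"
  unfolding norm_free0_def using assms lipschitz_1_zero by (intro cSUP_least) auto

lemma norm_free0_pos:
  fixes x :: "'a free0"
  assumes "x \<noteq> 0"
  shows "norm x > 0"
proof -
  have "\<exists>a. coef x a \<noteq> 0"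
    using assms by (metis coef_inject coef_simps(1) ext)
  then obtain a where a: "coef x a \<noteq> 0" ..
  let ?B = "{m. coef x m \<noteq> 0} - {a}"
  have "(\<Sum>m | coef x m \<noteq> 0. coef x m) = coef x a + sum (coef x) ?B"
    using a by (subst sum.remove[of _ a]) auto
  then have "?B \<noteq> {}"
    using a sum_coef[of x] by (metis add.right_neutral sum.empty)
  define r where "r = Min (dist a ` ?B)"
  define f where "f = (\<lambda>m. max 0 (r - dist a m))"
  have fin: "finite (dist a ` ?B)" "dist a ` ?B \<noteq> {}"
    using \<open>?B \<noteq> {}\<close> by auto
  have "r > 0"
    unfolding r_def using fin by (subst Min_gr_iff) auto
  have rle: "r \<le> dist a m" if "m \<in> ?B" for m
    unfolding r_def using fin that by (intro Min_le) auto
  have "\<bar>f m - f n\<bar> \<le> dist m n" for m n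
    using dist_triangle[of a m n] dist_triangle[of a n m]
    unfolding f_def by (auto simp: dist_commute max_def)
  then have L: "1-lipschitz_on UNIV f"
    by (auto simp: lipschitz_on_def dist_real_def)
  have "pairing x f = coef x a * f a + (\<Sum>m\<in>?B. coef x m * f m)"
    unfolding pairing_def using a by (subst sum.remove[of _ a]) auto
  also have "(\<Sum>m\<in>?B. coef x m * f m) = 0"
    using rle by (intro sum.neutral ballI) (simp add: f_def)
  also have "f a = r"
    using \<open>r > 0\<close> by (simp add: f_def)
  finally have "pairing x f \<noteq> 0"
    using a \<open>r > 0\<close> by simp
  then show ?thesis
    using pairing_le_norm[OF L, of x] by linarith
qed

instance
proof
  fix x y :: "'a free0" and c :: real
  show "norm x = 0 \<longleftrightarrow> x = 0"
  proof
    show "norm x = 0 \<Longrightarrow> x = 0"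
      using norm_free0_pos[of x] by fastforce
    have "norm (0 :: 'a free0) \<le> 0" "norm (0 :: 'a free0) \<ge> \<bar>pairing 0 (\<lambda>_ :: 'a. 0)\<bar>"
      by (intro norm_free0_least pairing_le_norm lipschitz_1_zero; simp)+
    then show "x = 0 \<Longrightarrow> norm x = 0"
      by simp
  qed
  show "norm (x + y) \<le> norm x + norm y"
  proof (rule norm_free0_least)
    fix f :: "'a \<Rightarrow> real"
    assume "1-lipschitz_on UNIV f"
    from pairing_le_norm[OF this, of x] pairing_le_norm[OF this, of y]
    show "\<bar>pairing (x + y) f\<bar> \<le> norm x + norm y"
      by (simp add: pairing_add)
  qed
  have le: "norm (k *\<^sub>R z) \<le> \<bar>k\<bar> * norm z" for k and z :: "'a free0"
    by (rule norm_free0_least)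
      (auto simp: pairing_scaleR abs_mult intro!: mult_left_mono pairing_le_norm)
  show "norm (c *\<^sub>R x) = \<bar>c\<bar> * norm x"
  proof (cases "c = 0")
    case True
    then show ?thesis
      using le[of 0 x] pairing_le_norm[OF lipschitz_1_zero, of "0 *\<^sub>R x"] by simp
  next
    case False
    have "norm x \<le> \<bar>inverse c\<bar> * norm (c *\<^sub>R x)"
      using le[of "inverse c" "c *\<^sub>R x"] False by simp
    then have "\<bar>c\<bar> * norm x \<le> norm (c *\<^sub>R x)"
      using False by (simp add: field_simps abs_inverse)
    with le[of c x] show ?thesis
      by simp
  qed
qed (simp_all only: dist_free0_def sgn_free0_def uniformity_free0_def open_free0_def)

end


section \<open>The canonical embedding into the bidual\<close>

lift_definition bidual_embed :: "'b::real_normed_vector \<Rightarrow> (('b \<Rightarrow>\<^sub>L real) \<Rightarrow>\<^sub>L real)"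
  is "\<lambda>x \<phi>. blinfun_apply \<phi> x"
  by (rule blinfun.bounded_linear_left)

declare bidual_embed.rep_eq [simp]

lemma linear_bidual_embed: "linear bidual_embed"
  by (intro linearI blinfun_eqI) (simp_all add: blinfun.bilinear_simps)

lemma norm_bidual_embed_le: "norm (bidual_embed x) \<le> norm x"
  by (rule norm_blinfun_bound) (simp_all add: norm_blinfun mult.commute[of "norm x"] del: real_norm_def)

lemma norm_bidual_embed_free0: "norm (bidual_embed x) = norm (x :: 'a::metric_space free0)"
proof (rule antisym[OF norm_bidual_embed_le norm_free0_least])
  fix f :: "'a \<Rightarrow> real"
  assume f: "1-lipschitz_on UNIV f"
  define \<phi> where "\<phi> = Blinfun (\<lambda>x. pairing x f)"
  have "bounded_linear (\<lambda>x. pairing x f)"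
    by (rule bounded_linear_intro[of _ 1])
      (use pairing_le_norm[OF f] in \<open>simp_all add: pairing_add pairing_scaleR\<close>)
  then have \<phi>: "blinfun_apply \<phi> x = pairing x f" for x
    by (simp add: \<phi>_def bounded_linear_Blinfun_apply)
  then have "norm \<phi> \<le> 1"
    using pairing_le_norm[OF f] by (intro norm_blinfun_bound) auto
  have "\<bar>pairing x f\<bar> = norm (blinfun_apply (bidual_embed x) \<phi>)"
    by (simp add: \<phi>)
  also have "\<dots> \<le> norm (bidual_embed x) * norm \<phi>"
    by (rule norm_blinfun)
  also have "\<dots> \<le> norm (bidual_embed x)"
    using \<open>norm \<phi> \<le> 1\<close> by (simp add: mult_left_le)
  finally show "\<bar>pairing x f\<bar> \<le> norm (bidual_embed x)" .
qed


section \<open>The Lipschitz-free space\<close>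

text \<open>
  The completion of \<^typ>\<open>'a free0\<close> is realised as the closure of its isometric copy in its
  bidual, which is a Banach space; see the lemmas on \<open>of_free0\<close> below.
\<close>

typedef (overloaded) 'a lipfree =
  "closure (range (bidual_embed :: 'a::metric_space free0 \<Rightarrow> _))"
  morphisms Rep_lipfree Abs_lipfree
  using closure_subset by fastforce

setup_lifting type_definition_lipfree

lemma subspace_closure_normed:
  fixes S :: "'b::real_normed_vector set"
  assumes "subspace S"
  shows "subspace (closure S)"
proof (rule subspaceI)
  show "0 \<in> closure S"
    using subspace_0[OF assms] closure_subset by blast
next
  fix x y assume "x \<in> closure S" "y \<in> closure S"
  then obtain u v where uv: "\<And>n. u n \<in> S" "u \<longlonglongrightarrow> x" "\<And>n. v n \<in> S" "v \<longlonglongrightarrow> y"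
    unfolding closure_sequential by blast
  show "x + y \<in> closure S"
    unfolding closure_sequential
    by (rule exI[of _ "\<lambda>n. u n + v n"]) (use uv in \<open>auto intro: tendsto_add subspace_add assms\<close>)
next
  fix c x assume "x \<in> closure S"
  then obtain u where u: "\<And>n. u n \<in> S" "u \<longlonglongrightarrow> x"
    unfolding closure_sequential by blast
  show "c *\<^sub>R x \<in> closure S"
    unfolding closure_sequential
    by (rule exI[of _ "\<lambda>n. c *\<^sub>R u n"])
      (use u in \<open>auto intro: tendsto_scaleR subspace_scale assms\<close>)
qed

lemma subspace_closure_range_bidual_embed: "subspace (closure (range bidual_embed))"
  by (intro subspace_closure_normed linear_subspace_image linear_bidual_embed subspace_UNIV)

instantiation lipfree :: (metric_space) real_normed_vector
begin

lift_definition zero_lipfree :: "'a lipfree" is 0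
  by (intro subspace_0 subspace_closure_range_bidual_embed)

lift_definition plus_lipfree :: "'a lipfree \<Rightarrow> 'a lipfree \<Rightarrow> 'a lipfree" is "(+)"
  by (intro subspace_add subspace_closure_range_bidual_embed)

lift_definition minus_lipfree :: "'a lipfree \<Rightarrow> 'a lipfree \<Rightarrow> 'a lipfree" is "(-)"
  by (intro subspace_diff subspace_closure_range_bidual_embed)

lift_definition uminus_lipfree :: "'a lipfree \<Rightarrow> 'a lipfree" is uminus
  by (intro subspace_neg subspace_closure_range_bidual_embed)

lift_definition scaleR_lipfree :: "real \<Rightarrow> 'a lipfree \<Rightarrow> 'a lipfree" is scaleR
  by (intro subspace_scale subspace_closure_range_bidual_embed)

lift_definition norm_lipfree :: "'a lipfree \<Rightarrow> real" is norm .

definition dist_lipfree :: "'a lipfree \<Rightarrow> 'a lipfree \<Rightarrow> real" where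
  "dist_lipfree x y = norm (x - y)"

definition sgn_lipfree :: "'a lipfree \<Rightarrow> 'a lipfree" where
  "sgn_lipfree x = scaleR (inverse (norm x)) x"

definition uniformity_lipfree :: "('a lipfree \<times> 'a lipfree) filter" where
  "uniformity_lipfree = (INF e\<in>{0 <..}. principal {(x, y). dist x y < e})"

definition open_lipfree :: "'a lipfree set \<Rightarrow> bool" where
  "open_lipfree U = (\<forall>x\<in>U. \<forall>\<^sub>F (x', y) in uniformity. x' = x \<longrightarrow> y \<in> U)"

instance
proof
  fix x y z :: "'a lipfree" and a b :: real
  show "x + y + z = x + (y + z)" "x + y = y + x" "0 + x = x" "- x + x = 0" "x - y = x + - y"
    "a *\<^sub>R (x + y) = a *\<^sub>R x + a *\<^sub>R y" "(a + b) *\<^sub>R x = a *\<^sub>R x + b *\<^sub>R x"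
    "a *\<^sub>R b *\<^sub>R x = (a * b) *\<^sub>R x" "1 *\<^sub>R x = x"
    by (transfer, simp add: scaleR_add_left scaleR_add_right)+
  show "norm x = 0 \<longleftrightarrow> x = 0" "norm (a *\<^sub>R x) = \<bar>a\<bar> * norm x"
    by (transfer, simp)+
  show "norm (x + y) \<le> norm x + norm y"
    by transfer (rule norm_triangle_ineq)
qed (simp_all only: dist_lipfree_def sgn_lipfree_def uniformity_lipfree_def open_lipfree_def)

end

lemma dist_Rep_lipfree: "dist (Rep_lipfree x) (Rep_lipfree y) = dist x y"
  unfolding dist_lipfree_def dist_norm by transfer simp

instance lipfree :: (metric_space) banach
proof
  fix X :: "nat \<Rightarrow> 'a lipfree"
  assume "Cauchy X"
  then have "Cauchy (\<lambda>n. Rep_lipfree (X n))"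
    by (simp add: Cauchy_def dist_Rep_lipfree)
  then have "convergent (\<lambda>n. Rep_lipfree (X n))"
    by (simp add: Cauchy_convergent_iff)
  then obtain l where l: "(\<lambda>n. Rep_lipfree (X n)) \<longlonglongrightarrow> l"
    unfolding convergent_def ..
  then have "l \<in> closure (range (bidual_embed :: 'a free0 \<Rightarrow> _))"
    by (rule closed_sequentially[OF closed_closure Rep_lipfree])
  then obtain y where "l = Rep_lipfree y"
    by (rule Rep_lipfree_cases)
  with l have "X \<longlonglongrightarrow> y"
    by (simp add: lim_sequentially dist_Rep_lipfree)
  then show "convergent X"
    by (rule convergentI)
qed

definition of_free0 :: "'a::metric_space free0 \<Rightarrow> 'a lipfree" where
  "of_free0 x = Abs_lipfree (bidual_embed x)"

lemma Rep_of_free0: "Rep_lipfree (of_free0 x) = bidual_embed x"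
  unfolding of_free0_def
  by (rule Abs_lipfree_inverse, rule subsetD[OF closure_subset], rule rangeI)

lemma linear_of_free0: "linear of_free0"
proof (rule linearI)
  show "of_free0 (x + y) = of_free0 x + of_free0 y" for x y :: "'a free0"
    by (rule Rep_lipfree_inject[THEN iffD1])
      (simp only: Rep_of_free0 plus_lipfree.rep_eq linear_add[OF linear_bidual_embed])
  show "of_free0 (c *\<^sub>R x) = c *\<^sub>R of_free0 x" for c and x :: "'a free0"
    by (rule Rep_lipfree_inject[THEN iffD1])
      (simp only: Rep_of_free0 scaleR_lipfree.rep_eq linear_scale[OF linear_bidual_embed])
qed

lemma norm_of_free0: "norm (of_free0 x) = norm x"
  by (simp add: norm_lipfree.rep_eq Rep_of_free0 norm_bidual_embed_free0)

lemma dense_of_free0: "closure (range of_free0) = UNIV"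
proof (rule equalityI[OF subset_UNIV], rule subsetI)
  fix x :: "'a lipfree"
  have "Rep_lipfree x \<in> closure (range bidual_embed)"
    by (rule Rep_lipfree)
  then have *: "\<exists>w\<in>range bidual_embed. dist w (Rep_lipfree x) < e" if "e > 0" for e
    using that by (simp only: closure_approachable)
  have "\<exists>z\<in>range of_free0. dist z x < e" if "e > 0" for e
  proof -
    from *[OF that] obtain y where "dist (bidual_embed y) (Rep_lipfree x) < e"
      by (elim bexE rangeE) simp
    then have "dist (of_free0 y) x < e"
      by (simp only: dist_Rep_lipfree flip: Rep_of_free0)
    then show ?thesis
      by (rule bexI) (rule rangeI)
  qed
  then show "x \<in> closure (range of_free0)"
    unfolding closure_approachable by (intro allI impI)
qed

text \<open>The elementary molecule \<open>m\<^sub>x\<^sub>,\<^sub>y\<close>; it is \<open>0\<close> when \<open>x = y\<close>.\<close>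

lift_definition molecule0 :: "'a::metric_space \<times> 'a \<Rightarrow> 'a free0"
  is "\<lambda>e z. (indicator {fst e} z - indicator {snd e} z) / dist (fst e) (snd e)"
proof -
  fix e :: "'a \<times> 'a"
  let ?f = "\<lambda>z. (indicator {fst e} z - indicator {snd e} z) / dist (fst e) (snd e) :: real"
  show "finite {m. ?f m \<noteq> 0} \<and> (\<Sum>m | ?f m \<noteq> 0. ?f m) = 0"
  proof (rule free0I)
    show "finite {fst e, snd e}"
      by simp
    show "{m. ?f m \<noteq> 0} \<subseteq> {fst e, snd e}"
      by (rule subsetI, rule ccontr) simp
    show "sum ?f {fst e, snd e} = 0"
      by (cases "fst e = snd e") (simp_all flip: add_divide_distrib)
  qed
qed

definition molecule :: "'a::metric_space \<times> 'a \<Rightarrow> 'a lipfree" where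
  "molecule e = of_free0 (molecule0 e)"

definition linear_isometry :: "('b::real_normed_vector \<Rightarrow> 'c::real_normed_vector) \<Rightarrow> bool" where
  "linear_isometry T \<longleftrightarrow> linear T \<and> (\<forall>x. norm (T x) = norm x)"


section \<open>Admissible edge sets and Prague spaces\<close>

definition edge_length :: "'a::metric_space \<times> 'a \<Rightarrow> real" where
  "edge_length e = dist (fst e) (snd e)"

definition ext_edges :: "('a::metric_space \<times> 'a) set" where
  "ext_edges = {e. fst e \<noteq> snd e \<and> bidual_embed (molecule e) extreme_point_of cball 0 1}"

definition incident_verts :: "('a \<times> 'a) set \<Rightarrow> 'a set" where
  "incident_verts E = fst ` E \<union> snd ` E"

definition edge_graph :: "('a \<times> 'a) set \<Rightarrow> ('a, 'a \<times> 'a) pre_digraph" where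
  "edge_graph E = \<lparr>verts = incident_verts E, arcs = E, tail = fst, head = snd\<rparr>"

text \<open>
  As for \<^const>\<open>pre_digraph.awalk\<close>, the empty list is a path from each vertex to itself.
  Without this convention the length infimum below would not vanish for \<open>x = y\<close>
  in, say, a finite space.
\<close>

definition edge_path :: "('a \<times> 'a) set \<Rightarrow> 'a \<Rightarrow> ('a \<times> 'a) list \<Rightarrow> 'a \<Rightarrow> bool" where
  "edge_path E x es y \<longleftrightarrow> pre_digraph.awalk (edge_graph E) x es y"

text \<open>
  A cycle is the set of edges of a nonempty closed walk;
  \<^const>\<open>pre_digraph.cycle\<close> also demands that no vertex be repeated.
\<close>

definition simple_cycle :: "('a \<times> 'a) set \<Rightarrow> ('a \<times> 'a) set \<Rightarrow> bool" where
  "simple_cycle E C \<longleftrightarrow> (\<exists>es. pre_digraph.cycle (edge_graph E) es \<and> C = set es)"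

definition weakly_admissible :: "('a::metric_space \<times> 'a) set \<Rightarrow> bool" where
  "weakly_admissible E \<longleftrightarrow>
     irrefl E \<and> sym E \<and> closure (incident_verts E) = UNIV \<and>
     (\<forall>x\<in>incident_verts E. \<forall>y\<in>incident_verts E. \<exists>es. edge_path E x es y)"

definition admissible :: "('a::metric_space \<times> 'a) set \<Rightarrow> bool" where
  "admissible E \<longleftrightarrow>
     weakly_admissible E \<and>
     (\<forall>x\<in>incident_verts E. \<forall>y\<in>incident_verts E.
        dist x y = (INF es\<in>{es. edge_path E x es y}. \<Sum>e\<leftarrow>es. edge_length e))"

definition weak_prague_space :: "'a::metric_space itself \<Rightarrow> bool" where
  "weak_prague_space _ \<longleftrightarrow> weakly_admissible (ext_edges :: ('a \<times> 'a) set)"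

definition prague_space :: "'a::metric_space itself \<Rightarrow> bool" where
  "prague_space _ \<longleftrightarrow> admissible (ext_edges :: ('a \<times> 'a) set)"


section \<open>The conditions on edge bijections\<close>

definition cond_Sa ::
  "('a \<times> 'a) set \<Rightarrow> ('b \<times> 'b) set \<Rightarrow> ('a \<times> 'a \<Rightarrow> 'b \<times> 'b) \<Rightarrow> bool" where
  "cond_Sa E\<^sub>1 E\<^sub>2 \<sigma> \<longleftrightarrow> (\<forall>C\<subseteq>E\<^sub>1. simple_cycle E\<^sub>1 C \<longleftrightarrow> simple_cycle E\<^sub>2 (\<sigma> ` C))"

definition cond_Sb ::
  "('a::metric_space \<times> 'a) set \<Rightarrow> ('a \<times> 'a \<Rightarrow> 'b::metric_space \<times> 'b) \<Rightarrow> bool" where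
  "cond_Sb E\<^sub>1 \<sigma> \<longleftrightarrow>
     (\<forall>C\<subseteq>E\<^sub>1. simple_cycle E\<^sub>1 C \<longrightarrow>
        (\<lambda>e. edge_length e / edge_length (\<sigma> e)) constant_on C)"

definition cond_Sc ::
  "('a::metric_space \<times> 'a) set \<Rightarrow> ('b::metric_space \<times> 'b) set \<Rightarrow> ('a \<times> 'a \<Rightarrow> 'b \<times> 'b) \<Rightarrow> bool"
  where
  "cond_Sc E\<^sub>1 E\<^sub>2 \<sigma> \<longleftrightarrow>
     (\<forall>x\<in>incident_verts E\<^sub>1. \<forall>y\<in>incident_verts E\<^sub>1. \<forall>es. edge_path E\<^sub>1 x es y \<longrightarrow>
        dist x y = norm (\<Sum>e\<leftarrow>es. edge_length e *\<^sub>R molecule (\<sigma> e))) \<and>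
     (\<forall>x\<in>incident_verts E\<^sub>2. \<forall>y\<in>incident_verts E\<^sub>2. \<forall>fs. edge_path E\<^sub>2 x fs y \<longrightarrow>
        dist x y = norm (\<Sum>f\<leftarrow>fs. edge_length f *\<^sub>R molecule (inv_into E\<^sub>1 \<sigma> f)))"

text \<open>
  Maps between edge sets are total functions in HOL; extensionality fixes their values
  outside \<open>E\<^sub>1\<close>, so that distinct elements below are distinct bijections.
\<close>

definition edge_bijections ::
  "('a \<times> 'a) set \<Rightarrow> ('b \<times> 'b) set \<Rightarrow> ('a \<times> 'a \<Rightarrow> 'b \<times> 'b) set" where
  "edge_bijections E\<^sub>1 E\<^sub>2 = {\<sigma> \<in> extensional E\<^sub>1. bij_betw \<sigma> E\<^sub>1 E\<^sub>2}"

definition induces ::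
  "('a::metric_space \<times> 'a \<Rightarrow> 'b::metric_space \<times> 'b) \<Rightarrow> ('a lipfree \<Rightarrow> 'b lipfree) \<Rightarrow> bool" where
  "induces \<sigma> T \<longleftrightarrow> linear_isometry T \<and> (\<forall>e\<in>ext_edges. T (molecule e) = molecule (\<sigma> e))"

definition induced_isometry ::
  "('a::metric_space \<times> 'a \<Rightarrow> 'b::metric_space \<times> 'b) \<Rightarrow> 'a lipfree \<Rightarrow> 'b lipfree" where
  "induced_isometry \<sigma> = (THE T. induces \<sigma> T)"

definition surj_linear_isometries ::
  "('a::metric_space lipfree \<Rightarrow> 'b::metric_space lipfree) set" where
  "surj_linear_isometries = {T. linear_isometry T \<and> surj T}"

end

theory Submission
  imports Defs
begin

text \<open>
  An edge \<open>e\<close> belongs to \<open>E\<^sub>e\<^sub>x\<^sub>t\<close> by virtue of an extremality property of the vector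
  \<open>m\<^sub>e\<close>, and a surjective linear isometry \<open>T\<close> of the free spaces induces one of the biduals,
  so \<open>T\<close> maps \<open>m\<^sub>e\<close> to an extreme point of the bidual ball
  (\<open>linear_isometry_preserves_bidual_extreme\<close>). The analytic heart of the proof is that such a
  point, once it lies in the free space, is again a molecule (\<open>extreme_is_molecule\<close>). Hence
  \<open>T\<close> induces a bijection \<open>\<sigma>\<close> of the edge sets.

  Two facts give \<open>extreme_is_molecule\<close>. First, the unit ball is the closed convex hull of the
  molecules, so by Milman's converse to the Krein--Milman theorem an extreme point of the bidual
  ball in the free space is a weak limit of molecules (\<open>extreme_in_weak_closure\<close>). The
  Hahn--Banach theorem enters here: if the molecules are split into two parts, a Hahn--Banach
  functional splits \<open>x\<close> into two pieces of the bidual ball, and extremality forces \<open>x\<close> into the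
  weak closed hull of one part. Second, weak limits of molecules are molecules when the metric
  space is complete (\<open>weak_limit_of_molecules_is_molecule\<close>): finitely many Lipschitz functions
  force the two points of a nearby molecule to stay at a distance bounded away from zero and
  infinity, and close to a finite set, so that \<open>x\<close> is even a norm limit of molecules
  of bounded length.

  Conditions (Sa) and (Sb) are linear algebra. The length-weighted sum of the molecules of a path
  telescopes, so it vanishes along a closed path; simple cycles are exactly the minimal sets of
  edges whose molecules satisfy a linear relation with positive coefficients
  (\<open>simple_cycle_iff_minimal_positively_dependent\<close>), and this relation is unique up to a factor
  (\<open>cycle_relation_constant\<close>). An injective linear map preserves minimal positive relations,
  which is (Sa), and comparing the two length-weighted relations on a cycle and on its image is
  (Sb). Condition (Sc) says that \<open>T\<close> preserves the norm of the telescoped sums.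

  Conversely, (Sc) makes the sum of \<open>d(e) m\<^sub>\<sigma>\<^sub>(\<^sub>e\<^sub>)\<close> along a path depend on the endpoints only: the
  norm of such a sum along a closed path is \<open>d(x,x) = 0\<close>. So it is a difference \<open>t(x) - t(y)\<close>, the
  map \<open>t\<close> is \<open>1\<close>-Lipschitz on the dense set of vertices, and by the universal property of the
  free space its extension linearises to a contraction with \<open>m\<^sub>e \<mapsto> m\<^sub>\<sigma>\<^sub>(\<^sub>e\<^sub>)\<close>. The inverse of \<open>\<sigma>\<close> gives
  a contraction in the other direction, and the two are mutually inverse because the molecules
  of the edges span a dense subspace (\<open>exists_isometry\<close>). In Prague spaces (Sc) follows from (Sa)
  and (Sb): a closed path decomposes into simple cycles, on each of which the transported sum is
  a multiple of a vanishing one, and the triangle inequality along almost shortest paths bounds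
  the norm by the distance (\<open>admissible_imp_cond_Sc\<close>).
\<close>

section \<open>The Hahn--Banach theorem\<close>

definition sublinear :: "('v::real_vector \<Rightarrow> real) \<Rightarrow> bool" where
  "sublinear p \<longleftrightarrow> (\<forall>x y. p (x + y) \<le> p x + p y) \<and> (\<forall>c x. 0 < c \<longrightarrow> p (c *\<^sub>R x) \<le> c * p x)"

lemma sublinearI:
  assumes "\<And>x y. p (x + y) \<le> p x + p y" "\<And>c x. 0 < c \<Longrightarrow> p (c *\<^sub>R x) \<le> c * p x"
  shows "sublinear p"
  using assms by (auto simp: sublinear_def)

lemma sublinear_add: "sublinear p \<Longrightarrow> p (x + y) \<le> p x + p y"
  by (simp add: sublinear_def)

lemma sublinear_scale:
  assumes "sublinear p" "0 < c"
  shows "p (c *\<^sub>R x) = c * p x"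
proof (rule antisym)
  show "p (c *\<^sub>R x) \<le> c * p x"
    using assms by (simp add: sublinear_def)
  have "p (inverse c *\<^sub>R (c *\<^sub>R x)) \<le> inverse c * p (c *\<^sub>R x)"
    using assms unfolding sublinear_def by (metis inverse_positive_iff_positive)
  then show "c * p x \<le> p (c *\<^sub>R x)"
    using assms by (simp add: field_simps)
qed

lemma sublinear_zero: "sublinear p \<Longrightarrow> p 0 = 0"
  using sublinear_scale[of p 2 0] by simp

lemma sublinear_minus: "sublinear p \<Longrightarrow> - p (- x) \<le> p x"
  using sublinear_add[of p x "- x"] sublinear_zero[of p] by simp

lemma sublinear_additive_imp_linear:
  assumes p: "sublinear p" and add: "\<And>x y. p (x + y) = p x + p y"
  shows "linear p"
proof (rule linearI)
  have neg: "p (- x) = - p x" for x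
    using add[of x "- x"] sublinear_zero[OF p] by simp
  fix c :: real and x
  consider "c > 0" | "c = 0" | "- c > 0"
    by (cases c "0 :: real" rule: linorder_cases) auto
  then show "p (c *\<^sub>R x) = c *\<^sub>R p x"
  proof cases
    case 3
    have "p (c *\<^sub>R x) = - p ((- c) *\<^sub>R x)"
      by (simp flip: neg)
    then show ?thesis
      using sublinear_scale[OF p 3, of x] by simp
  qed (use sublinear_scale[OF p] sublinear_zero[OF p] in auto)
qed (rule add)

text \<open>
  The infimal convolution of \<open>p\<close> with a linear functional on a convex cone is the device behind both
  halves of the Hahn--Banach theorem: along a half-line it shows that a minimal sublinear
  functional is additive, and along a subspace it builds the prescribed values into the bound.
\<close>

lemma sublinear_inf_convolution:
  fixes p :: "'v::real_vector \<Rightarrow> real" and f :: "'w::real_vector \<Rightarrow> real" and g :: "'w \<Rightarrow> 'v"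
  assumes p: "sublinear p"
    and W0: "0 \<in> W" and Wadd: "\<And>v w. v \<in> W \<Longrightarrow> w \<in> W \<Longrightarrow> v + w \<in> W"
    and Wscale: "\<And>c w. 0 < c \<Longrightarrow> w \<in> W \<Longrightarrow> c *\<^sub>R w \<in> W"
    and f: "linear f" and g: "linear g" and le: "\<And>w. w \<in> W \<Longrightarrow> f w \<le> p (g w)"
  defines "q \<equiv> \<lambda>z. INF w\<in>W. p (z + g w) - f w"
  shows "sublinear q" and "\<And>z w. w \<in> W \<Longrightarrow> q z \<le> p (z + g w) - f w"
proof -
  have bdd: "bdd_below ((\<lambda>w. p (z + g w) - f w) ` W)" for z
  proof (rule bdd_belowI2)
    fix w assume "w \<in> W"
    have "f w \<le> p ((z + g w) + - z)"
      using le[OF \<open>w \<in> W\<close>] by simp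
    also have "\<dots> \<le> p (z + g w) + p (- z)"
      by (rule sublinear_add[OF p])
    finally show "- p (- z) \<le> p (z + g w) - f w" by simp
  qed
  show upper: "q z \<le> p (z + g w) - f w" if "w \<in> W" for z w
    unfolding q_def using that by (intro cINF_lower bdd) auto
  have lower: "K \<le> q z" if "\<And>w. w \<in> W \<Longrightarrow> K \<le> p (z + g w) - f w" for K z
    unfolding q_def using that W0 by (intro cINF_greatest) auto
  show "sublinear q"
  proof (rule sublinearI)
    fix x y
    have "q (x + y) - (p (y + g w) - f w) \<le> q x" if "w \<in> W" for w
    proof (rule lower)
      fix v assume "v \<in> W"
      have "q (x + y) \<le> p ((x + g v) + (y + g w)) - f (v + w)"
        using upper[OF Wadd[OF \<open>v \<in> W\<close> that], of "x + y"] by (simp add: linear_add[OF g] algebra_simps)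
      also have "\<dots> \<le> p (x + g v) + p (y + g w) - (f v + f w)"
        using sublinear_add[OF p] linear_add[OF f] by simp
      finally show "q (x + y) - (p (y + g w) - f w) \<le> p (x + g v) - f v" by simp
    qed
    then have "q (x + y) - q x \<le> q y"
      by (intro lower) (simp add: algebra_simps)
    then show "q (x + y) \<le> q x + q y" by simp
  next
    fix c :: real and x assume c: "0 < c"
    have "inverse c * q (c *\<^sub>R x) \<le> q x"
    proof (rule lower)
      fix w assume "w \<in> W"
      have "q (c *\<^sub>R x) \<le> p (c *\<^sub>R (x + g w)) - f (c *\<^sub>R w)"
        using upper[OF Wscale[OF c \<open>w \<in> W\<close>], of "c *\<^sub>R x"] by (simp add: linear_scale[OF g] algebra_simps)
      also have "\<dots> = c * (p (x + g w) - f w)"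
        using sublinear_scale[OF p c, of "x + g w"] linear_scale[OF f, of c w]
        by (simp add: right_diff_distrib)
      finally show "inverse c * q (c *\<^sub>R x) \<le> p (x + g w) - f w"
        using c by (simp add: field_simps)
    qed
    then show "q (c *\<^sub>R x) \<le> c * q x"
      using c by (simp add: field_simps)
  qed
qed

text \<open>
  Zorn's lemma applies because the pointwise infimum of a chain of sublinear functionals below \<open>p\<close> is
  finite: each of them is bounded below at \<open>x\<close> by \<open>-p(-x)\<close>.
\<close>

lemma minimal_sublinear_below:
  fixes p :: "'v::real_vector \<Rightarrow> real"
  assumes p: "sublinear p"
  obtains q where "sublinear q" "q \<le> p" "\<And>r. sublinear r \<Longrightarrow> r \<le> q \<Longrightarrow> r = q"
proof -
  define S where "S = {q. sublinear q \<and> q \<le> p}"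
  have "\<exists>m\<in>S. \<forall>a\<in>S. m \<ge> a \<longrightarrow> a = m"
  proof (rule predicate_Zorn)
    show "partial_order_on S (relation_of (\<ge>) S)"
      by (rule partial_order_on_relation_ofI) auto
    fix C assume "C \<in> Chains (relation_of (\<ge>) S)"
    then have CS: "C \<subseteq> S" and chain: "\<And>a b. a \<in> C \<Longrightarrow> b \<in> C \<Longrightarrow> a \<le> b \<or> b \<le> a"
      by (auto simp: Chains_def relation_of_def)
    show "\<exists>u\<in>S. \<forall>a\<in>C. a \<ge> u"
    proof (cases "C = {}")
      case True
      then show ?thesis using p by (auto simp: S_def)
    next
      case False
      define u where "u = (\<lambda>x. INF q\<in>C. q x)"
      have bdd: "bdd_below ((\<lambda>q. q x) ` C)" for x
      proof (rule bdd_belowI2)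
        fix q assume "q \<in> C"
        then have "sublinear q" "q (- x) \<le> p (- x)"
          using CS by (auto simp: S_def le_fun_def)
        then show "- p (- x) \<le> q x"
          using sublinear_minus[of q x] by simp
      qed
      have upper: "u x \<le> q x" if "q \<in> C" for q x
        unfolding u_def using that by (intro cINF_lower bdd)
      have lower: "K \<le> u x" if "\<And>q. q \<in> C \<Longrightarrow> K \<le> q x" for K x
        unfolding u_def using that False by (intro cINF_greatest)
      have "sublinear u"
      proof (rule sublinearI)
        fix x y
        have "u (x + y) - r y \<le> u x" if r: "r \<in> C" for r
        proof (rule lower)
          fix q assume "q \<in> C"
          then obtain s where s: "s \<in> C" "s \<le> q" "s \<le> r"
            using chain[OF \<open>q \<in> C\<close> r] r by auto
          then have "u (x + y) \<le> s x + s y"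
            using upper[OF \<open>s \<in> C\<close>, of "x + y"] sublinear_add[of s x y] CS by (force simp: S_def)
          also have "\<dots> \<le> q x + r y"
            using s by (intro add_mono) (auto simp: le_fun_def)
          finally show "u (x + y) - r y \<le> q x" by simp
        qed
        then have "u (x + y) - u x \<le> u y"
          by (intro lower) (simp add: algebra_simps)
        then show "u (x + y) \<le> u x + u y" by simp
      next
        fix c :: real and x assume c: "0 < c"
        have "inverse c * u (c *\<^sub>R x) \<le> u x"
        proof (rule lower)
          fix q assume "q \<in> C"
          then show "inverse c * u (c *\<^sub>R x) \<le> q x"
            using upper[of q "c *\<^sub>R x"] sublinear_scale[of q c x] CS c
            by (auto simp: S_def field_simps)
        qed
        then show "u (c *\<^sub>R x) \<le> c * u x"
          using c by (simp add: field_simps)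
      qed
      moreover have "u \<le> p"
      proof (rule le_funI)
        fix x
        obtain q where "q \<in> C" using False by auto
        then show "u x \<le> p x"
          using upper[of q x] CS by (auto simp: S_def le_fun_def intro: order_trans)
      qed
      ultimately show ?thesis
        using upper by (auto simp: S_def le_fun_def)
    qed
  qed
  then obtain q where q: "q \<in> S" "\<And>a. a \<in> S \<Longrightarrow> a \<le> q \<Longrightarrow> a = q" by auto
  show ?thesis
    by (rule that[of q]) (use q in \<open>auto simp: S_def intro: order_trans\<close>)
qed

text \<open>
  A minimal sublinear functional \<open>q\<close> is linear: lowering it in the direction \<open>y\<close> yields a sublinear
  functional below \<open>q\<close>, hence \<open>q\<close> itself, and this says \<open>q(x) + q(y) \<le> q(x + y)\<close>.
\<close>

lemma linear_below_sublinear: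
  fixes p :: "'v::real_vector \<Rightarrow> real"
  assumes p: "sublinear p"
  obtains L where "linear L" "\<And>x. L x \<le> p x"
proof -
  obtain q where q: "sublinear q" "q \<le> p" and min: "\<And>r. sublinear r \<Longrightarrow> r \<le> q \<Longrightarrow> r = q"
    using minimal_sublinear_below[OF p] by blast
  have "q (x + y) = q x + q y" for x y
  proof (rule antisym)
    show "q (x + y) \<le> q x + q y" by (rule sublinear_add[OF q(1)])
    let ?r = "\<lambda>z. INF t\<in>{0..}. q (z + t *\<^sub>R y) - t * q y"
    have lin: "linear (\<lambda>t. t * q y)" "linear (\<lambda>t. t *\<^sub>R y)"
      by (auto intro!: linearI simp: algebra_simps)
    have dom: "t * q y \<le> q (t *\<^sub>R y)" if "t \<in> {0..}" for t
      using that sublinear_scale[OF q(1), of t y] sublinear_zero[OF q(1)] by (cases "t = 0") auto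
    have *: "sublinear ?r" "\<And>z t. 0 \<le> t \<Longrightarrow> ?r z \<le> q (z + t *\<^sub>R y) - t * q y"
      by (rule sublinear_inf_convolution(1)[OF q(1) _ _ _ lin dom] sublinear_inf_convolution(2)[OF q(1) _ _ _ lin dom];
          simp)+
    have "?r = q"
    proof (rule min[OF *(1)], rule le_funI)
      show "?r z \<le> q z" for z using *(2)[of 0 z] by simp
    qed
    then have "?r x = q x" by (rule fun_cong)
    then show "q x + q y \<le> q (x + y)"
      using *(2)[of 1 x] by simp
  qed
  then have "linear q"
    by (rule sublinear_additive_imp_linear[OF q(1)])
  then show ?thesis
    using that q(2) by (auto simp: le_fun_def)
qed

text \<open>
  The prescribed functional lives on the range of a linear map \<open>g\<close> and is given through the
  parameter \<open>w\<close>. The subspace on which it is defined need not be described separately then, and its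
  well-definedness follows from the domination.
\<close>

lemma Hahn_Banach_dominated_extension:
  fixes p :: "'v::real_vector \<Rightarrow> real" and f :: "'w::real_vector \<Rightarrow> real" and g :: "'w \<Rightarrow> 'v"
  assumes p: "sublinear p" and f: "linear f" and g: "linear g" and le: "\<And>w. f w \<le> p (g w)"
  shows "\<exists>L. linear L \<and> (\<forall>x. L x \<le> p x) \<and> (\<forall>w. L (g w) = f w)"
proof -
  let ?q = "\<lambda>z. INF w. p (z + g w) - f w"
  have q: "sublinear ?q" "\<And>z w. ?q z \<le> p (z + g w) - f w"
    using sublinear_inf_convolution[OF p _ _ _ f g le, of UNIV] by auto
  obtain L where L: "linear L" "\<And>x. L x \<le> ?q x"
    using linear_below_sublinear[OF q(1)] by blast
  have Lp: "L x \<le> p (x + g w) - f w" for x w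
    using L(2) q(2) order_trans by blast
  have half: "L (g w) \<le> f w" for w
    using Lp[of "g w" "- w"] sublinear_zero[OF p] by (simp add: linear_neg[OF f] linear_neg[OF g])
  show ?thesis
  proof (intro exI[of _ L] conjI allI L(1))
    show "L x \<le> p x" for x
      using Lp[of x 0] by (simp add: linear_0[OF f] linear_0[OF g])
    show "L (g w) = f w" for w
      using half[of w] half[of "- w"]
      by (simp add: linear_neg[OF f] linear_neg[OF g] linear_neg[OF L(1)])
  qed
qed

section \<open>Extreme points of the bidual ball and weak closures\<close>

text \<open>
  The weak closed convex hull, in the dual description given by Hahn--Banach separation: the
  intersection of the closed half-spaces that contain \<open>A\<close>.
\<close>

definition weak_hull :: "'b::real_normed_vector set \<Rightarrow> 'b set" where
  "weak_hull A = {x. \<forall>(\<phi> :: 'b \<Rightarrow>\<^sub>L real) c. (\<forall>a\<in>A. \<phi> a \<le> c) \<longrightarrow> \<phi> x \<le> c}"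

lemma weak_hullI:
  assumes "\<And>(\<phi> :: 'b::real_normed_vector \<Rightarrow>\<^sub>L real) c. (\<And>a. a \<in> A \<Longrightarrow> \<phi> a \<le> c) \<Longrightarrow> \<phi> x \<le> c"
  shows "x \<in> weak_hull A"
  using assms by (auto simp: weak_hull_def)

lemma weak_hullD:
  fixes \<phi> :: "'b::real_normed_vector \<Rightarrow>\<^sub>L real"
  assumes "x \<in> weak_hull A" "\<And>a. a \<in> A \<Longrightarrow> \<phi> a \<le> c"
  shows "\<phi> x \<le> c"
  using assms by (auto simp: weak_hull_def)

lemma weak_hull_empty [simp]: "weak_hull {} = {}"
  using weak_hullD[of _ "{}" 0 "-1"] by auto

lemma blinfun_le_norm:
  fixes \<phi> :: "'b::real_normed_vector \<Rightarrow>\<^sub>L real"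
  assumes "norm a \<le> 1"
  shows "\<phi> a \<le> norm \<phi>"
proof -
  have "\<phi> a \<le> norm \<phi> * norm a"
    using norm_blinfun[of \<phi> a] by simp
  also have "\<dots> \<le> norm \<phi>"
    using assms by (simp add: mult_left_le)
  finally show ?thesis .
qed

text \<open>
  Affine instead of linear functions are used because a functional on pairs \<open>(\<phi>, s)\<close> that is dominated
  by this supremum has a total mass on \<open>A\<close>, namely its value at \<open>(0, 1)\<close>.
\<close>

definition affine_support :: "'b::real_normed_vector set \<Rightarrow> ('b \<Rightarrow>\<^sub>L real) \<times> real \<Rightarrow> real" where
  "affine_support A u = (SUP a\<in>A. fst u a + snd u)"

lemma affine_support_le:
  fixes A :: "'b::real_normed_vector set" and u :: "('b \<Rightarrow>\<^sub>L real) \<times> real"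
  assumes "A \<noteq> {}" "\<And>a. a \<in> A \<Longrightarrow> fst u a + snd u \<le> K"
  shows "affine_support A u \<le> K"
  unfolding affine_support_def using assms by (intro cSUP_least)

lemma affine_support_upper:
  fixes A :: "'b::real_normed_vector set" and u :: "('b \<Rightarrow>\<^sub>L real) \<times> real"
  assumes "A \<subseteq> cball 0 1" "a \<in> A"
  shows "fst u a + snd u \<le> affine_support A u"
  unfolding affine_support_def
proof (rule cSUP_upper[OF \<open>a \<in> A\<close>], rule bdd_aboveI2)
  show "fst u a + snd u \<le> norm (fst u) + snd u" if "a \<in> A" for a
    using assms(1) that by (auto intro!: blinfun_le_norm)
qed

lemma sublinear_affine_support:
  fixes A :: "'b::real_normed_vector set"
  assumes "A \<noteq> {}" "A \<subseteq> cball 0 1"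
  shows "sublinear (affine_support A)"
proof (rule sublinearI)
  fix u v :: "('b \<Rightarrow>\<^sub>L real) \<times> real" and c :: real
  show "affine_support A (u + v) \<le> affine_support A u + affine_support A v"
  proof (rule affine_support_le[OF assms(1)])
    fix a assume "a \<in> A"
    then show "fst (u + v) a + snd (u + v) \<le> affine_support A u + affine_support A v"
      using affine_support_upper[OF assms(2), of a u] affine_support_upper[OF assms(2), of a v]
      by (simp add: blinfun.add_left)
  qed
  show "affine_support A (c *\<^sub>R u) \<le> c * affine_support A u" if "0 < c"
  proof (rule affine_support_le[OF assms(1)])
    fix a assume "a \<in> A"
    then have "c * (fst u a + snd u) \<le> c * affine_support A u"
      using affine_support_upper[OF assms(2), of a u] that by (intro mult_left_mono) auto
    then show "fst (c *\<^sub>R u) a + snd (c *\<^sub>R u) \<le> c * affine_support A u"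
      by (simp add: blinfun.scaleR_left algebra_simps)
  qed
qed

text \<open>
  In the bidual, the weak* closed convex hull of \<open>A \<union> B\<close> consists of the convex combinations
  \<open>t a + (1 - t) b\<close> of points of the hulls of \<open>A\<close> and \<open>B\<close>. Here \<open>u = t a\<close> and \<open>v = (1 - t) b\<close>. They come
  from one Hahn--Banach functional on two copies of the space of affine functions: on the diagonal it
  is evaluation at \<open>x\<close>, and it is dominated by the larger of the suprema over \<open>A\<close> and over \<open>B\<close>.
\<close>

lemma weak_hull_Un_split:
  fixes x :: "'b::real_normed_vector"
  assumes A: "A \<noteq> {}" "A \<subseteq> cball 0 1" and B: "B \<noteq> {}" "B \<subseteq> cball 0 1"
    and x: "x \<in> weak_hull (A \<union> B)"
  obtains t and u v :: "('b \<Rightarrow>\<^sub>L real) \<Rightarrow> real" where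
    "0 \<le> t" "t \<le> 1" "linear u" "linear v" "\<And>\<phi> :: 'b \<Rightarrow>\<^sub>L real. blinfun_apply \<phi> x = u \<phi> + v \<phi>"
    "\<And>(\<phi> :: 'b \<Rightarrow>\<^sub>L real) c. (\<And>a. a \<in> A \<Longrightarrow> blinfun_apply \<phi> a \<le> c) \<Longrightarrow> u \<phi> \<le> t * c"
    "\<And>(\<phi> :: 'b \<Rightarrow>\<^sub>L real) c. (\<And>b. b \<in> B \<Longrightarrow> blinfun_apply \<phi> b \<le> c) \<Longrightarrow> v \<phi> \<le> (1 - t) * c"
proof -
  note sub = sublinear_affine_support[OF A] sublinear_affine_support[OF B]
  define P where "P = (\<lambda>w. max (affine_support A (fst w)) (affine_support B (snd w)))"
  have "sublinear P"
  proof (rule sublinearI)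
    fix w z
    show "P (w + z) \<le> P w + P z"
      using sublinear_add[OF sub(1), of "fst w" "fst z"] sublinear_add[OF sub(2), of "snd w" "snd z"]
      unfolding P_def fst_add snd_add by linarith
    show "P (c *\<^sub>R w) \<le> c * P w" if "0 < c" for c
      using sublinear_scale[OF sub(1) that] sublinear_scale[OF sub(2) that] that
      by (simp add: P_def max_mult_distrib_left)
  qed
  moreover have "linear (\<lambda>w :: ('b \<Rightarrow>\<^sub>L real) \<times> real. blinfun_apply (fst w) x + snd w)"
    by (rule linearI) (auto simp: blinfun.add_left blinfun.scaleR_left algebra_simps)
  moreover have "linear (\<lambda>w :: ('b \<Rightarrow>\<^sub>L real) \<times> real. (w, w))"
    by (rule linearI) auto
  moreover have "blinfun_apply (fst w) x + snd w \<le> P (w, w)" for w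
  proof -
    have "blinfun_apply (fst w) x \<le> P (w, w) - snd w"
    proof (rule weak_hullD[OF x])
      fix a assume "a \<in> A \<union> B"
      then have "blinfun_apply (fst w) a + snd w \<le> P (w, w)"
        using affine_support_upper[OF A(2), of a w] affine_support_upper[OF B(2), of a w]
        by (auto simp: P_def)
      then show "blinfun_apply (fst w) a \<le> P (w, w) - snd w" by simp
    qed
    then show ?thesis by simp
  qed
  ultimately have "\<exists>L. linear L \<and> (\<forall>w. L w \<le> P w) \<and> (\<forall>w. L (w, w) = blinfun_apply (fst w) x + snd w)"
    by (rule Hahn_Banach_dominated_extension)
  then obtain L where L: "linear L" "\<And>w. L w \<le> P w"
    and Lx: "\<And>w. L (w, w) = blinfun_apply (fst w) x + snd w"
    by blast
  \<comment> \<open>The weight \<open>t\<close> is the mass of the first copy; the constant function has total mass \<open>1\<close>.\<close>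
  define t where "t = L ((0, 1), 0)"
  define u where "u = (\<lambda>\<phi>. L ((\<phi>, 0), 0))"
  define v where "v = (\<lambda>\<phi>. L (0, (\<phi>, 0)))"
  have split: "L (w, z) = L (w, 0) + L (0, z)" for w z
    using linear_add[OF L(1), of "(w, 0)" "(0, z)"] by simp
  have t': "L (0, (0, 1)) = 1 - t"
    using split[of "(0, 1)" "(0, 1)"] Lx[of "(0, 1)"] by (simp add: t_def)
  have Lu: "L ((\<phi>, s), 0) = u \<phi> + s * t" for \<phi> :: "'b \<Rightarrow>\<^sub>L real" and s
  proof -
    have "L ((\<phi>, s), 0) = L (((\<phi>, 0), 0) + s *\<^sub>R ((0, 1), 0))"
      by simp
    then show ?thesis
      unfolding u_def t_def linear_add[OF L(1)] linear_scale[OF L(1)] by simp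
  qed
  have Lv: "L (0, (\<phi>, s)) = v \<phi> + s * (1 - t)" for \<phi> :: "'b \<Rightarrow>\<^sub>L real" and s
  proof -
    have "L (0, (\<phi>, s)) = L ((0, (\<phi>, 0)) + s *\<^sub>R (0, (0, 1)))"
      by simp
    then show ?thesis
      unfolding v_def t'[symmetric] linear_add[OF L(1)] linear_scale[OF L(1)] by simp
  qed
  have u_le: "u \<phi> \<le> t * c" if "\<And>a. a \<in> A \<Longrightarrow> blinfun_apply \<phi> a \<le> c" for \<phi> :: "'b \<Rightarrow>\<^sub>L real" and c
  proof -
    \<comment> \<open>Shifting \<open>\<phi>\<close> by the constant \<open>-c\<close> makes it nonpositive on \<open>A\<close>, so the dominating function vanishes.\<close>
    have "affine_support A (\<phi>, - c) \<le> 0"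
      using that by (intro affine_support_le[OF A(1)]) auto
    then have "P ((\<phi>, - c), 0) \<le> 0"
      using sublinear_zero[OF sub(2)] by (simp add: P_def)
    then show ?thesis
      using L(2)[of "((\<phi>, - c), 0)"] by (simp add: Lu algebra_simps)
  qed
  have v_le: "v \<phi> \<le> (1 - t) * c" if "\<And>b. b \<in> B \<Longrightarrow> blinfun_apply \<phi> b \<le> c" for \<phi> :: "'b \<Rightarrow>\<^sub>L real" and c
  proof -
    have "affine_support B (\<phi>, - c) \<le> 0"
      using that by (intro affine_support_le[OF B(1)]) auto
    then have "P (0, (\<phi>, - c)) \<le> 0"
      using sublinear_zero[OF sub(1)] by (simp add: P_def)
    then show ?thesis
      using L(2)[of "(0, (\<phi>, - c))"] by (simp add: Lv algebra_simps)
  qed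
  have lin: "linear (\<lambda>\<phi>. ((\<phi>, 0), 0))" "linear (\<lambda>\<phi>. (0, (\<phi>, 0)))"
    by (auto intro!: linearI)
  have uv: "linear u" "linear v"
    unfolding u_def v_def using linear_compose[OF lin(1) L(1)] linear_compose[OF lin(2) L(1)]
    by (simp_all add: o_def)
  have zero: "u 0 = 0" "v 0 = 0" using uv linear_0 by auto
  show ?thesis
  proof (rule that[OF _ _ uv _ u_le v_le])
    show "0 \<le> t" using u_le[of 0 1] zero by simp
    show "t \<le> 1" using v_le[of 0 1] zero by simp
    show "blinfun_apply \<phi> x = u \<phi> + v \<phi>" for \<phi> :: "'b \<Rightarrow>\<^sub>L real"
      using Lx[of "(\<phi>, 0)"] split[of "(\<phi>, 0)" "(\<phi>, 0)"] by (simp add: u_def v_def)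
  qed
qed

text \<open>
  Of the two pieces of \<open>x\<close> furnished by the splitting, each lies in the bidual ball after
  normalisation. If both have positive weight, extremality makes them equal to \<open>x\<close>; if one has
  weight \<open>0\<close>, the other is \<open>x\<close>.
\<close>

lemma extreme_weak_hull_Un:
  fixes x :: "'b::real_normed_vector"
  assumes ext: "bidual_embed x extreme_point_of cball 0 1"
    and AB: "A \<subseteq> cball 0 1" "B \<subseteq> cball 0 1" and x: "x \<in> weak_hull (A \<union> B)"
  shows "x \<in> weak_hull A \<or> x \<in> weak_hull B"
proof (cases "A = {} \<or> B = {}")
  case True
  then show ?thesis using x by auto
next
  case False
  then obtain t and u v :: "('b \<Rightarrow>\<^sub>L real) \<Rightarrow> real" where t: "0 \<le> t" "t \<le> 1"
    and lin: "linear u" "linear v" and x_eq: "\<And>\<phi> :: 'b \<Rightarrow>\<^sub>L real. blinfun_apply \<phi> x = u \<phi> + v \<phi>"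
    and u: "\<And>(\<phi> :: 'b \<Rightarrow>\<^sub>L real) c. (\<And>a. a \<in> A \<Longrightarrow> blinfun_apply \<phi> a \<le> c) \<Longrightarrow> u \<phi> \<le> t * c"
    and v: "\<And>(\<phi> :: 'b \<Rightarrow>\<^sub>L real) c. (\<And>b. b \<in> B \<Longrightarrow> blinfun_apply \<phi> b \<le> c) \<Longrightarrow> v \<phi> \<le> (1 - t) * c"
    using weak_hull_Un_split[of A B x] AB x by metis
  have u_norm: "u \<phi> \<le> t * norm \<phi>" and v_norm: "v \<phi> \<le> (1 - t) * norm \<phi>" for \<phi> :: "'b \<Rightarrow>\<^sub>L real"
    using AB by (auto intro!: u v blinfun_le_norm)
  have u_abs: "\<bar>u \<phi>\<bar> \<le> t * norm \<phi>" and v_abs: "\<bar>v \<phi>\<bar> \<le> (1 - t) * norm \<phi>" for \<phi> :: "'b \<Rightarrow>\<^sub>L real"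
    using u_norm[of \<phi>] u_norm[of "- \<phi>"] v_norm[of \<phi>] v_norm[of "- \<phi>"]
    by (auto simp: linear_neg[OF lin(1)] linear_neg[OF lin(2)])
  consider "t = 0" | "t = 1" | "0 < t" "t < 1" using t by linarith
  then show ?thesis
  proof cases
    case 1
    then have "x \<in> weak_hull B"
      using u_abs v by (intro weak_hullI) (fastforce simp: x_eq)
    then show ?thesis ..
  next
    case 2
    then have "x \<in> weak_hull A"
      using v_abs u by (intro weak_hullI) (fastforce simp: x_eq)
    then show ?thesis ..
  next
    case 3
    define a where "a = Blinfun (\<lambda>\<phi>. u \<phi> / t)"
    define b where "b = Blinfun (\<lambda>\<phi>. v \<phi> / (1 - t))"
    have "bounded_linear (\<lambda>\<phi>. u \<phi> / t)"
    proof (rule bounded_linear_intro[of _ 1])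
      show "norm (u \<phi> / t) \<le> norm \<phi> * 1" for \<phi>
        using u_abs[of \<phi>] 3 by (simp add: field_simps)
    qed (simp_all add: linear_add[OF lin(1)] linear_scale[OF lin(1)] add_divide_distrib)
    then have a: "a \<phi> = u \<phi> / t" for \<phi> :: "'b \<Rightarrow>\<^sub>L real"
      by (simp add: a_def bounded_linear_Blinfun_apply)
    have "bounded_linear (\<lambda>\<phi>. v \<phi> / (1 - t))"
    proof (rule bounded_linear_intro[of _ 1])
      show "norm (v \<phi> / (1 - t)) \<le> norm \<phi> * 1" for \<phi>
        using v_abs[of \<phi>] 3 by (simp add: field_simps)
    qed (simp_all add: linear_add[OF lin(2)] linear_scale[OF lin(2)] add_divide_distrib)
    then have b: "b \<phi> = v \<phi> / (1 - t)" for \<phi> :: "'b \<Rightarrow>\<^sub>L real"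
      by (simp add: b_def bounded_linear_Blinfun_apply)
    have "norm a \<le> 1" "norm b \<le> 1"
      using u_abs v_abs 3 by (auto intro!: norm_blinfun_bound simp: a b field_simps)
    moreover have x_ab: "bidual_embed x = (1 - (1 - t)) *\<^sub>R a + (1 - t) *\<^sub>R b"
      using 3 by (intro blinfun_eqI) (simp add: a b x_eq blinfun.add_left blinfun.scaleR_left)
    moreover have "bidual_embed x \<in> open_segment a b" if "a \<noteq> b"
      unfolding in_segment using that x_ab 3 by (intro conjI exI[of _ "1 - t"]) auto
    ultimately have "a = b"
      using ext by (auto simp: extreme_point_of_def)
    then have "bidual_embed x = a"
      using x_ab by (simp flip: scaleR_add_left)
    then have "blinfun_apply \<phi> x = u \<phi> / t" for \<phi> :: "'b \<Rightarrow>\<^sub>L real"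
      using a by (metis bidual_embed.rep_eq)
    moreover have "u \<phi> / t \<le> c" if "\<And>a. a \<in> A \<Longrightarrow> blinfun_apply \<phi> a \<le> c" for \<phi> c
      using u[OF that] 3 by (simp add: field_simps)
    ultimately have "x \<in> weak_hull A"
      by (intro weak_hullI) simp
    then show ?thesis ..
  qed
qed

lemma extreme_weak_hull_UN:
  fixes x :: "'b::real_normed_vector"
  assumes ext: "bidual_embed x extreme_point_of cball 0 1"
    and "finite I" "\<And>i. i \<in> I \<Longrightarrow> A i \<subseteq> cball 0 1" "x \<in> weak_hull (\<Union>i\<in>I. A i)"
  shows "\<exists>i\<in>I. x \<in> weak_hull (A i)"
  using assms(2-)
proof (induction I)
  case (insert i I)
  then have "x \<in> weak_hull (A i) \<or> x \<in> weak_hull (\<Union>i\<in>I. A i)"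
    by (intro extreme_weak_hull_Un[OF ext]) auto
  then show ?case using insert by auto
qed auto

text \<open>
  Milman's converse to the Krein--Milman theorem. If no point of \<open>V\<close> were close to \<open>x\<close>, then \<open>V\<close> would
  be covered by finitely many parts, on each of which one functional \<open>\<plusminus>g\<close> separates from \<open>x\<close>; but
  \<open>x\<close> lies in the weak hull of one of the parts.
\<close>

lemma extreme_in_weak_closure:
  fixes x :: "'b::real_normed_vector" and G :: "('b \<Rightarrow>\<^sub>L real) set"
  assumes ext: "bidual_embed x extreme_point_of cball 0 1"
    and V: "V \<subseteq> cball 0 1" "x \<in> weak_hull V" and "finite G" "0 < \<epsilon>"
  shows "\<exists>a\<in>V. \<forall>g\<in>G. \<bar>g a - g x\<bar> < \<epsilon>"
proof (rule ccontr)
  assume contra: "\<not> ?thesis"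
  define A where "A = (\<lambda>(g :: 'b \<Rightarrow>\<^sub>L real, r :: real). {a \<in> V. \<epsilon> \<le> r * (g a - g x)})"
  have "a \<in> (\<Union>i \<in> G \<times> {1, -1}. A i)" if a: "a \<in> V" for a
  proof -
    obtain g where g: "g \<in> G" "\<not> \<bar>blinfun_apply g a - g x\<bar> < \<epsilon>"
      using contra a by blast
    then have "a \<in> A (g, 1) \<or> a \<in> A (g, - 1)"
      using a by (auto simp: A_def abs_if split: if_splits)
    then show ?thesis using g(1) by auto
  qed
  then have "V = (\<Union>i \<in> G \<times> {1, -1}. A i)" by (auto simp: A_def)
  then have "\<exists>i \<in> G \<times> {1, -1}. x \<in> weak_hull (A i)"
    using V \<open>finite G\<close> by (intro extreme_weak_hull_UN[OF ext]) (auto simp: A_def)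
  then obtain g r where "x \<in> weak_hull (A (g, r))" by auto
  then have "(- r *\<^sub>R g) x \<le> - r * g x - \<epsilon>"
    by (rule weak_hullD) (auto simp: A_def blinfun.scaleR_left blinfun.minus_left algebra_simps)
  then show False
    using \<open>0 < \<epsilon>\<close> by (simp add: blinfun.scaleR_left blinfun.minus_left)
qed

section \<open>Lipschitz functions as functionals on the free space\<close>

lemma one_lipschitzI:
  fixes f :: "'a::metric_space \<Rightarrow> real"
  assumes "\<And>a b. f a \<le> f b + dist a b"
  shows "1-lipschitz_on UNIV f"
proof (rule lipschitz_onI)
  show "dist (f a) (f b) \<le> 1 * dist a b" for a b
    using assms[of a b] assms[of b a] by (simp add: dist_real_def dist_commute abs_le_iff)
qed simp

lemma one_lipschitzD:
  fixes f :: "'a::metric_space \<Rightarrow> real"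
  assumes "1-lipschitz_on UNIV f"
  shows "f a - f b \<le> dist a b"
  using lipschitz_onD[OF assms, of a b] by (simp add: dist_real_def)

lemma pairing_const: "pairing z (\<lambda>_. c) = 0"
  by (simp add: pairing_def sum_coef flip: sum_distrib_right)

lemma pairing_le_lipschitz:
  fixes f :: "'a::metric_space \<Rightarrow> real"
  assumes "C-lipschitz_on UNIV f"
  shows "\<bar>pairing z f\<bar> \<le> C * norm z"
proof (cases "C = 0")
  case True
  have "f m = f undefined" for m
    using lipschitz_onD[OF assms, of m undefined] True by simp
  then have "f = (\<lambda>_. f undefined)" by (rule ext)
  then have "pairing z f = 0"
    using pairing_const by metis
  then show ?thesis using True by simp
next
  case False
  then have C: "C > 0"
    using lipschitz_on_nonneg[OF assms] by simp
  have "1-lipschitz_on UNIV (\<lambda>m. f m / C)"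
  proof (rule lipschitz_onI)
    fix a b
    have "dist (f a / C) (f b / C) = dist (f a) (f b) / C"
      using C by (simp add: dist_real_def abs_divide flip: diff_divide_distrib)
    also have "\<dots> \<le> dist a b"
      using lipschitz_onD[OF assms, of a b] C by (simp add: pos_divide_le_eq mult.commute)
    finally show "dist (f a / C) (f b / C) \<le> 1 * dist a b" by simp
  qed simp
  then have "\<bar>pairing z (\<lambda>m. f m / C)\<bar> \<le> norm z"
    by (rule pairing_le_norm)
  moreover have "pairing z (\<lambda>m. f m / C) = pairing z f / C"
    by (simp add: pairing_def sum_divide_distrib)
  ultimately show ?thesis
    using C by (simp add: field_simps)
qed

text \<open>
  An element of the completion is by construction a functional on the dual of the space of finitely
  supported elements, and this dual contains the pairings with Lipschitz functions.
\<close>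

definition lip_eval :: "('a::metric_space \<Rightarrow> real) \<Rightarrow> 'a lipfree \<Rightarrow> real" where
  "lip_eval f x = Rep_lipfree x (Blinfun (\<lambda>z. pairing z f))"

lemma bounded_linear_pairing:
  assumes "C-lipschitz_on UNIV f"
  shows "bounded_linear (\<lambda>z. pairing z f)"
  by (rule bounded_linear_intro[of _ C])
    (use pairing_le_lipschitz[OF assms] in \<open>simp_all add: pairing_add pairing_scaleR mult.commute\<close>)

lemma lip_eval_of_free0:
  "C-lipschitz_on UNIV f \<Longrightarrow> lip_eval f (of_free0 z) = pairing z f"
  by (simp add: lip_eval_def Rep_of_free0 bounded_linear_Blinfun_apply bounded_linear_pairing)

lemma linear_lip_eval: "linear (lip_eval f)"
  by (rule linearI)
    (simp_all add: lip_eval_def plus_lipfree.rep_eq scaleR_lipfree.rep_eq blinfun.add_left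
      blinfun.scaleR_left)

lemmas lip_eval_simps =
  linear_add[OF linear_lip_eval] linear_diff[OF linear_lip_eval] linear_scale[OF linear_lip_eval]
  linear_neg[OF linear_lip_eval] linear_0[OF linear_lip_eval]

lemma lip_eval_le:
  assumes "C-lipschitz_on UNIV f"
  shows "\<bar>lip_eval f x\<bar> \<le> C * norm x"
proof -
  have "norm (Blinfun (\<lambda>z. pairing z f)) \<le> C"
    using pairing_le_lipschitz[OF assms] lipschitz_on_nonneg[OF assms]
    by (intro norm_blinfun_bound)
      (auto simp: bounded_linear_Blinfun_apply[OF bounded_linear_pairing[OF assms]])
  then have "norm (Rep_lipfree x) * norm (Blinfun (\<lambda>z. pairing z f)) \<le> norm (Rep_lipfree x) * C"
    by (intro mult_left_mono) auto
  then show ?thesis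
    using norm_blinfun[of "Rep_lipfree x" "Blinfun (\<lambda>z. pairing z f)"]
    by (simp add: lip_eval_def norm_lipfree.rep_eq mult.commute)
qed

lemma bounded_linear_lip_eval:
  assumes "C-lipschitz_on UNIV f"
  shows "bounded_linear (lip_eval f)"
  using lip_eval_le[OF assms]
  by (intro bounded_linear_intro[of _ C]) (auto simp: lip_eval_simps mult.commute)

lemma of_free0_approx:
  fixes x :: "'a::metric_space lipfree"
  assumes "0 < \<epsilon>"
  obtains z where "norm (x - of_free0 z) < \<epsilon>"
proof -
  have "x \<in> closure (range of_free0)" by (simp add: dense_of_free0)
  then show ?thesis
    using that assms unfolding closure_approachable by (auto simp: dist_norm norm_minus_commute)
qed

lemma of_free0_limit:
  fixes x :: "'a::metric_space lipfree"
  obtains z where "(\<lambda>n. of_free0 (z n)) \<longlonglongrightarrow> x"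
proof -
  have "x \<in> closure (range of_free0)" by (simp add: dense_of_free0)
  then obtain u where u: "\<And>n. u n \<in> range of_free0" "u \<longlonglongrightarrow> x"
    unfolding closure_sequential by blast
  then have "\<forall>n. \<exists>z. u n = of_free0 z" by auto
  then obtain z where "u = (\<lambda>n. of_free0 (z n))" by metis
  then show ?thesis using that u by blast
qed

text \<open>
  The definition of the norm as a supremum over \<open>1\<close>-Lipschitz functions survives completion.
\<close>

lemma norm_lipfree_le:
  fixes x :: "'a::metric_space lipfree"
  assumes "\<And>f. 1-lipschitz_on UNIV f \<Longrightarrow> lip_eval f x \<le> K"
  shows "norm x \<le> K"
proof (rule field_le_epsilon)
  fix e :: real assume "0 < e"
  then obtain z where z: "norm (x - of_free0 z) < e / 2"
    using of_free0_approx[of "e / 2" x] by auto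
  have le: "pairing z f \<le> K + e / 2" if f: "1-lipschitz_on UNIV f" for f
    using assms[OF f] lip_eval_le[OF f, of "x - of_free0 z"] z
    by (simp add: lip_eval_simps lip_eval_of_free0[OF f])
  have "norm z \<le> K + e / 2"
  proof (rule norm_free0_least)
    fix f :: "'a \<Rightarrow> real" assume f: "1-lipschitz_on UNIV f"
    then have "1-lipschitz_on UNIV (\<lambda>m. - f m)" by (simp add: lipschitz_on_minus)
    moreover have "pairing z (\<lambda>m. - f m) = - pairing z f" by (simp add: pairing_def sum_negf)
    ultimately show "\<bar>pairing z f\<bar> \<le> K + e / 2"
      using le[of f] le[of "\<lambda>m. - f m"] f by simp
  qed
  moreover have "norm x \<le> norm (x - of_free0 z) + norm (of_free0 z)"
    by norm
  ultimately show "norm x \<le> K + e"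
    using z by (simp add: norm_of_free0)
qed

lemma exists_norming_lipschitz:
  fixes x :: "'a::metric_space lipfree"
  assumes "0 < \<epsilon>"
  obtains f where "1-lipschitz_on UNIV f" "norm x - \<epsilon> < lip_eval f x"
proof -
  have "\<not> norm x \<le> norm x - \<epsilon>" using assms by simp
  then show ?thesis
    using norm_lipfree_le[of x "norm x - \<epsilon>"] that by (meson not_le)
qed

section \<open>Differences of point masses\<close>

definition point_diff0 :: "'a::metric_space \<times> 'a \<Rightarrow> 'a free0" where
  "point_diff0 e = edge_length e *\<^sub>R molecule0 e"

text \<open>
  The class of \<open>\<chi>\<^sub>x - \<chi>\<^sub>y\<close>. Unlike molecules, these vectors telescope along paths.
\<close>

definition point_diff :: "'a::metric_space \<times> 'a \<Rightarrow> 'a lipfree" where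
  "point_diff e = edge_length e *\<^sub>R molecule e"

lemma coef_point_diff0:
  "coef (point_diff0 e) z = indicator {fst e} z - indicator {snd e} z"
  by (simp add: point_diff0_def edge_length_def molecule0.rep_eq)

lemma point_diff_of_free0: "point_diff e = of_free0 (point_diff0 e)"
  by (simp add: point_diff_def point_diff0_def molecule_def linear_scale[OF linear_of_free0])

lemma free0_eqI: "(\<And>m. coef x m = coef y m) \<Longrightarrow> x = y"
  by (metis coef_inject ext)

lemma point_diff_add: "point_diff (a, b) + point_diff (b, c) = point_diff (a, c)"
  unfolding point_diff_of_free0 linear_add[OF linear_of_free0, symmetric]
  by (rule arg_cong[of _ _ of_free0], rule free0_eqI) (simp add: coef_point_diff0)

lemma point_diff_same [simp]: "point_diff (a, a) = 0"
  by (simp add: point_diff_def edge_length_def)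

lemma point_diff_swap: "point_diff (b, a) = - point_diff (a, b)"
  using point_diff_add[of a b a] by (simp add: eq_neg_iff_add_eq_0 add.commute)

lemma pairing_point_diff0: "pairing (point_diff0 e) f = f (fst e) - f (snd e)"
proof -
  have "pairing (point_diff0 e) f =
    (\<Sum>m\<in>{fst e, snd e}. coef (point_diff0 e) m * f m)"
    by (rule pairing_superset) (auto simp: coef_point_diff0 split: split_indicator_asm)
  then show ?thesis
    by (cases "fst e = snd e") (auto simp: coef_point_diff0)
qed

lemma lip_eval_point_diff:
  "C-lipschitz_on UNIV f \<Longrightarrow> lip_eval f (point_diff e) = f (fst e) - f (snd e)"
  by (simp add: point_diff_of_free0 lip_eval_of_free0 pairing_point_diff0)

lemma lip_eval_molecule:
  assumes "C-lipschitz_on UNIV f"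
  shows "lip_eval f (molecule (p, q)) = (f p - f q) / dist p q"
proof (cases "p = q")
  case True
  then have "molecule0 (p, q) = 0"
    by (intro free0_eqI) (simp add: molecule0.rep_eq)
  then show ?thesis
    using True by (simp add: molecule_def linear_0[OF linear_of_free0] lip_eval_simps)
next
  case False
  then show ?thesis
    using lip_eval_point_diff[OF assms, of "(p, q)"]
    by (simp add: point_diff_def edge_length_def lip_eval_simps field_simps)
qed

lemma norm_point_diff: "norm (point_diff e) = edge_length e"
proof (rule antisym)
  show "norm (point_diff e) \<le> edge_length e"
  proof (rule norm_lipfree_le)
    fix f :: "'a \<Rightarrow> real" assume f: "1-lipschitz_on UNIV f"
    show "lip_eval f (point_diff e) \<le> edge_length e"
      using lipschitz_onD[OF f, of "fst e" "snd e"]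
      by (simp add: lip_eval_point_diff[OF f] edge_length_def dist_real_def)
  qed
  have f: "1-lipschitz_on UNIV (\<lambda>z. dist z (snd e))"
    by (rule one_lipschitzI) (simp add: add.commute dist_triangle)
  show "edge_length e \<le> norm (point_diff e)"
    using lip_eval_le[OF f, of "point_diff e"]
    by (simp add: lip_eval_point_diff[OF f] edge_length_def)
qed

lemma norm_molecule:
  assumes "fst e \<noteq> snd e"
  shows "norm (molecule e) = 1"
  using norm_point_diff[of e] assms by (simp add: point_diff_def edge_length_def)

lemma of_free0_eq_sum_point_diff:
  "of_free0 z = (\<Sum>m | coef z m \<noteq> 0. coef z m *\<^sub>R point_diff (m, b))"
proof -
  have coef_sum: "coef (\<Sum>i\<in>A. g i) m = (\<Sum>i\<in>A. coef (g i) m)" for A m and g :: "'a \<Rightarrow> 'a free0"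
    by (induction A rule: infinite_finite_induct) auto
  have "z = (\<Sum>m | coef z m \<noteq> 0. coef z m *\<^sub>R point_diff0 (m, b))"
  proof (rule free0_eqI)
    fix k
    have "(\<Sum>m | coef z m \<noteq> 0. coef z m * (indicator {m} k - indicator {b} k)) =
       (\<Sum>m | coef z m \<noteq> 0. coef z m * indicator {m} k)"
      using sum_coef[of z] by (simp add: right_diff_distrib sum_subtractf flip: sum_distrib_right)
    also have "\<dots> = (\<Sum>m | coef z m \<noteq> 0. if m = k then coef z m else 0)"
      by (intro sum.cong) (auto split: split_indicator)
    also have "\<dots> = coef z k" by simp
    finally show "coef z k =
        coef (\<Sum>m | coef z m \<noteq> 0. coef z m *\<^sub>R point_diff0 (m, b)) k"
      by (simp add: coef_sum coef_point_diff0)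
  qed
  then have "of_free0 z = of_free0 \<dots>" by simp
  then show ?thesis
    by (simp only: linear_sum[OF linear_of_free0] linear_scale[OF linear_of_free0] flip: point_diff_of_free0)
qed

text \<open>
  The differences with a fixed base point \<open>b\<close> span the finitely supported elements, which are dense.
\<close>

lemma bounded_linear_eq_of_point_diff:
  fixes S T :: "'a::metric_space lipfree \<Rightarrow> 'b::real_normed_vector"
  assumes S: "bounded_linear S" and T: "bounded_linear T"
    and eq: "\<And>m. S (point_diff (m, b)) = T (point_diff (m, b))"
  shows "S = T"
proof (rule ext)
  fix x :: "'a lipfree"
  have *: "S (of_free0 z) = T (of_free0 z)" for z
    using eq
    by (simp add: of_free0_eq_sum_point_diff[of z b] linear_sum[OF bounded_linear.linear] S T
        linear_scale[OF bounded_linear.linear])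
  obtain z where z: "(\<lambda>n. of_free0 (z n)) \<longlonglongrightarrow> x" by (rule of_free0_limit)
  have "(\<lambda>n. S (of_free0 (z n))) \<longlonglongrightarrow> S x" "(\<lambda>n. T (of_free0 (z n))) \<longlonglongrightarrow> T x"
    using bounded_linear.tendsto[OF S z] bounded_linear.tendsto[OF T z] .
  then show "S x = T x"
    using LIMSEQ_unique by (simp add: *)
qed

section \<open>The unit ball and the molecules\<close>

text \<open>
  If a functional \<open>\<phi>\<close> is at most \<open>c\<close> on all molecules, then \<open>v \<mapsto> \<phi>(\<chi>\<^sub>v - \<chi>\<^sub>b)\<close> is \<open>c\<close>-Lipschitz and
  represents \<open>\<phi>\<close>, so \<open>\<phi>\<close> is at most \<open>c\<close> on the unit ball. The two distinct points guarantee that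
  molecules exist, and \<open>c \<ge> 0\<close> because molecules come in opposite pairs.
\<close>

lemma ball_subset_weak_hull_molecules:
  fixes x :: "'a::metric_space lipfree" and a b :: 'a
  assumes x: "norm x \<le> 1" and ab: "a \<noteq> b"
  shows "x \<in> weak_hull (molecule ` {e. fst e \<noteq> snd e})"
proof (rule weak_hullI)
  fix \<phi> :: "'a lipfree \<Rightarrow>\<^sub>L real" and c
  assume le: "\<And>m. m \<in> molecule ` {e. fst e \<noteq> snd e} \<Longrightarrow> \<phi> m \<le> c"
  have \<phi>_le: "\<phi> (point_diff e) \<le> c * edge_length e" for e
  proof (cases "fst e = snd e")
    case False
    then have "edge_length e * \<phi> (molecule e) \<le> edge_length e * c"
      using le by (intro mult_left_mono) (auto simp: edge_length_def)
    then show ?thesis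
      by (simp add: point_diff_def blinfun.scaleR_right mult.commute)
  qed (cases e; simp add: edge_length_def)
  have c: "0 \<le> c"
  proof -
    have "0 \<le> c * dist a b"
      using \<phi>_le[of "(a, b)"] \<phi>_le[of "(b, a)"]
      by (simp add: point_diff_swap[of b a] blinfun.minus_right edge_length_def dist_commute)
    then show ?thesis using ab by (simp add: zero_le_mult_iff)
  qed
  define f where "f = (\<lambda>v. \<phi> (point_diff (v, b)))"
  have diff: "f v - f w = \<phi> (point_diff (v, w))" for v w
    using point_diff_add[of v w b] blinfun.add_right[of \<phi> "point_diff (v, w)" "point_diff (w, b)"]
    by (simp add: f_def)
  have f: "c-lipschitz_on UNIV f"
  proof (rule lipschitz_onI)
    fix v w
    show "dist (f v) (f w) \<le> c * dist v w"
      using diff[of v w] diff[of w v] \<phi>_le[of "(v, w)"] \<phi>_le[of "(w, v)"]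
      by (simp add: dist_real_def edge_length_def dist_commute abs_le_iff)
  qed (rule c)
  have "blinfun_apply \<phi> = lip_eval f"
  proof (rule bounded_linear_eq_of_point_diff)
    show "bounded_linear (blinfun_apply \<phi>)" by (rule blinfun.bounded_linear_right)
    show "bounded_linear (lip_eval f)" by (rule bounded_linear_lip_eval[OF f])
    show "\<phi> (point_diff (m, b)) = lip_eval f (point_diff (m, b))" for m
      by (simp add: lip_eval_point_diff[OF f] diff)
  qed
  then have "\<phi> x \<le> c * norm x"
    using lip_eval_le[OF f, of x] by simp
  also have "\<dots> \<le> c" using c x by (simp add: mult_left_le)
  finally show "\<phi> x \<le> c" .
qed

section \<open>The universal property of the free space\<close>

lemma dense_linear_extension:
  fixes j :: "'v::real_normed_vector \<Rightarrow> 'w::real_normed_vector" and T0 :: "'v \<Rightarrow> 'c::banach"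
  assumes j: "linear j" "\<And>v. norm (j v) = norm v" "closure (range j) = UNIV"
    and T0: "linear T0" "\<And>v. norm (T0 v) \<le> norm v"
  obtains T where "linear T" "\<And>w. norm (T w) \<le> norm w" "\<And>v. T (j v) = T0 v"
proof -
  have "inj j"
    using j(1,2) by (simp add: linear_injective_0) (metis norm_eq_zero)
  define F where "F = (\<lambda>w. T0 (inv j w))"
  have Fj: "F (j v) = T0 v" for v
    by (simp add: F_def \<open>inj j\<close>)
  have "uniformly_continuous_on (range j) F"
    unfolding uniformly_continuous_on_def
  proof (intro allI impI)
    fix e :: real assume e: "0 < e"
    have "dist (F y) (F x) \<le> dist y x" if xy: "x \<in> range j" "y \<in> range j" for x y
    proof -
      obtain v w where vw: "x = j v" "y = j w" using xy by auto
      have "dist (F y) (F x) = norm (T0 (w - v))"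
        by (simp add: vw Fj dist_norm linear_diff[OF T0(1)])
      also have "\<dots> \<le> norm (w - v)" by (rule T0(2))
      also have "\<dots> = dist y x"
        by (simp add: vw dist_norm flip: j(2) linear_diff[OF j(1)])
      finally show ?thesis .
    qed
    then show "\<exists>d>0. \<forall>x\<in>range j. \<forall>x'\<in>range j. dist x' x < d \<longrightarrow> dist (F x') (F x) < e"
      using e by (meson le_less_trans)
  qed
  then obtain T where T: "uniformly_continuous_on (closure (range j)) T"
      and TF: "\<And>x. x \<in> range j \<Longrightarrow> F x = T x"
    using uniformly_continuous_on_extension_on_closure[of "range j" F] by metis
  have Tj: "T (j v) = T0 v" for v
    using TF[of "j v"] Fj by simp
  have cont: "isCont T w" for w
    using uniformly_continuous_imp_continuous[OF T] j(3) by (simp add: continuous_on_eq_continuous_at)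
  have limit: "\<exists>v. (\<lambda>n. j (v n)) \<longlonglongrightarrow> w" for w
  proof -
    have "w \<in> closure (range j)" using j(3) by simp
    then obtain u where u: "\<And>n. u n \<in> range j" "u \<longlonglongrightarrow> w"
      unfolding closure_sequential by blast
    then have "\<forall>n. \<exists>v. u n = j v" by auto
    then show ?thesis using u(2) by (metis (no_types, lifting) ext)
  qed
  have T_lim: "(\<lambda>n. T0 (v n)) \<longlonglongrightarrow> T w" if "(\<lambda>n. j (v n)) \<longlonglongrightarrow> w" for v w
    using isCont_tendsto_compose[OF cont that] by (simp add: Tj)
  show ?thesis
  proof (rule that[OF linearI _ Tj])
    fix w z and c :: real
    obtain v u where v: "(\<lambda>n. j (v n)) \<longlonglongrightarrow> w" and u: "(\<lambda>n. j (u n)) \<longlonglongrightarrow> z"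
      using limit by blast
    have "(\<lambda>n. j (v n + u n)) \<longlonglongrightarrow> w + z"
      using tendsto_add[OF v u] by (simp add: linear_add[OF j(1)])
    from T_lim[OF this] have "(\<lambda>n. T0 (v n) + T0 (u n)) \<longlonglongrightarrow> T (w + z)"
      by (simp add: linear_add[OF T0(1)])
    then show "T (w + z) = T w + T z"
      using tendsto_add[OF T_lim[OF v] T_lim[OF u]] LIMSEQ_unique by blast
    have "(\<lambda>n. j (c *\<^sub>R v n)) \<longlonglongrightarrow> c *\<^sub>R w"
      using tendsto_scaleR[OF tendsto_const v] by (simp add: linear_scale[OF j(1)])
    from T_lim[OF this] have "(\<lambda>n. c *\<^sub>R T0 (v n)) \<longlonglongrightarrow> T (c *\<^sub>R w)"
      by (simp add: linear_scale[OF T0(1)])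
    then show "T (c *\<^sub>R w) = c *\<^sub>R T w"
      using tendsto_scaleR[OF tendsto_const T_lim[OF v]] LIMSEQ_unique by blast
    show "norm (T w) \<le> norm w"
    proof (rule LIMSEQ_le)
      show "(\<lambda>n. norm (T0 (v n))) \<longlonglongrightarrow> norm (T w)" "(\<lambda>n. norm (j (v n))) \<longlonglongrightarrow> norm w"
        using tendsto_norm[OF T_lim[OF v]] tendsto_norm[OF v] .
    qed (use T0(2) in \<open>auto simp: j(2)\<close>)
  qed
qed

text \<open>
  The universal property. The linearisation of \<open>t\<close> is a contraction because composing \<open>t\<close> with a
  norming functional of the target, itself given by a \<open>1\<close>-Lipschitz function, gives a \<open>1\<close>-Lipschitz
  function on the source.
\<close>

lemma lipschitz_linear_extension:
  fixes t :: "'a::metric_space \<Rightarrow> 'b::metric_space lipfree"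
  assumes t: "\<And>a b. norm (t a - t b) \<le> dist a b"
  obtains T where "linear T" "\<And>x. norm (T x) \<le> norm x" "\<And>a b. T (point_diff (a, b)) = t a - t b"
proof -
  define T0 where "T0 = (\<lambda>z. \<Sum>m | coef z m \<noteq> 0. coef z m *\<^sub>R t m)"
  have T0_superset: "T0 z = (\<Sum>m\<in>A. coef z m *\<^sub>R t m)"
    if "finite A" "{m. coef z m \<noteq> 0} \<subseteq> A" for z A
    unfolding T0_def by (rule sum.mono_neutral_left) (use that in auto)
  have "linear T0"
  proof (rule linearI)
    fix x y :: "'a free0"
    let ?A = "{m. coef x m \<noteq> 0} \<union> {m. coef y m \<noteq> 0}"
    have "T0 x = (\<Sum>m\<in>?A. coef x m *\<^sub>R t m)" "T0 y = (\<Sum>m\<in>?A. coef y m *\<^sub>R t m)"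
      "T0 (x + y) = (\<Sum>m\<in>?A. coef (x + y) m *\<^sub>R t m)"
      by (rule T0_superset; auto)+
    then show "T0 (x + y) = T0 x + T0 y"
      by (simp add: scaleR_add_left sum.distrib)
  next
    fix c and x :: "'a free0"
    have "T0 (c *\<^sub>R x) = (\<Sum>m | coef x m \<noteq> 0. coef (c *\<^sub>R x) m *\<^sub>R t m)"
      by (rule T0_superset) auto
    then show "T0 (c *\<^sub>R x) = c *\<^sub>R T0 x"
      by (simp add: T0_def scaleR_sum_right)
  qed
  moreover have "norm (T0 z) \<le> norm z" for z
  proof (rule norm_lipfree_le)
    fix f :: "'b \<Rightarrow> real" assume f: "1-lipschitz_on UNIV f"
    have "1-lipschitz_on UNIV (\<lambda>a. lip_eval f (t a))"
    proof (rule lipschitz_onI)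
      fix a b
      have "dist (lip_eval f (t a)) (lip_eval f (t b)) \<le> norm (t a - t b)"
        using lip_eval_le[OF f, of "t a - t b"] by (simp add: lip_eval_simps dist_real_def)
      then show "dist (lip_eval f (t a)) (lip_eval f (t b)) \<le> 1 * dist a b"
        using t[of a b] by simp
    qed simp
    moreover have "lip_eval f (T0 z) = pairing z (\<lambda>a. lip_eval f (t a))"
      by (simp add: T0_def pairing_def linear_sum[OF linear_lip_eval] lip_eval_simps)
    ultimately show "lip_eval f (T0 z) \<le> norm z"
      using pairing_le_norm[of "\<lambda>a. lip_eval f (t a)" z] by simp
  qed
  ultimately obtain T where T: "linear T" "\<And>x. norm (T x) \<le> norm x" "\<And>z. T (of_free0 z) = T0 z"
    using dense_linear_extension[OF linear_of_free0 norm_of_free0 dense_of_free0] by metis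
  have "T (point_diff (a, b)) = t a - t b" for a b
  proof -
    have "T0 (point_diff0 (a, b)) =
      (\<Sum>m\<in>{a, b}. coef (point_diff0 (a, b)) m *\<^sub>R t m)"
      by (rule T0_superset) (auto simp: coef_point_diff0 split: split_indicator_asm)
    then show ?thesis
      by (cases "a = b") (auto simp: point_diff_of_free0 T(3) coef_point_diff0)
  qed
  then show ?thesis using that T by blast
qed

section \<open>Norm limits of molecules\<close>

lemma norm_molecule_le: "norm (molecule e) \<le> 1"
proof (cases "fst e = snd e")
  case True
  then have "molecule0 e = 0"
    by (intro free0_eqI) (simp add: molecule0.rep_eq)
  then show ?thesis by (simp add: molecule_def linear_0[OF linear_of_free0])
qed (simp add: norm_molecule)

lemma molecule_swap: "molecule (q, p) = - molecule (p, q)"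
proof -
  have "molecule0 (q, p) = - molecule0 (p, q)"
    by (intro free0_eqI) (simp add: molecule0.rep_eq dist_commute minus_divide_left)
  then show ?thesis by (simp add: molecule_def linear_neg[OF linear_of_free0])
qed

lemma abs_dist_diff_le_sum: "\<bar>dist p q - dist s t\<bar> \<le> dist p s + dist q t"
  using dist_triangle[of p q s] dist_triangle[of s q t] dist_triangle[of s t p] dist_triangle[of p t q]
  by (simp add: dist_commute abs_le_iff)

lemma norm_molecule_diff_le:
  assumes "p \<noteq> q"
  shows "norm (molecule (p, q) - molecule (s, t)) \<le> 2 * (dist p s + dist q t) / dist p q"
proof -
  let ?D = "dist p q" and ?D' = "dist s t" and ?d = "dist p s + dist q t"
  have D: "0 < ?D" using assms by simp
  have "point_diff (p, q) - point_diff (s, t) = point_diff (p, s) + point_diff (t, q)"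
    using point_diff_add[of p s q] point_diff_add[of s t q] by (simp add: algebra_simps)
  then have pd: "norm (point_diff (p, q) - point_diff (s, t)) \<le> ?d"
    using norm_triangle_ineq[of "point_diff (p, s)" "point_diff (t, q)"]
    by (simp add: norm_point_diff edge_length_def dist_commute)
  have "?D *\<^sub>R (molecule (p, q) - molecule (s, t))
      = (point_diff (p, q) - point_diff (s, t)) + (?D' - ?D) *\<^sub>R molecule (s, t)"
    by (simp add: point_diff_def edge_length_def algebra_simps)
  then have "?D * norm (molecule (p, q) - molecule (s, t))
      = norm ((point_diff (p, q) - point_diff (s, t)) + (?D' - ?D) *\<^sub>R molecule (s, t))"
    by (metis abs_of_nonneg norm_scaleR zero_le_dist)
  also have "\<dots> \<le> ?d + \<bar>?D' - ?D\<bar> * norm (molecule (s, t))"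
    by (rule norm_triangle_le) (use pd in simp)
  also have "\<dots> \<le> ?d + ?d * 1"
    using abs_dist_diff_le_sum[of p q s t] norm_molecule_le
    by (intro add_mono mult_mono) auto
  finally show ?thesis using D by (simp add: field_simps)
qed

text \<open>
  The tent function of height \<open>d(p,q)\<close> with top at \<open>p\<close> and foot at \<open>q\<close> is \<open>1\<close>-Lipschitz and takes the
  value \<open>1\<close> at \<open>m\<^sub>p\<^sub>q\<close>. It must then be almost as steep from \<open>p'\<close> to \<open>q'\<close>, which places \<open>p'\<close> close to
  its top.
\<close>

lemma dist_le_of_molecules_close:
  fixes p q p' q' :: "'a::metric_space"
  assumes ne: "p \<noteq> q" "p' \<noteq> q'"
    and close: "norm (molecule (p, q) - molecule (p', q')) \<le> \<epsilon>" and \<epsilon>: "\<epsilon> < 1"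
  shows "dist p' p \<le> dist p q - (1 - \<epsilon>) * dist p' q'"
proof -
  define h where "h = (\<lambda>v. max 0 (dist p q - dist v p))"
  have h: "1-lipschitz_on UNIV h"
  proof (rule one_lipschitzI)
    fix a b
    show "h a \<le> h b + dist a b"
      using dist_triangle[of b p a] by (simp add: h_def max_def dist_commute)
  qed
  have h1: "lip_eval h (molecule (p, q)) = 1"
    using ne lip_eval_molecule[OF h, of p q] by (simp add: h_def dist_commute)
  have "1 - \<epsilon> \<le> (h p' - h q') / dist p' q'"
    using lip_eval_le[OF h, of "molecule (p, q) - molecule (p', q')"] close
    unfolding lip_eval_simps h1 lip_eval_molecule[OF h, of p' q'] by linarith
  then have "(1 - \<epsilon>) * dist p' q' \<le> h p' - h q'"
    using ne by (simp add: field_simps)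
  also have "\<dots> \<le> h p'" by (simp add: h_def)
  finally have "(1 - \<epsilon>) * dist p' q' \<le> h p'" .
  moreover have "0 < (1 - \<epsilon>) * dist p' q'"
    using ne \<epsilon> by simp
  ultimately show ?thesis by (auto simp: h_def max_def split: if_splits)
qed

lemma dist_le_of_molecules_close_bounded:
  fixes p q p' q' :: "'a::metric_space"
  assumes ne: "p \<noteq> q" "p' \<noteq> q'" and R: "dist p q \<le> R" "dist p' q' \<le> R"
    and close: "norm (molecule (p, q) - molecule (p', q')) \<le> \<epsilon>" and \<epsilon>: "\<epsilon> < 1"
  shows "dist p p' \<le> \<epsilon> * R"
proof -
  have "0 \<le> \<epsilon>" using close norm_ge_zero order_trans by blast
  have "dist p' p \<le> dist p q - (1 - \<epsilon>) * dist p' q'"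
    "dist p p' \<le> dist p' q' - (1 - \<epsilon>) * dist p q"
    using dist_le_of_molecules_close[of p q p' q' \<epsilon>] dist_le_of_molecules_close[of p' q' p q \<epsilon>]
      assms by (auto simp: norm_minus_commute)
  then have "2 * dist p p' \<le> \<epsilon> * dist p q + \<epsilon> * dist p' q'"
    by (simp add: dist_commute algebra_simps)
  also have "\<dots> \<le> \<epsilon> * R + \<epsilon> * R"
    using R \<open>0 \<le> \<epsilon>\<close> by (intro add_mono mult_left_mono)
  finally show ?thesis by (simp add: mult.commute)
qed

text \<open>
  By the previous estimates the endpoints of a norm convergent sequence of molecules form Cauchy
  sequences as long as the lengths are bounded. The lower bound on the lengths keeps the limits of the
  endpoints apart.
\<close>

lemma molecules_bounded_length_closed:
  fixes x :: "'a::metric_space lipfree"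
  assumes complete: "complete (UNIV :: 'a set)" and \<delta>: "0 < \<delta>"
    and approx: "\<And>\<epsilon>. 0 < \<epsilon> \<Longrightarrow> \<exists>p q. \<delta> \<le> dist p q \<and> dist p q \<le> R \<and> norm (x - molecule (p, q)) < \<epsilon>"
  shows "\<exists>p q. p \<noteq> q \<and> x = molecule (p, q)"
proof -
  have "\<exists>p q. \<delta> \<le> dist p q \<and> dist p q \<le> R \<and> norm (x - molecule (p, q)) < inverse (Suc n)" for n
    by (rule approx) simp
  then obtain p q where dist_ge: "\<And>n. \<delta> \<le> dist (p n) (q n)" and dist_le: "\<And>n. dist (p n) (q n) \<le> R"
    and close: "\<And>n. norm (x - molecule (p n, q n)) < inverse (Suc n)"
    by metis
  have ne: "p n \<noteq> q n" for n
    using dist_ge[of n] \<delta> by auto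
  have R: "0 < R" using dist_ge[of 0] dist_le[of 0] \<delta> by linarith
  have lim: "(\<lambda>n. molecule (p n, q n)) \<longlonglongrightarrow> x"
  proof (rule LIM_zero_cancel, rule Lim_null_comparison)
    show "\<forall>\<^sub>F n in sequentially. norm (molecule (p n, q n) - x) \<le> inverse (real (Suc n))"
      using close by (intro always_eventually allI) (simp add: norm_minus_commute less_imp_le)
    show "(\<lambda>n. inverse (real (Suc n))) \<longlonglongrightarrow> 0"
      by (rule LIMSEQ_inverse_real_of_nat)
  qed
  have cauchy: "Cauchy p \<and> Cauchy q"
  proof (intro conjI metric_CauchyI)
    fix e :: real assume e: "0 < e"
    have "Cauchy (\<lambda>n. molecule (p n, q n))"
      using lim LIMSEQ_imp_Cauchy by blast
    moreover have "0 < min (1/2) (e / (2 * R))" using e R by simp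
    ultimately obtain N where
      N: "\<And>m n. m \<ge> N \<Longrightarrow> n \<ge> N \<Longrightarrow> dist (molecule (p m, q m)) (molecule (p n, q n)) < min (1/2) (e / (2 * R))"
      unfolding Cauchy_def by metis
    have *: "dist (p m) (p n) < e" "dist (q m) (q n) < e" if mn: "m \<ge> N" "n \<ge> N" for m n
    proof -
      define \<epsilon> where "\<epsilon> = norm (molecule (p m, q m) - molecule (p n, q n))"
      have \<epsilon>: "\<epsilon> < 1" "\<epsilon> * R < e"
        using N[OF mn] e R by (auto simp: \<epsilon>_def dist_norm field_simps)
      have "dist (p m) (p n) \<le> \<epsilon> * R"
        by (rule dist_le_of_molecules_close_bounded[OF ne ne]) (use dist_le \<epsilon> in \<open>auto simp: \<epsilon>_def\<close>)
      moreover have "dist (q m) (q n) \<le> \<epsilon> * R"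
        by (rule dist_le_of_molecules_close_bounded[OF ne[symmetric] ne[symmetric]])
          (use dist_le \<epsilon> in \<open>auto simp: \<epsilon>_def molecule_swap[of "q _"] dist_commute norm_minus_commute\<close>)
      ultimately show "dist (p m) (p n) < e" "dist (q m) (q n) < e"
        using \<epsilon>(2) by auto
    qed
    show "\<exists>M. \<forall>m\<ge>M. \<forall>n\<ge>M. dist (p m) (p n) < e" "\<exists>M. \<forall>m\<ge>M. \<forall>n\<ge>M. dist (q m) (q n) < e"
      using * by blast+
  qed
  then obtain a b where ab: "p \<longlonglongrightarrow> a" "q \<longlonglongrightarrow> b"
    using complete unfolding complete_def by blast
  have "\<delta> \<le> dist a b"
    using tendsto_dist[OF ab] dist_ge by (intro LIMSEQ_le_const[of "\<lambda>n. dist (p n) (q n)"]) auto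
  then have "a \<noteq> b" using \<delta> by auto
  have "(\<lambda>n. 2 * (dist a (p n) + dist b (q n)) / dist a b) \<longlonglongrightarrow> 2 * (dist a a + dist b b) / dist a b"
    using \<open>a \<noteq> b\<close> by (intro tendsto_intros ab) auto
  then have bound0: "(\<lambda>n. 2 * (dist a (p n) + dist b (q n)) / dist a b) \<longlonglongrightarrow> 0" by simp
  have bound: "\<forall>\<^sub>F n in sequentially. norm (molecule (p n, q n) - molecule (a, b))
      \<le> 2 * (dist a (p n) + dist b (q n)) / dist a b"
    using norm_molecule_diff_le[OF \<open>a \<noteq> b\<close>]
    by (intro always_eventually allI) (metis norm_minus_commute)
  have "(\<lambda>n. molecule (p n, q n)) \<longlonglongrightarrow> molecule (a, b)"
    by (rule LIM_zero_cancel, rule Lim_null_comparison[OF bound bound0])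
  then show ?thesis
    using lim LIMSEQ_unique \<open>a \<noteq> b\<close> by blast
qed

section \<open>Test functions\<close>

lemma cos_le_one_minus_quarter_square:
  fixes u :: real
  assumes "\<bar>u\<bar> \<le> 1"
  shows "cos u \<le> 1 - u\<^sup>2 / 4"
proof -
  obtain t where "cos u = (\<Sum>m<4. cos_coeff m * u ^ m) + (cos (t + 1/2 * real 4 * pi) / fact 4) * u ^ 4"
    using Maclaurin_cos_expansion[of u 4] by auto
  moreover have "{..<4 :: nat} = {0, 1, 2, 3}" by auto
  ultimately have "cos u = 1 - u\<^sup>2 / 2 + cos (t + 2 * pi) / 24 * u ^ 4"
    by (simp add: cos_coeff_def fact_numeral)
  also have "\<dots> \<le> 1 - u\<^sup>2 / 2 + 1 / 24 * u ^ 4"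
    by (intro add_left_mono mult_right_mono divide_right_mono) auto
  also have "u ^ 4 \<le> u\<^sup>2"
    using assms power_le_one[of "\<bar>u\<bar>" 2] mult_left_le[of "u\<^sup>2" "u\<^sup>2"] by (simp add: power4_eq_xxxx power2_eq_square mult.assoc)
  finally show ?thesis
    using zero_le_power2[of u] by linarith
qed

text \<open>
  On an arc of length at most \<open>1\<close> the chord is comparable to the arc. So two points whose images under
  both \<open>sin\<close> and \<open>cos\<close> nearly agree are either nearly equal or far apart.
\<close>

lemma chord_ge_half_arc:
  fixes a b :: real
  assumes "\<bar>a - b\<bar> \<le> 1"
  shows "(a - b)\<^sup>2 / 2 \<le> (sin a - sin b)\<^sup>2 + (cos a - cos b)\<^sup>2"
proof -
  have "(sin a - sin b)\<^sup>2 + (cos a - cos b)\<^sup>2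
      = ((sin a)\<^sup>2 + (cos a)\<^sup>2) + ((sin b)\<^sup>2 + (cos b)\<^sup>2) - 2 * (cos a * cos b + sin a * sin b)"
    by (simp add: power2_eq_square algebra_simps)
  also have "\<dots> = 2 - 2 * cos (a - b)"
    by (simp add: cos_diff)
  finally show ?thesis
    using cos_le_one_minus_quarter_square[OF assms] by simp
qed

lemma abs_sin_diff_le: "\<bar>sin a - sin b\<bar> \<le> \<bar>a - b\<bar>" for a b :: real
proof -
  have "\<bar>sin a - sin b\<bar> = 2 * \<bar>sin ((a - b) / 2)\<bar> * \<bar>cos ((a + b) / 2)\<bar>"
    by (simp add: sin_diff_sin abs_mult)
  also have "\<dots> \<le> 2 * \<bar>(a - b) / 2\<bar> * 1"
    by (intro mult_mono abs_sin_x_le_abs_x) (auto intro: mult_left_mono abs_sin_x_le_abs_x)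
  finally show ?thesis by simp
qed

lemma abs_cos_diff_le: "\<bar>cos a - cos b\<bar> \<le> \<bar>a - b\<bar>" for a b :: real
  using abs_sin_diff_le[of "pi / 2 - a" "pi / 2 - b"] by (simp add: sin_diff abs_minus_commute)

lemma pairing_le_sup:
  assumes "\<And>v. \<bar>h v\<bar> \<le> K"
  shows "\<bar>pairing z h\<bar> \<le> (\<Sum>m | coef z m \<noteq> 0. \<bar>coef z m\<bar>) * K"
proof -
  have "\<bar>pairing z h\<bar> \<le> (\<Sum>m | coef z m \<noteq> 0. \<bar>coef z m * h m\<bar>)"
    unfolding pairing_def by (rule sum_abs)
  also have "\<dots> \<le> (\<Sum>m | coef z m \<noteq> 0. \<bar>coef z m\<bar> * K)"
    using assms by (intro sum_mono) (auto simp: abs_mult intro!: mult_left_mono)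
  finally show ?thesis by (simp add: sum_distrib_right)
qed

text \<open>
  Truncating a norming function outside its range on the support of a finitely supported approximation
  of \<open>x\<close> does not change the pairing with that approximation.
\<close>

lemma exists_bounded_norming_lipschitz:
  fixes x :: "'a::metric_space lipfree"
  assumes \<epsilon>: "0 < \<epsilon>"
  obtains g R where "1-lipschitz_on UNIV g" "\<And>v. \<bar>g v\<bar> \<le> R" "norm x - \<epsilon> < lip_eval g x"
proof -
  obtain f where f: "1-lipschitz_on UNIV f" "norm x - \<epsilon> / 3 < lip_eval f x"
    using exists_norming_lipschitz[of "\<epsilon> / 3" x] \<epsilon> by auto
  obtain z where z: "norm (x - of_free0 z) < \<epsilon> / 3"
    using of_free0_approx[of "\<epsilon> / 3" x] \<epsilon> by auto
  define R where "R = (\<Sum>m | coef z m \<noteq> 0. \<bar>f m\<bar>)"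
  have R0: "0 \<le> R" unfolding R_def by (simp add: sum_nonneg)
  have R: "\<bar>f m\<bar> \<le> R" if "coef z m \<noteq> 0" for m
    unfolding R_def using that by (intro member_le_sum) auto
  define g where "g = (\<lambda>v. max (- R) (min R (f v)))"
  have g: "1-lipschitz_on UNIV g"
  proof (rule one_lipschitzI)
    show "g a \<le> g b + dist a b" for a b
      using one_lipschitzD[OF f(1), of a b] zero_le_dist[of a b] R0
      unfolding g_def max_def min_def by (smt (verit))
  qed
  have "g m = f m" if "coef z m \<noteq> 0" for m
  proof -
    have "f m \<le> R" "- R \<le> f m" using R[OF that] by linarith+
    then show ?thesis by (simp add: g_def)
  qed
  then have "pairing z g = pairing z f"
    unfolding pairing_def by (intro sum.cong) auto
  then have "norm x - \<epsilon> < lip_eval g x"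
    using lip_eval_le[OF f(1), of "x - of_free0 z"] lip_eval_le[OF g, of "x - of_free0 z"] z f(2)
    by (simp add: lip_eval_simps lip_eval_of_free0[OF f(1)] lip_eval_of_free0[OF g])
  moreover have "\<bar>g v\<bar> \<le> R" for v
    using R0 by (auto simp: g_def)
  ultimately show ?thesis using that g by blast
qed

lemma exists_finite_grid:
  fixes R h :: real
  assumes "0 < h"
  obtains C where "finite C" "\<And>t. \<bar>t\<bar> \<le> R \<Longrightarrow> \<exists>c\<in>C. t \<le> c \<and> c \<le> t + h"
proof (rule that[of "(\<lambda>j :: int. j * h) ` {- \<lceil>R / h\<rceil> - 1 .. \<lceil>R / h\<rceil> + 1}"])
  fix t assume t: "\<bar>t\<bar> \<le> R"
  let ?j = "\<lceil>t / h\<rceil>"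
  have "t / h \<le> R / h" "- (R / h) \<le> t / h"
    using t assms by (auto simp: field_simps abs_le_iff)
  then have "?j \<in> {- \<lceil>R / h\<rceil> - 1 .. \<lceil>R / h\<rceil> + 1}"
    by simp linarith
  moreover have "t \<le> ?j * h" "?j * h \<le> t + h"
    using pos_divide_le_eq[OF assms, THEN iffD1, OF le_of_int_ceiling] ceiling_correct[of "t / h"] assms
    by (auto simp: field_simps)
  ultimately show "\<exists>c \<in> (\<lambda>j :: int. j * h) ` {- \<lceil>R / h\<rceil> - 1 .. \<lceil>R / h\<rceil> + 1}. t \<le> c \<and> c \<le> t + h"
    by (intro bexI[of _ "?j * h"]) auto
qed simp

section \<open>Weak limits of molecules\<close>

text \<open>
  Testing with \<open>1\<close>-Lipschitz functions determines the weak topology, since every functional on the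
  free space is a multiple of the evaluation of such a function.
\<close>

definition weak_limit_of_molecules :: "'a::metric_space lipfree \<Rightarrow> bool" where
  "weak_limit_of_molecules x \<longleftrightarrow>
    (\<forall>G \<epsilon>. finite G \<longrightarrow> (\<forall>g\<in>G. 1-lipschitz_on UNIV g) \<longrightarrow> 0 < \<epsilon> \<longrightarrow>
      (\<exists>p q. p \<noteq> q \<and> (\<forall>g\<in>G. \<bar>lip_eval g (molecule (p, q)) - lip_eval g x\<bar> < \<epsilon>)))"

lemma weak_limit_of_moleculesD:
  assumes "weak_limit_of_molecules x" "finite G" "\<And>g. g \<in> G \<Longrightarrow> 1-lipschitz_on UNIV g" "0 < \<epsilon>"
  shows "\<exists>p q. p \<noteq> q \<and> (\<forall>g\<in>G. \<bar>lip_eval g (molecule (p, q)) - lip_eval g x\<bar> < \<epsilon>)"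
  using assms unfolding weak_limit_of_molecules_def by simp

text \<open>
  Molecules weakly close to a unit vector \<open>x\<close> are neither very short nor very long. A norming function
  \<open>g\<close> has slope almost \<open>1\<close> along such a molecule; as \<open>g\<close> is bounded, the molecule cannot be long.
  The functions \<open>\<delta> sin(g/\<delta>)\<close> and \<open>\<delta> cos(g/\<delta>)\<close> are \<open>1\<close>-Lipschitz but uniformly small, hence almost
  vanish at \<open>x\<close>; on a molecule shorter than \<open>\<delta>\<close>, however, one of them is about as steep as \<open>g\<close>.
\<close>

lemma weak_limit_of_molecules_lengths:
  fixes x :: "'a::metric_space lipfree"
  assumes x: "norm x = 1"
  obtains G :: "('a \<Rightarrow> real) set" and g \<delta> R where
    "finite G" "\<And>h. h \<in> G \<Longrightarrow> 1-lipschitz_on UNIV h"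
    "1-lipschitz_on UNIV g" "0 < \<delta>" "\<And>v. \<bar>g v\<bar> \<le> R"
    "\<And>p q. p \<noteq> q \<Longrightarrow> (\<And>h. h \<in> G \<Longrightarrow> \<bar>lip_eval h (molecule (p, q)) - lip_eval h x\<bar> < 1 / 20) \<Longrightarrow>
      \<delta> \<le> dist p q \<and> dist p q \<le> R \<and> \<delta> / 2 \<le> g p - g q"
proof -
  obtain g R where g: "1-lipschitz_on UNIV g" and R: "\<And>v. \<bar>g v\<bar> \<le> R" and gx: "1 - 1 / 20 < lip_eval g x"
    using exists_bounded_norming_lipschitz[of "1 / 20" x] x by auto
  obtain z where z: "norm (x - of_free0 z) < 1 / 20"
    using of_free0_approx[of "1 / 20" x] by auto
  define N where "N = (\<Sum>m | coef z m \<noteq> 0. \<bar>coef z m\<bar>)"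
  have N: "0 \<le> N" unfolding N_def by (simp add: sum_nonneg)
  \<comment> \<open>With this choice a function bounded by \<open>\<delta>\<close> pairs with \<open>z\<close> to at most \<open>1/20\<close>.\<close>
  define \<delta> where "\<delta> = 1 / (20 * (N + 1))"
  have \<delta>: "0 < \<delta>" "N * \<delta> \<le> 1 / 20"
    using N by (auto simp: \<delta>_def field_simps)
  define sn where "sn = (\<lambda>v. \<delta> * sin (g v / \<delta>))"
  define cs where "cs = (\<lambda>v. \<delta> * cos (g v / \<delta>))"
  have lip: "1-lipschitz_on UNIV (\<lambda>v. \<delta> * F (g v / \<delta>))" if F: "\<And>a b. \<bar>F a - F b\<bar> \<le> \<bar>a - b\<bar>" for F
  proof (rule one_lipschitzI)
    fix a b
    have "\<delta> * (F (g a / \<delta>) - F (g b / \<delta>)) \<le> \<delta> * \<bar>g a / \<delta> - g b / \<delta>\<bar>"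
      using F[of "g a / \<delta>" "g b / \<delta>"] \<delta>(1) by (intro mult_left_mono) auto
    also have "\<dots> = \<bar>g a - g b\<bar>"
      using \<delta>(1) by (simp add: abs_divide flip: diff_divide_distrib)
    also have "\<dots> \<le> dist a b"
      using one_lipschitzD[OF g, of a b] one_lipschitzD[OF g, of b a] by (simp add: dist_commute)
    finally show "\<delta> * F (g a / \<delta>) \<le> \<delta> * F (g b / \<delta>) + dist a b"
      by (simp add: algebra_simps)
  qed
  have sn: "1-lipschitz_on UNIV sn" and cs: "1-lipschitz_on UNIV cs"
    unfolding sn_def cs_def by (rule lip abs_sin_diff_le abs_cos_diff_le)+
  have small: "\<bar>lip_eval h x\<bar> \<le> 2 / 20" if h: "1-lipschitz_on UNIV h" "\<And>v. \<bar>h v\<bar> \<le> \<delta>" for h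
  proof -
    have "\<bar>pairing z h\<bar> \<le> N * \<delta>"
      unfolding N_def by (rule pairing_le_sup) (rule h(2))
    then have "\<bar>pairing z h\<bar> \<le> 1 / 20"
      using \<delta>(2) by linarith
    moreover have "\<bar>lip_eval h (x - of_free0 z)\<bar> \<le> 1 / 20"
      using lip_eval_le[OF h(1), of "x - of_free0 z"] z by simp
    ultimately show ?thesis
      unfolding lip_eval_simps lip_eval_of_free0[OF h(1)] by linarith
  qed
  have "\<bar>sn v\<bar> \<le> \<delta>" "\<bar>cs v\<bar> \<le> \<delta>" for v
    using \<delta>(1) by (simp_all add: sn_def cs_def abs_mult mult_left_le)
  then have snx: "\<bar>lip_eval sn x\<bar> \<le> 2 / 20" and csx: "\<bar>lip_eval cs x\<bar> \<le> 2 / 20"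
    using small sn cs by auto
  show ?thesis
  proof (rule that[of "{g, sn, cs}" g \<delta> "3 * R"])
    have "0 \<le> R" using R[of undefined] by linarith
    then show "\<bar>g v\<bar> \<le> 3 * R" for v using R[of v] by linarith
    fix p q :: 'a assume pq: "p \<noteq> q"
      and near: "\<And>h. h \<in> {g, sn, cs} \<Longrightarrow> \<bar>lip_eval h (molecule (p, q)) - lip_eval h x\<bar> < 1 / 20"
    have D: "0 < dist p q" using pq by simp
    have "\<bar>lip_eval g (molecule (p, q)) - lip_eval g x\<bar> < 1 / 20"
      by (rule near) simp
    then have "1 - 2 / 20 < (g p - g q) / dist p q"
      using gx unfolding lip_eval_molecule[OF g] by linarith
    then have gD: "9 / 10 * dist p q < g p - g q"
      using D by (simp add: field_simps)
    have bound: "\<bar>h p - h q\<bar> \<le> 3 / 20 * dist p q"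
      if "h \<in> {sn, cs}" "1-lipschitz_on UNIV h" "\<bar>lip_eval h x\<bar> \<le> 2 / 20" for h
    proof -
      have "\<bar>lip_eval h (molecule (p, q)) - lip_eval h x\<bar> < 1 / 20"
        using that(1) by (intro near) auto
      then have "\<bar>lip_eval h (molecule (p, q))\<bar> \<le> 3 / 20"
        using that(3) by linarith
      then show ?thesis
        using D by (simp add: lip_eval_molecule[OF that(2)] abs_divide divide_le_eq)
    qed
    have "\<delta> \<le> dist p q"
    proof (rule ccontr)
      assume "\<not> \<delta> \<le> dist p q"
      \<comment> \<open>In units of \<open>\<delta>\<close> the arc is at least \<open>0.9 w\<close> while both coordinates of the chord are at most \<open>0.15 w\<close>.\<close>
      define w where "w = dist p q / \<delta>"
      have w: "0 < w" "w < 1"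
        using D \<delta>(1) \<open>\<not> \<delta> \<le> dist p q\<close> by (auto simp: w_def)
      let ?a = "g p / \<delta>" and ?b = "g q / \<delta>"
      have ab: "?a - ?b = (g p - g q) / \<delta>" by (simp add: diff_divide_distrib)
      have u: "9 / 10 * w \<le> ?a - ?b" "?a - ?b \<le> w"
        using divide_right_mono[of "9 / 10 * dist p q" "g p - g q" \<delta>] gD
          divide_right_mono[OF one_lipschitzD[OF g, of p q], of \<delta>] \<delta>(1)
        unfolding ab w_def by auto
      have scale: "\<bar>y\<bar> \<le> 3 / 20 * w" if "\<bar>\<delta> * y\<bar> \<le> 3 / 20 * dist p q" for y
      proof -
        have "\<bar>y\<bar> * \<delta> \<le> 3 / 20 * dist p q"
          using that \<delta>(1) by (simp add: abs_mult mult.commute)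
        then have "\<bar>y\<bar> \<le> 3 / 20 * dist p q / \<delta>"
          using \<delta>(1) pos_le_divide_eq by blast
        then show ?thesis by (simp add: w_def)
      qed
      have "\<bar>sin ?a - sin ?b\<bar> \<le> 3 / 20 * w"
        using bound[OF _ sn snx] by (intro scale) (simp add: sn_def right_diff_distrib)
      moreover have "\<bar>cos ?a - cos ?b\<bar> \<le> 3 / 20 * w"
        using bound[OF _ cs csx] by (intro scale) (simp add: cs_def right_diff_distrib)
      ultimately have "\<bar>sin ?a - sin ?b\<bar>\<^sup>2 \<le> (3 / 20 * w)\<^sup>2" "\<bar>cos ?a - cos ?b\<bar>\<^sup>2 \<le> (3 / 20 * w)\<^sup>2"
        by (intro power_mono; simp)+
      then have "(?a - ?b)\<^sup>2 / 2 \<le> 2 * (3 / 20 * w)\<^sup>2"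
        using chord_ge_half_arc[of ?a ?b] u w by simp
      moreover have "(9 / 10 * w)\<^sup>2 \<le> (?a - ?b)\<^sup>2"
        using u w by (intro power_mono) auto
      moreover have "0 < w\<^sup>2" using w by simp
      ultimately show False
        by (simp add: power_mult_distrib power_divide)
    qed
    moreover have "dist p q \<le> 3 * R"
      using gD R[of p] R[of q] \<open>0 \<le> R\<close> by (simp add: abs_le_iff)
    ultimately show "\<delta> \<le> dist p q \<and> dist p q \<le> 3 * R \<and> \<delta> / 2 \<le> g p - g q"
      using gD \<delta> by linarith
  qed (use g sn cs \<delta> in auto)
qed

lemma lip_eval_vanishing_on_support:
  assumes h: "1-lipschitz_on UNIV h" and "\<And>m. coef z m \<noteq> 0 \<Longrightarrow> h m = 0"
  shows "\<bar>lip_eval h x\<bar> \<le> norm (x - of_free0 z)"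
proof -
  have "pairing z h = 0"
    unfolding pairing_def using assms(2) by (intro sum.neutral) auto
  then show ?thesis
    using lip_eval_le[OF h, of "x - of_free0 z"] by (simp add: lip_eval_simps lip_eval_of_free0[OF h])
qed

lemma exists_near_of_infdist_less:
  assumes "infdist v S < \<kappa>" "S \<noteq> {}"
  obtains s where "s \<in> S" "dist v s < \<kappa>"
  using assms unfolding infdist_notempty[OF assms(2)]
  by (metis (no_types, lifting) cINF_less_iff bdd_belowI2 zero_le_dist)

text \<open>
  A weak limit of molecules is a norm limit of molecules of controlled length. Let \<open>S\<close> be the support of
  a good approximation of \<open>x\<close>. A \<open>1\<close>-Lipschitz function that vanishes on \<open>S\<close> is small at \<open>x\<close>, hence on a
  weakly close molecule \<open>m\<^sub>p\<^sub>q\<close>. The distance to \<open>S\<close> alone would only show that \<open>p\<close> and \<open>q\<close> are about equally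
  far from \<open>S\<close>; cutting it off below or above a level \<open>c\<close> of \<open>g\<close> between \<open>g(q)\<close> and \<open>g(p)\<close> makes it
  vanish at one endpoint, so the other one is close to \<open>S\<close>. As the level is not known in
  advance, a finite grid of levels is used. Thus \<open>m\<^sub>p\<^sub>q\<close> is close in norm to one of the finitely many
  molecules with endpoints in \<open>S\<close>, and testing with norming functions for the differences between
  \<open>x\<close> and these molecules turns weak into norm closeness.
\<close>

lemma weak_limit_of_molecules_approx:
  fixes x :: "'a::metric_space lipfree"
  assumes x: "norm x = 1" and weak: "weak_limit_of_molecules x"
  obtains \<delta> R where "0 < \<delta>"
    "\<And>\<epsilon>. 0 < \<epsilon> \<Longrightarrow> \<exists>p q. \<delta> \<le> dist p q \<and> dist p q \<le> R \<and> norm (x - molecule (p, q)) < \<epsilon>"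
proof -
  obtain G0 :: "('a \<Rightarrow> real) set" and g \<delta> R where G0: "finite G0" "\<And>h. h \<in> G0 \<Longrightarrow> 1-lipschitz_on UNIV h"
    and g: "1-lipschitz_on UNIV g" and \<delta>: "0 < \<delta>" and gR: "\<And>v. \<bar>g v\<bar> \<le> R"
    and near: "\<And>p q. p \<noteq> q \<Longrightarrow>
      (\<And>h. h \<in> G0 \<Longrightarrow> \<bar>lip_eval h (molecule (p, q)) - lip_eval h x\<bar> < 1 / 20) \<Longrightarrow>
      \<delta> \<le> dist p q \<and> dist p q \<le> R \<and> \<delta> / 2 \<le> g p - g q"
    using weak_limit_of_molecules_lengths[OF x] by metis
  have R: "0 < R"
  proof -
    obtain p q where "p \<noteq> q" "\<And>h. h \<in> G0 \<Longrightarrow> \<bar>lip_eval h (molecule (p, q)) - lip_eval h x\<bar> < 1 / 20"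
      using weak_limit_of_moleculesD[OF weak G0, of "1 / 20"] by auto
    then show ?thesis using near \<delta> by fastforce
  qed
  obtain C where C: "finite C" "\<And>t. \<bar>t\<bar> \<le> R + \<delta> \<Longrightarrow> \<exists>c\<in>C. t \<le> c \<and> c \<le> t + \<delta> / 4"
    using exists_finite_grid[of "\<delta> / 4" "R + \<delta>"] \<delta> by auto
  show ?thesis
  proof (rule that[of "\<delta> / 2" "R + \<delta>"])
    fix \<epsilon> :: real assume \<epsilon>: "0 < \<epsilon>"
    \<comment> \<open>Small enough that \<open>\<kappa> \<le> \<delta>/8\<close>, so that a value below \<open>\<kappa>\<close> of a cut-off distance is a distance,
      and that the final error is less than \<open>\<epsilon>\<close>.\<close>
    define \<eta> where "\<eta> = min (1 / 20) (min (\<delta> / (16 * R)) (\<epsilon> / (2 * (2 + 8 * R / \<delta>))))"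
    have \<eta>: "0 < \<eta>" using \<delta> R \<epsilon> by (simp add: \<eta>_def add_pos_nonneg)
    define \<kappa> where "\<kappa> = 2 * \<eta> * R"
    have \<eta>20: "\<eta> \<le> 1 / 20"
      unfolding \<eta>_def by (rule min.cobounded1)
    have "\<eta> \<le> min (\<delta> / (16 * R)) (\<epsilon> / (2 * (2 + 8 * R / \<delta>)))"
      unfolding \<eta>_def by (rule min.cobounded2)
    then have \<eta>_le: "\<eta> \<le> \<delta> / (16 * R)" "\<eta> \<le> \<epsilon> / (2 * (2 + 8 * R / \<delta>))"
      by simp_all
    then have \<kappa>: "\<kappa> \<le> \<delta> / 8" "0 < \<kappa>"
      using R \<eta> by (auto simp: \<kappa>_def field_simps)
    have \<epsilon>': "2 * \<eta> + 4 * \<kappa> / \<delta> < \<epsilon>"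
    proof -
      have pos: "0 < 2 + 8 * R / \<delta>" using R \<delta> by (simp add: add_pos_nonneg)
      have "2 * \<eta> + 4 * \<kappa> / \<delta> = \<eta> * (2 + 8 * R / \<delta>)"
        by (simp add: \<kappa>_def algebra_simps)
      also have "\<dots> \<le> \<epsilon> / (2 * (2 + 8 * R / \<delta>)) * (2 + 8 * R / \<delta>)"
        using pos \<eta>_le(2) by (intro mult_right_mono) auto
      also have "\<dots> = \<epsilon> / 2"
      proof -
        have "\<epsilon> / (2 * K) * K = \<epsilon> / 2" if "0 < K" for K using that by simp
        then show ?thesis using pos .
      qed
      finally show ?thesis using \<epsilon> by simp
    qed
    obtain z where z: "norm (x - of_free0 z) < \<eta>"
      using of_free0_approx[OF \<eta>] by auto
    \<comment> \<open>The extra point only ensures that \<open>S\<close> is nonempty.\<close>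
    define S where "S = insert undefined {m. coef z m \<noteq> 0}"
    have S: "finite S" "S \<noteq> {}" by (auto simp: S_def)
    define above where "above = (\<lambda>c v. min (infdist v S) (max 0 (g v - c)))"
    define below where "below = (\<lambda>c v. min (infdist v S) (max 0 (c - g v)))"
    have above: "1-lipschitz_on UNIV (above c)" and below: "1-lipschitz_on UNIV (below c)" for c
    proof -
      have "above c a \<le> above c b + dist a b" "below c a \<le> below c b + dist a b" for a b
        using one_lipschitzD[OF g, of a b] one_lipschitzD[OF g, of b a] infdist_triangle[of a S b]
        by (auto simp: above_def below_def min_def max_def dist_commute)
      then show "1-lipschitz_on UNIV (above c)" "1-lipschitz_on UNIV (below c)"
        by (auto intro: one_lipschitzI)
    qed
    have "\<exists>f. 1-lipschitz_on UNIV f \<and> norm (x - molecule e) - \<eta> < lip_eval f (x - molecule e)" for e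
      using exists_norming_lipschitz[OF \<eta>, of "x - molecule e"] by metis
    then obtain F where F: "\<And>e. 1-lipschitz_on UNIV (F e)"
      "\<And>e. norm (x - molecule e) - \<eta> < lip_eval (F e) (x - molecule e)"
      by metis
    define G where "G = G0 \<union> above ` C \<union> below ` C \<union> F ` (S \<times> S)"
    have "finite G" "\<And>h. h \<in> G \<Longrightarrow> 1-lipschitz_on UNIV h"
      using G0 C S above below F by (auto simp: G_def)
    then obtain p q where pq: "p \<noteq> q"
      and pq_near: "\<And>h. h \<in> G \<Longrightarrow> \<bar>lip_eval h (molecule (p, q)) - lip_eval h x\<bar> < \<eta>"
      using weak_limit_of_moleculesD[OF weak _ _ \<eta>] by metis
    have D: "\<delta> \<le> dist p q" "dist p q \<le> R" "\<delta> / 2 \<le> g p - g q"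
    proof -
      have "\<bar>lip_eval h (molecule (p, q)) - lip_eval h x\<bar> < 1 / 20" if "h \<in> G0" for h
        using pq_near[of h] that \<eta>20 unfolding G_def by force
      then show "\<delta> \<le> dist p q" "dist p q \<le> R" "\<delta> / 2 \<le> g p - g q"
        using near[OF pq] by blast+
    qed
    have "\<bar>g q + \<delta> / 8\<bar> \<le> R + \<delta>"
      using gR[of q] \<delta> by (simp add: abs_le_iff)
    then obtain c where c: "c \<in> C" "g q + \<delta> / 8 \<le> c" "c \<le> g q + \<delta> / 8 + \<delta> / 4"
      using C(2) by blast
    have small: "\<bar>h p - h q\<bar> < \<kappa>" if h: "h \<in> G" "1-lipschitz_on UNIV h" "\<And>s. s \<in> S \<Longrightarrow> h s = 0" for h
    proof -
      have "\<bar>lip_eval h x\<bar> \<le> norm (x - of_free0 z)"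
        using h by (intro lip_eval_vanishing_on_support) (auto simp: S_def)
      then have "\<bar>lip_eval h (molecule (p, q))\<bar> < 2 * \<eta>"
        using pq_near[OF h(1)] z by linarith
      then have "\<bar>h p - h q\<bar> < 2 * \<eta> * dist p q"
        using pq by (simp add: lip_eval_molecule[OF h(2)] abs_divide divide_less_eq)
      also have "\<dots> \<le> \<kappa>"
        using D \<eta> by (simp add: \<kappa>_def)
      finally show ?thesis .
    qed
    have "\<bar>above c p - above c q\<bar> < \<kappa>"
      using c(1) by (intro small above) (auto simp: G_def above_def)
    moreover have "above c q = 0"
      using c \<delta> infdist_nonneg[of q S] by (simp add: above_def max_def min_def)
    moreover have "\<delta> / 8 \<le> g p - c"
      using c D by simp
    ultimately have "infdist p S < \<kappa>"
      using \<kappa> by (auto simp: above_def min_def max_def abs_less_iff split: if_splits)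
    then obtain s where s: "s \<in> S" "dist p s < \<kappa>"
      using exists_near_of_infdist_less S by metis
    have "\<bar>below c p - below c q\<bar> < \<kappa>"
      using c(1) by (intro small below) (auto simp: G_def below_def)
    moreover have "below c p = 0"
      using \<open>\<delta> / 8 \<le> g p - c\<close> \<delta> infdist_nonneg[of p S] by (simp add: below_def max_def min_def)
    ultimately have "infdist q S < \<kappa>"
      using \<kappa> c by (auto simp: below_def min_def max_def abs_less_iff split: if_splits)
    then obtain t where t: "t \<in> S" "dist q t < \<kappa>"
      using exists_near_of_infdist_less S by metis
    have "norm (molecule (p, q) - molecule (s, t)) \<le> 2 * (dist p s + dist q t) / dist p q"
      by (rule norm_molecule_diff_le[OF pq])
    also have "\<dots> \<le> 4 * \<kappa> / \<delta>"
      using s t D \<delta> \<kappa>(2) by (intro frac_le) auto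
    finally have close: "norm (molecule (p, q) - molecule (s, t)) \<le> 4 * \<kappa> / \<delta>" .
    let ?f = "F (s, t)"
    have "?f \<in> G" using s t by (simp add: G_def)
    then have "norm (x - molecule (s, t)) < 2 * \<eta> + lip_eval ?f (molecule (p, q) - molecule (s, t))"
      using F(2)[of "(s, t)"] pq_near[of ?f] by (simp add: lip_eval_simps abs_less_iff)
    also have "\<dots> \<le> 2 * \<eta> + 4 * \<kappa> / \<delta>"
      using lip_eval_le[OF F(1), of "(s, t)" "molecule (p, q) - molecule (s, t)"] close by simp
    finally have "norm (x - molecule (s, t)) < \<epsilon>" using \<epsilon>' by simp
    moreover have "\<delta> / 2 \<le> dist s t" "dist s t \<le> R + \<delta>"
      using abs_dist_diff_le_sum[of p q s t] s t D \<kappa> \<delta> by (auto simp: abs_le_iff)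
    ultimately show "\<exists>p q. \<delta> / 2 \<le> dist p q \<and> dist p q \<le> R + \<delta> \<and> norm (x - molecule (p, q)) < \<epsilon>"
      by blast
  qed (use \<delta> in simp)
qed

theorem weak_limit_of_molecules_is_molecule:
  fixes x :: "'a::metric_space lipfree"
  assumes "complete (UNIV :: 'a set)" "norm x = 1" "weak_limit_of_molecules x"
  shows "\<exists>p q. p \<noteq> q \<and> x = molecule (p, q)"
  using weak_limit_of_molecules_approx[OF assms(2,3)] molecules_bounded_length_closed[OF assms(1)]
  by metis

lemma Blinfun_lip_eval:
  "1-lipschitz_on UNIV f \<Longrightarrow> blinfun_apply (Blinfun (lip_eval f)) = lip_eval f"
  by (simp add: bounded_linear_Blinfun_apply bounded_linear_lip_eval)

text \<open>
  Milman's theorem provides weak approximation by molecules, which is the situation of the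
  preceding result.
\<close>

theorem extreme_is_molecule:
  fixes x :: "'a::metric_space lipfree"
  assumes complete: "complete (UNIV :: 'a set)" and x: "norm x = 1"
    and ext: "bidual_embed x extreme_point_of cball 0 1"
  shows "\<exists>p q. p \<noteq> q \<and> x = molecule (p, q)"
proof (rule weak_limit_of_molecules_is_molecule[OF complete x])
  have "\<exists>a b :: 'a. a \<noteq> b"
  proof (rule ccontr)
    assume "\<not> (\<exists>a b :: 'a. a \<noteq> b)"
    \<comment> \<open>On a one-point space every function is constant, so the free space is trivial.\<close>
    then have "0-lipschitz_on UNIV f" for f :: "'a \<Rightarrow> real"
      by (intro lipschitz_onI) (metis dist_self mult_zero_left order_refl, simp)
    then have "norm x \<le> 0"
      using lip_eval_le[of 0 _ x] by (intro norm_lipfree_le) (metis abs_le_zero_iff mult_zero_left order_refl)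
    then show False using x by simp
  qed
  then obtain a b :: 'a where ab: "a \<noteq> b" by blast
  show "weak_limit_of_molecules x"
    unfolding weak_limit_of_molecules_def
  proof (intro allI impI)
    fix G :: "('a \<Rightarrow> real) set" and \<epsilon> :: real
    assume G: "finite G" "\<forall>g\<in>G. 1-lipschitz_on UNIV g" and \<epsilon>: "0 < \<epsilon>"
    have "\<exists>m \<in> molecule ` {e. fst e \<noteq> snd e}.
      \<forall>\<phi> \<in> (\<lambda>g. Blinfun (lip_eval g)) ` G. \<bar>blinfun_apply \<phi> m - \<phi> x\<bar> < \<epsilon>"
      using ball_subset_weak_hull_molecules[OF _ ab, of x] x G(1) \<epsilon>
      by (intro extreme_in_weak_closure[OF ext]) (auto simp: norm_molecule_le)
    then show "\<exists>p q. p \<noteq> q \<and> (\<forall>g\<in>G. \<bar>lip_eval g (molecule (p, q)) - lip_eval g x\<bar> < \<epsilon>)"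
      using G(2) by (auto simp: Blinfun_lip_eval)
  qed
qed

section \<open>Paths and simple cycles\<close>

lemma edge_graph_simps [simp]:
  "verts (edge_graph E) = incident_verts E" "arcs (edge_graph E) = E"
  "tail (edge_graph E) = fst" "head (edge_graph E) = snd"
  by (simp_all add: edge_graph_def)

interpretation edge_graph: wf_digraph "edge_graph E" for E
  by unfold_locales (auto simp: incident_verts_def)

lemma edge_path_Nil [simp]: "edge_path E x [] y \<longleftrightarrow> x = y \<and> x \<in> incident_verts E"
  by (auto simp: edge_path_def edge_graph.awalk_Nil_iff)

lemma edge_path_Cons [simp]:
  "edge_path E x (e # es) y \<longleftrightarrow> e \<in> E \<and> x = fst e \<and> edge_path E (snd e) es y"
  by (simp add: edge_path_def edge_graph.awalk_Cons_iff)

lemma edge_path_append [simp]: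
  "edge_path E x (es @ fs) z \<longleftrightarrow> (\<exists>y. edge_path E x es y \<and> edge_path E y fs z)"
proof (induction es arbitrary: x)
  case Nil
  have "x \<in> incident_verts E" if "edge_path E x fs z"
    using that by (cases fs) (auto simp: incident_verts_def)
  then show ?case by auto
qed auto

lemma edge_path_set: "edge_path E x es y \<Longrightarrow> set es \<subseteq> E"
  by (induction es arbitrary: x) auto

lemma edge_path_mono: "edge_path C x es y \<Longrightarrow> C \<subseteq> E \<Longrightarrow> edge_path E x es y"
  by (induction es arbitrary: x) (auto simp: incident_verts_def)

lemma edge_path_verts: "edge_path E x es y \<Longrightarrow> x # map snd es = map fst es @ [y]"
  by (induction es arbitrary: x) auto

lemma edge_path_verts_in:
  assumes "edge_path E x es y"
  shows "x \<in> incident_verts E" "y \<in> incident_verts E"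
  using assms by (auto simp: edge_path_def edge_graph.awalk_hd_in_verts edge_graph.awalk_last_in_verts
      dest: edge_graph.awalk_hd_in_verts edge_graph.awalk_last_in_verts)

lemma edge_path_sum_point_diff:
  "edge_path E x es y \<Longrightarrow> (\<Sum>e\<leftarrow>es. point_diff e) = point_diff (x, y)"
  by (induction es arbitrary: x) (auto simp: point_diff_add)

lemma cycle_iff:
  "pre_digraph.cycle (edge_graph E) es \<longleftrightarrow>
    es \<noteq> [] \<and> distinct (map snd es) \<and> (\<exists>x. edge_path E x es x)"
proof -
  have "tl (pre_digraph.awalk_verts (edge_graph E) x es) = map snd es" if "edge_path E x es x" for x
    using that by (auto simp: edge_path_def pre_digraph.awalk_def pre_digraph.awalk_verts_conv')
  then show ?thesis
    unfolding edge_graph.cycle_def edge_path_def[symmetric] by auto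
qed

text \<open>
  A closed path that repeats a vertex is cut at the repetition into two shorter closed paths, so every
  closed path is assembled from simple cycles.
\<close>

lemma closed_path_sum_eq_zero:
  fixes F :: "'a \<times> 'a \<Rightarrow> 'v::ab_group_add"
  assumes cycle: "\<And>es. pre_digraph.cycle (edge_graph E) es \<Longrightarrow> (\<Sum>e\<leftarrow>es. F e) = 0"
  shows "edge_path E x es x \<Longrightarrow> (\<Sum>e\<leftarrow>es. F e) = 0"
proof (induction "length es" arbitrary: es x rule: less_induct)
  case less
  consider "es = []" | "es \<noteq> []" "distinct (map snd es)" | "\<not> distinct (map snd es)" by blast
  then show ?case
  proof cases
    case 2
    then show ?thesis
      using less.prems by (intro cycle) (auto simp: cycle_iff)
  next
    case 3
    then obtain as bs cs v where "map snd es = as @ [v] @ bs @ [v] @ cs"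
      using not_distinct_decomp by blast
    then obtain us e vs f ws where es: "es = us @ [e] @ vs @ [f] @ ws" "snd e = v" "snd f = v"
      by (auto simp: map_eq_append_conv map_eq_Cons_conv append_eq_map_conv Cons_eq_map_conv)
    have "edge_path E x (us @ [e] @ ws) x" "edge_path E v (vs @ [f]) v"
      using less.prems es by (auto simp: incident_verts_def)
    then have "(\<Sum>e\<leftarrow>us @ [e] @ ws. F e) = 0" "(\<Sum>e\<leftarrow>vs @ [f]. F e) = 0"
      using es(1) by (intro less.hyps; auto)+
    then have "(\<Sum>e\<leftarrow>us. F e) + F e + ((\<Sum>e\<leftarrow>vs. F e) + F f) + (\<Sum>e\<leftarrow>ws. F e) = 0"
      by (simp add: algebra_simps)
    then show ?thesis by (simp add: es(1) algebra_simps)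
  qed simp
qed

text \<open>
  In a simple cycle every vertex is the end of exactly one edge, and also the start of exactly one
  edge since the list of starts is a rotation of the list of ends.
\<close>

lemma cycle_set:
  assumes "pre_digraph.cycle (edge_graph E) es"
  shows "finite (set es)" "set es \<noteq> {}" "set es \<subseteq> E" "distinct es"
    "inj_on fst (set es)" "inj_on snd (set es)" "fst ` set es = snd ` set es"
proof -
  obtain x where x: "edge_path E x es x" "distinct (map snd es)" "es \<noteq> []"
    using assms by (auto simp: cycle_iff)
  have "mset (x # map snd es) = mset (map fst es @ [x])"
    using edge_path_verts[OF x(1)] by (rule arg_cong)
  then have eq: "mset (map snd es) = mset (map fst es)" by simp
  then have "distinct (map fst es)"
    using x(2) mset_eq_imp_distinct_iff by blast
  then show "distinct es" "inj_on fst (set es)" "inj_on snd (set es)"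
    using x(2) by (auto simp: distinct_map)
  show "fst ` set es = snd ` set es"
    using mset_eq_setD[OF eq] by simp
  show "finite (set es)" "set es \<noteq> {}" "set es \<subseteq> E"
    using x edge_path_set[OF x(1)] by auto
qed

text \<open>
  In a finite set of edges without dead ends, following successors eventually repeats an edge.
\<close>

lemma exists_cycle_of_no_dead_ends:
  assumes "finite C" "C \<noteq> {}" "C \<subseteq> E" and next_edge: "\<And>e. e \<in> C \<Longrightarrow> \<exists>f\<in>C. fst f = snd e"
  obtains es where "pre_digraph.cycle (edge_graph E) es" "set es \<subseteq> C"
proof -
  obtain e0 where e0: "e0 \<in> C" using assms(2) by auto
  obtain s where s: "\<And>e. e \<in> C \<Longrightarrow> s e \<in> C \<and> fst (s e) = snd e"
    using next_edge by metis
  define f where "f = (\<lambda>n. (s ^^ n) e0)"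
  have f: "f n \<in> C" for n
    unfolding f_def using e0 s by (induction n) auto
  have f_Suc: "fst (f (Suc n)) = snd (f n)" for n
    using s[OF f[of n]] by (simp add: f_def)
  have "\<not> inj f"
    using f \<open>finite C\<close> by (meson finite_imageD finite_subset image_subsetI infinite_UNIV_nat)
  then obtain i k where ik: "f i = f (i + k)" "k > 0"
    by (auto simp: inj_on_def) (metis less_imp_add_positive linorder_neqE_nat)
  have path: "edge_path C (snd (f i)) (map f [Suc i..<Suc (i + n)]) (snd (f (i + n)))" for n
  proof (induction n)
    case (Suc n)
    then show ?case
      using f[of "Suc (i + n)"] f_Suc[of "i + n"] by (auto simp: incident_verts_def)
  qed (use f in \<open>auto simp: incident_verts_def\<close>)
  have "edge_graph.closed_w C (map f [Suc i..<Suc (i + k)])"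
    unfolding edge_graph.closed_w_def edge_path_def[symmetric] using path[of k] ik by auto
  then obtain es where "pre_digraph.cycle (edge_graph C) es"
    using edge_graph.closed_w_imp_cycle by blast
  then have "pre_digraph.cycle (edge_graph E) es" "set es \<subseteq> C"
    using cycle_set(3)[of C es] edge_path_mono[OF _ \<open>C \<subseteq> E\<close>] unfolding cycle_iff by blast+
  then show ?thesis by (rule that)
qed

section \<open>Simple cycles as minimal positive relations between molecules\<close>

definition positively_dependent :: "('i \<Rightarrow> 'v::real_vector) \<Rightarrow> 'i set \<Rightarrow> bool" where
  "positively_dependent m C \<longleftrightarrow>
    finite C \<and> C \<noteq> {} \<and> (\<exists>c. (\<forall>e\<in>C. 0 < c e) \<and> (\<Sum>e\<in>C. c e *\<^sub>R m e) = 0)"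

lemma of_free0_eq_0_iff: "of_free0 z = 0 \<longleftrightarrow> z = 0"
  by (metis norm_eq_zero norm_of_free0)

text \<open>
  The coefficient at the vertex \<open>v\<close>: a linear relation between edge vectors is a flow with inflow equal to
  outflow at every vertex (Kirchhoff's law).
\<close>

lemma point_diff_relation_balanced:
  assumes "finite C" "(\<Sum>e\<in>C. c e *\<^sub>R point_diff e) = 0"
  shows "(\<Sum>e | e \<in> C \<and> fst e = v. c e) = (\<Sum>e | e \<in> C \<and> snd e = v. c e)"
proof -
  have "of_free0 (\<Sum>e\<in>C. c e *\<^sub>R point_diff0 e) = 0"
    using assms(2) by (simp add: linear_sum[OF linear_of_free0] linear_scale[OF linear_of_free0] point_diff_of_free0)
  then have "coef (\<Sum>e\<in>C. c e *\<^sub>R point_diff0 e) v = 0"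
    by (simp add: of_free0_eq_0_iff)
  moreover have "coef (\<Sum>e\<in>C. c e *\<^sub>R point_diff0 e) v
      = (\<Sum>e\<in>C. c e * (indicator {fst e} v - indicator {snd e} v))"
    using \<open>finite C\<close> by (induction C rule: finite_induct) (auto simp: coef_point_diff0)
  ultimately have "(\<Sum>e\<in>C. c e * indicator {fst e} v) = (\<Sum>e\<in>C. c e * indicator {snd e} v)"
    by (simp add: right_diff_distrib sum_subtractf)
  moreover have "(\<Sum>e\<in>C. c e * indicator {h e} v) = (\<Sum>e | e \<in> C \<and> h e = v. c e)" for h
    using \<open>finite C\<close> by (auto simp: indicator_def sum.inter_filter[symmetric] if_distrib eq_commute intro!: sum.cong cong: if_cong)
  ultimately show ?thesis by simp
qed

text \<open>
  At each vertex of a simple cycle one edge enters and one leaves, so by Kirchhoff's law consecutive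
  edges have the same coefficient.
\<close>

lemma cycle_relation_constant:
  assumes cyc: "pre_digraph.cycle (edge_graph E) es"
    and rel: "(\<Sum>e\<in>set es. c e *\<^sub>R point_diff e) = 0"
  shows "c constant_on set es"
proof -
  note es = cycle_set[OF cyc]
  obtain x where x: "edge_path E x es x" "es \<noteq> []" using cyc by (auto simp: cycle_iff)
  have step: "c f = c e" if "e \<in> set es" "f \<in> set es" "fst f = snd e" for e f
  proof -
    have "e' = f" if "e' \<in> set es" "fst e' = snd e" for e'
      using inj_onD[OF es(5), of e' f] that \<open>f \<in> set es\<close> \<open>fst f = snd e\<close> by simp
    then have "{e' \<in> set es. fst e' = snd e} = {f}"
      using that by blast
    moreover have "{e' \<in> set es. snd e' = snd e} = {e}"
      using inj_onD[OF es(6)] \<open>e \<in> set es\<close> by blast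
    ultimately show ?thesis
      using point_diff_relation_balanced[OF es(1) rel, of "snd e"] by simp
  qed
  have "\<forall>e\<in>set fs. c e = k" if "edge_path E y fs z" "set fs \<subseteq> set es"
    "g \<in> set es" "snd g = y" "c g = k" for fs y z g k
    using that
  proof (induction fs arbitrary: y g)
    case (Cons e fs)
    then have "c e = k" using step[of g e] by auto
    then show ?case using Cons.IH[of "snd e" e] Cons.prems by auto
  qed simp
  moreover obtain e fs where "es = e # fs" using x by (cases es) auto
  ultimately have "\<forall>f\<in>set es. c f = c e"
    using x(1) by fastforce
  then show ?thesis by (auto simp: constant_on_def)
qed

lemma cycle_sum_point_diff:
  assumes "pre_digraph.cycle (edge_graph E) es"
  shows "(\<Sum>e\<in>set es. point_diff e) = 0"
proof -
  obtain x where "edge_path E x es x" using assms by (auto simp: cycle_iff)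
  then have "(\<Sum>e\<leftarrow>es. point_diff e) = 0" by (simp add: edge_path_sum_point_diff)
  then show ?thesis using cycle_set(4)[OF assms] by (simp add: sum_list_distinct_conv_sum_set)
qed

lemma scaleR_molecule:
  assumes "fst e \<noteq> snd e"
  shows "c *\<^sub>R molecule e = (c / edge_length e) *\<^sub>R point_diff e"
  using assms by (simp add: point_diff_def edge_length_def)

text \<open>
  By Kirchhoff's law a vertex with positive inflow has positive outflow, so the edges of a positive
  relation have no dead ends.
\<close>

lemma positively_dependent_contains_cycle:
  assumes "irrefl E" "C \<subseteq> E" "positively_dependent molecule C"
  obtains es where "pre_digraph.cycle (edge_graph E) es" "set es \<subseteq> C"
proof -
  obtain c where C: "finite C" "C \<noteq> {}" and c: "\<And>e. e \<in> C \<Longrightarrow> 0 < c e"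
    and rel: "(\<Sum>e\<in>C. c e *\<^sub>R molecule e) = 0"
    using assms(3) by (auto simp: positively_dependent_def)
  have ne: "fst e \<noteq> snd e" if "e \<in> C" for e
    using that assms(1,2) by (cases e) (auto simp: irrefl_def)
  have "(\<Sum>e\<in>C. (c e / edge_length e) *\<^sub>R point_diff e) = 0"
    using rel ne by (simp add: scaleR_molecule)
  note bal = point_diff_relation_balanced[OF C(1) this]
  have pos: "0 < c e / edge_length e" if "e \<in> C" for e
    using c ne that by (simp add: edge_length_def)
  have "\<exists>f\<in>C. fst f = snd e" if e: "e \<in> C" for e
  proof (rule ccontr)
    assume "\<not> (\<exists>f\<in>C. fst f = snd e)"
    then have "{f \<in> C. fst f = snd e} = {}" by auto
    moreover have "0 < (\<Sum>f | f \<in> C \<and> snd f = snd e. c f / edge_length f)"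
    proof (rule sum_pos)
      show "{f \<in> C. snd f = snd e} \<noteq> {}" using e by blast
    qed (use C(1) pos in auto)
    ultimately show False using bal[of "snd e"] by (simp only: sum.empty)
  qed
  then show ?thesis
    using exists_cycle_of_no_dead_ends[OF C assms(2)] that by blast
qed

lemma cycle_positively_dependent:
  assumes cyc: "pre_digraph.cycle (edge_graph E) es" and irr: "irrefl E"
  shows "positively_dependent molecule (set es)"
proof -
  have "\<forall>e\<in>set es. 0 < edge_length e"
    using cycle_set(3)[OF cyc] irr by (auto simp: edge_length_def irrefl_def)
  then show ?thesis
    using cycle_set(1,2)[OF cyc] cycle_sum_point_diff[OF cyc]
    unfolding positively_dependent_def point_diff_def by blast
qed

text \<open>
  A simple cycle carries the positive relation given by the lengths. A smaller positively
  dependent set would contain another cycle, whose relation would be a nonconstant relation on the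
  first. Conversely, a positively dependent set contains a cycle, and minimality makes them equal.
\<close>

lemma simple_cycle_iff_minimal_positively_dependent:
  assumes irrefl: "irrefl E" and "C \<subseteq> E"
  shows "simple_cycle E C \<longleftrightarrow>
    positively_dependent molecule C \<and> (\<forall>D. D \<subset> C \<longrightarrow> \<not> positively_dependent molecule D)"
proof (intro iffI conjI allI impI notI)
  assume "simple_cycle E C"
  then obtain es where es: "pre_digraph.cycle (edge_graph E) es" "C = set es"
    by (auto simp: simple_cycle_def)
  show "positively_dependent molecule C"
    using cycle_positively_dependent[OF es(1) irrefl] es(2) by simp
  fix D assume D: "D \<subset> C" "positively_dependent molecule D"
  then obtain fs where fs: "pre_digraph.cycle (edge_graph E) fs" "set fs \<subseteq> D"
    using positively_dependent_contains_cycle[OF irrefl _ D(2)] \<open>C \<subseteq> E\<close> by blast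
  have "(\<Sum>e\<in>set es. indicator (set fs) e *\<^sub>R point_diff e) = (\<Sum>e\<in>set fs. point_diff e)"
    using fs D es by (intro sum.mono_neutral_cong_right) auto
  then have "(indicator (set fs) :: 'a \<times> 'a \<Rightarrow> real) constant_on set es"
    using cycle_relation_constant[OF es(1)] cycle_sum_point_diff[OF fs(1)] by simp
  then obtain k where k: "\<And>e. e \<in> C \<Longrightarrow> indicator (set fs) e = (k :: real)"
    by (auto simp: constant_on_def es(2))
  obtain e where "e \<in> set fs" using cycle_set(2)[OF fs(1)] by (metis ex_in_conv)
  moreover obtain e' where "e' \<in> C" "e' \<notin> D" using D by auto
  moreover have "e \<in> C" "e' \<notin> set fs" using calculation fs(2) D(1) by blast+
  ultimately show False
    using k[of e] k[of e'] by simp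
next
  assume min: "positively_dependent molecule C \<and> (\<forall>D. D \<subset> C \<longrightarrow> \<not> positively_dependent molecule D)"
  then obtain es where es: "pre_digraph.cycle (edge_graph E) es" "set es \<subseteq> C"
    using positively_dependent_contains_cycle[OF irrefl \<open>C \<subseteq> E\<close>] by blast
  then have "set es = C"
    using min cycle_positively_dependent[OF es(1) irrefl] by blast
  then show "simple_cycle E C" using es(1) by (auto simp: simple_cycle_def)
qed

section \<open>From isometries to edge bijections\<close>

lemma linear_isometry_bounded_linear: "linear_isometry T \<Longrightarrow> bounded_linear T"
  unfolding linear_isometry_def
  by (intro bounded_linear_intro[of _ 1]) (auto simp: linear_add linear_scale)

lemma linear_isometry_inj: "linear_isometry T \<Longrightarrow> inj T"
  unfolding linear_isometry_def by (simp add: linear_injective_0) (metis norm_eq_zero)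

lemma linear_isometry_inv:
  assumes "linear_isometry T" "surj T"
  shows "linear_isometry (inv T)"
proof -
  note lin = conjunct1[OF assms(1)[unfolded linear_isometry_def]]
  have TS: "T (inv T y) = y" and ST: "inv T (T x) = x" for x y
    using surj_f_inv_f[OF assms(2)] inv_f_f[OF linear_isometry_inj[OF assms(1)]] by auto
  have "linear (inv T)"
  proof (rule linearI)
    show "inv T (x + y) = inv T x + inv T y" for x y
      using ST[of "inv T x + inv T y"] by (simp add: linear_add[OF lin] TS)
    show "inv T (c *\<^sub>R x) = c *\<^sub>R inv T x" for c x
      using ST[of "c *\<^sub>R inv T x"] by (simp add: linear_scale[OF lin] TS)
  qed
  moreover have "norm (inv T y) = norm y" for y
    using assms(1) TS[of y] unfolding linear_isometry_def by metis
  ultimately show ?thesis by (simp add: linear_isometry_def)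
qed

text \<open>
  Precomposition with \<open>s = T\<^sup>-\<^sup>1\<close> defines an injective contraction \<open>P\<close> of the biduals that takes the image
  of \<open>T x\<close> back to that of \<open>x\<close>; a segment through the former would be carried to one through the latter.
\<close>

lemma linear_isometry_preserves_bidual_extreme:
  fixes T :: "'b::real_normed_vector \<Rightarrow> 'c::real_normed_vector"
  assumes T: "linear_isometry T" "surj T" and x: "norm x \<le> 1"
    and ext: "bidual_embed x extreme_point_of cball 0 1"
  shows "bidual_embed (T x) extreme_point_of cball 0 1"
proof -
  define S where "S = inv T"
  have ST: "S (T y) = y" for y
    using inv_f_f[OF linear_isometry_inj[OF T(1)]] by (simp add: S_def)
  have S: "bounded_linear S" "norm (S y) = norm y" for y
    using linear_isometry_bounded_linear linear_isometry_inv[OF T]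
    by (auto simp: S_def linear_isometry_def)
  define s t where "s = Blinfun S" and "t = Blinfun T"
  have s: "blinfun_apply s = S" and t: "blinfun_apply t = T"
    using S linear_isometry_bounded_linear[OF T(1)] by (simp_all add: s_def t_def bounded_linear_Blinfun_apply)
  have "norm s \<le> 1"
    using S(2) by (intro norm_blinfun_bound) (auto simp: s)
  define P where "P = (\<lambda>\<Psi> :: ('c \<Rightarrow>\<^sub>L real) \<Rightarrow>\<^sub>L real. Blinfun (\<lambda>\<phi> :: 'b \<Rightarrow>\<^sub>L real. blinfun_apply \<Psi> (\<phi> o\<^sub>L s)))"
  have "bounded_linear (\<lambda>\<phi> :: 'b \<Rightarrow>\<^sub>L real. blinfun_apply \<Psi> (\<phi> o\<^sub>L s))" for \<Psi> :: "('c \<Rightarrow>\<^sub>L real) \<Rightarrow>\<^sub>L real"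
    by (intro bounded_linear_compose[OF blinfun.bounded_linear_right]
        bounded_bilinear.bounded_linear_left[OF bounded_bilinear_blinfun_compose])
  then have P: "blinfun_apply (P \<Psi>) \<phi> = blinfun_apply \<Psi> (\<phi> o\<^sub>L s)" for \<Psi> \<phi>
    by (simp add: P_def bounded_linear_Blinfun_apply)
  have norm_P: "norm (P \<Psi>) \<le> norm \<Psi>" for \<Psi>
  proof (rule norm_blinfun_bound)
    fix \<phi> :: "'b \<Rightarrow>\<^sub>L real"
    have "norm (\<phi> o\<^sub>L s) \<le> norm \<phi> * norm s" by (rule norm_blinfun_compose)
    also have "\<dots> \<le> norm \<phi>" using \<open>norm s \<le> 1\<close> by (simp add: mult_left_le)
    finally have "norm \<Psi> * norm (\<phi> o\<^sub>L s) \<le> norm \<Psi> * norm \<phi>"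
      by (rule mult_left_mono) simp
    then show "norm (blinfun_apply (P \<Psi>) \<phi>) \<le> norm \<Psi> * norm \<phi>"
      using norm_blinfun[of \<Psi> "\<phi> o\<^sub>L s"] unfolding P by linarith
  qed simp
  have P_inj: "\<Phi> = \<Psi>" if "P \<Phi> = P \<Psi>" for \<Phi> \<Psi>
  proof (rule blinfun_eqI)
    fix \<psi> :: "'c \<Rightarrow>\<^sub>L real"
    have "(\<psi> o\<^sub>L t) o\<^sub>L s = \<psi>"
      using surj_f_inv_f[OF T(2)] by (intro blinfun_eqI) (simp add: s t S_def)
    then show "blinfun_apply \<Phi> \<psi> = blinfun_apply \<Psi> \<psi>"
      using that P[of \<Phi> "\<psi> o\<^sub>L t"] P[of \<Psi> "\<psi> o\<^sub>L t"] by simp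
  qed
  have P_x: "P (bidual_embed (T x)) = bidual_embed x"
    by (rule blinfun_eqI) (simp add: P s ST)
  have "norm (T x) \<le> 1" using T(1) x by (simp add: linear_isometry_def)
  then have "bidual_embed (T x) \<in> cball 0 1"
    using norm_bidual_embed_le[of "T x"] by simp
  moreover have "bidual_embed (T x) \<notin> open_segment a b" if ab: "a \<in> cball 0 1" "b \<in> cball 0 1" for a b
  proof
    assume "bidual_embed (T x) \<in> open_segment a b"
    then obtain u where u: "a \<noteq> b" "0 < u" "u < 1" "bidual_embed (T x) = (1 - u) *\<^sub>R a + u *\<^sub>R b"
      by (auto simp: in_segment)
    have "bidual_embed x = (1 - u) *\<^sub>R P a + u *\<^sub>R P b"
      unfolding P_x[symmetric] u(4) by (rule blinfun_eqI) (simp add: P blinfun.add_left blinfun.scaleR_left)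
    then have "bidual_embed x \<in> open_segment (P a) (P b)"
      using u P_inj by (auto simp: in_segment)
    moreover have "P a \<in> cball 0 1" "P b \<in> cball 0 1"
      using ab norm_P[of a] norm_P[of b] by auto
    ultimately show False using ext by (auto simp: extreme_point_of_def)
  qed
  ultimately show ?thesis by (auto simp: extreme_point_of_def)
qed

text \<open>
  As functions, molecules are positive at the first point and negative at the second.
\<close>

lemma molecule_eq_imp_eq:
  assumes ne: "fst e \<noteq> snd e" "fst f \<noteq> snd f" and eq: "molecule e = molecule f"
  shows "e = f"
proof -
  have "of_free0 (molecule0 e - molecule0 f) = 0"
    using eq by (simp add: molecule_def linear_diff[OF linear_of_free0])
  then have "molecule0 e = molecule0 f" by (simp add: of_free0_eq_0_iff)
  then have "coef (molecule0 e) v = coef (molecule0 f) v" for v by simp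
  then have v: "(indicator {fst e} v - indicator {snd e} v) / dist (fst e) (snd e)
      = (indicator {fst f} v - indicator {snd f} v) / (dist (fst f) (snd f) :: real)" for v
    by (simp add: molecule0.rep_eq)
  have d: "0 < 1 / dist (fst e) (snd e)" using ne by simp
  have "fst e = fst f"
  proof (rule ccontr)
    assume "fst e \<noteq> fst f"
    then have "1 / dist (fst e) (snd e) = (0 - indicator {snd f} (fst e)) / dist (fst f) (snd f)"
      using v[of "fst e"] ne by simp
    also have "\<dots> \<le> 0" by (intro divide_nonpos_nonneg) auto
    finally show False using d by simp
  qed
  moreover have "snd e = snd f"
  proof (rule ccontr)
    assume "snd e \<noteq> snd f"
    then have "- (1 / dist (fst e) (snd e)) = indicator {fst f} (snd e) / dist (fst f) (snd f)"
      using v[of "snd e"] ne by simp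
    also have "\<dots> \<ge> 0" by (intro divide_nonneg_nonneg) auto
    finally show False using d by simp
  qed
  ultimately show ?thesis by (simp add: prod_eq_iff)
qed

lemma ext_edges_distinct: "e \<in> ext_edges \<Longrightarrow> fst e \<noteq> snd e"
  by (simp add: ext_edges_def)

lemma isometry_maps_ext_molecule:
  fixes T :: "'a::metric_space lipfree \<Rightarrow> 'b::metric_space lipfree"
  assumes "complete (UNIV :: 'b set)" and T: "linear_isometry T" "surj T" and e: "e \<in> ext_edges"
  shows "\<exists>f\<in>ext_edges. T (molecule e) = molecule f"
proof -
  have e': "norm (molecule e) = 1" "bidual_embed (molecule e) extreme_point_of cball 0 1"
    using e norm_molecule[of e] by (auto simp: ext_edges_def)
  have ext: "bidual_embed (T (molecule e)) extreme_point_of cball 0 1"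
    using linear_isometry_preserves_bidual_extreme[OF T _ e'(2)] e'(1) by simp
  moreover have "norm (T (molecule e)) = 1"
    using T(1) e'(1) by (simp add: linear_isometry_def)
  ultimately obtain p q where "p \<noteq> q" "T (molecule e) = molecule (p, q)"
    using extreme_is_molecule[OF assms(1)] by blast
  then show ?thesis
    using ext by (intro bexI[of _ "(p, q)"]) (auto simp: ext_edges_def)
qed

lemma positively_dependent_isometry:
  assumes T: "linear_isometry T" and \<sigma>: "inj_on \<sigma> C"
    and eq: "\<And>e. e \<in> C \<Longrightarrow> T (molecule e) = molecule (\<sigma> e)"
  shows "positively_dependent molecule (\<sigma> ` C) \<longleftrightarrow> positively_dependent molecule C"
proof -
  note lin = conjunct1[OF T[unfolded linear_isometry_def]]
  have T0: "T y = 0 \<longleftrightarrow> y = 0" for y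
    using T unfolding linear_isometry_def by (metis norm_eq_zero)
  have sum: "(\<Sum>f\<in>\<sigma> ` C. c f *\<^sub>R molecule f) = T (\<Sum>e\<in>C. c (\<sigma> e) *\<^sub>R molecule e)" for c
    using eq by (simp add: sum.reindex[OF \<sigma>] linear_sum[OF lin] linear_scale[OF lin])
  show ?thesis
    unfolding positively_dependent_def sum T0 finite_image_iff[OF \<sigma>]
  proof (intro conj_cong refl iffI)
    assume "\<exists>c. (\<forall>f\<in>\<sigma> ` C. 0 < c f) \<and> (\<Sum>e\<in>C. c (\<sigma> e) *\<^sub>R molecule e) = 0"
    then obtain c where "\<forall>e\<in>C. 0 < c (\<sigma> e)" "(\<Sum>e\<in>C. c (\<sigma> e) *\<^sub>R molecule e) = 0" by auto
    then show "\<exists>c. (\<forall>e\<in>C. 0 < c e) \<and> (\<Sum>e\<in>C. c e *\<^sub>R molecule e) = 0"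
      by (intro exI[of _ "\<lambda>e. c (\<sigma> e)"]) simp
  next
    assume "\<exists>c. (\<forall>e\<in>C. 0 < c e) \<and> (\<Sum>e\<in>C. c e *\<^sub>R molecule e) = 0"
    then obtain c where "\<forall>e\<in>C. 0 < c e" "(\<Sum>e\<in>C. c e *\<^sub>R molecule e) = 0" by auto
    then show "\<exists>c. (\<forall>f\<in>\<sigma> ` C. 0 < c f) \<and> (\<Sum>e\<in>C. c (\<sigma> e) *\<^sub>R molecule e) = 0"
      by (intro exI[of _ "\<lambda>f. c (inv_into C \<sigma> f)"]) (simp add: inv_into_f_f[OF \<sigma>])
  qed auto
qed

text \<open>
  Positive dependence, hence its minimal instances, is preserved by an injective linear map.
\<close>

lemma isometry_cond_Sa:
  assumes T: "linear_isometry T" and \<sigma>: "bij_betw \<sigma> E\<^sub>1 E\<^sub>2" and "irrefl E\<^sub>1" "irrefl E\<^sub>2"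
    and eq: "\<And>e. e \<in> E\<^sub>1 \<Longrightarrow> T (molecule e) = molecule (\<sigma> e)"
  shows "cond_Sa E\<^sub>1 E\<^sub>2 \<sigma>"
  unfolding cond_Sa_def
proof (intro allI impI)
  fix C assume C: "C \<subseteq> E\<^sub>1"
  have inj: "inj_on \<sigma> D" if "D \<subseteq> C" for D
    using \<sigma> C that by (meson bij_betw_imp_inj_on inj_on_subset subset_trans)
  have dep: "positively_dependent molecule (\<sigma> ` D) \<longleftrightarrow> positively_dependent molecule D" if "D \<subseteq> C" for D
    using that C eq by (intro positively_dependent_isometry[OF T inj]) auto
  have "(\<forall>D'. D' \<subset> \<sigma> ` C \<longrightarrow> \<not> positively_dependent molecule D') \<longleftrightarrow>
      (\<forall>D. D \<subset> C \<longrightarrow> \<not> positively_dependent molecule (\<sigma> ` D))"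
  proof (intro iffI allI impI)
    fix D assume *: "\<forall>D'. D' \<subset> \<sigma> ` C \<longrightarrow> \<not> positively_dependent molecule D'" and D: "D \<subset> C"
    then have "\<sigma> ` D \<subset> \<sigma> ` C"
      using inj[of C] inj_on_image_eq_iff[of \<sigma> C D C] by blast
    then show "\<not> positively_dependent molecule (\<sigma> ` D)" using * by blast
  next
    fix D' assume *: "\<forall>D. D \<subset> C \<longrightarrow> \<not> positively_dependent molecule (\<sigma> ` D)" and D': "D' \<subset> \<sigma> ` C"
    then obtain D where "D \<subseteq> C" "D' = \<sigma> ` D" by (meson psubset_imp_subset subset_imageE)
    then show "\<not> positively_dependent molecule D'" using * D' by blast
  qed
  moreover have "\<sigma> ` C \<subseteq> E\<^sub>2" using \<sigma> C by (auto simp: bij_betw_def)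
  ultimately show "simple_cycle E\<^sub>1 C \<longleftrightarrow> simple_cycle E\<^sub>2 (\<sigma> ` C)"
    using simple_cycle_iff_minimal_positively_dependent[OF \<open>irrefl E\<^sub>1\<close> C]
      simple_cycle_iff_minimal_positively_dependent[OF \<open>irrefl E\<^sub>2\<close> \<open>\<sigma> ` C \<subseteq> E\<^sub>2\<close>] dep
    by (metis order_refl psubset_imp_subset)
qed

lemma irrefl_distinct: "irrefl E \<Longrightarrow> e \<in> E \<Longrightarrow> fst e \<noteq> snd e"
  by (cases e) (auto simp: irrefl_def)

text \<open>
  The length relation on a simple cycle \<open>C\<close> is mapped by \<open>T\<close> to a relation on the simple cycle \<open>\<sigma>(C)\<close>,
  whose coefficients with respect to the differences of point masses are the ratios of lengths; on a
  simple cycle all coefficients of such a relation agree.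
\<close>

lemma isometry_cond_Sb:
  assumes T: "linear_isometry T" and \<sigma>: "bij_betw \<sigma> E\<^sub>1 E\<^sub>2" and irr: "irrefl E\<^sub>1" "irrefl E\<^sub>2"
    and eq: "\<And>e. e \<in> E\<^sub>1 \<Longrightarrow> T (molecule e) = molecule (\<sigma> e)"
  shows "cond_Sb E\<^sub>1 \<sigma>"
  unfolding cond_Sb_def
proof (intro allI impI)
  fix C assume C: "C \<subseteq> E\<^sub>1" and cyc: "simple_cycle E\<^sub>1 C"
  note lin = conjunct1[OF T[unfolded linear_isometry_def]]
  have inj: "inj_on \<sigma> C"
    using \<sigma> C by (meson bij_betw_imp_inj_on inj_on_subset)
  obtain es where es: "pre_digraph.cycle (edge_graph E\<^sub>1) es" "C = set es"
    using cyc by (auto simp: simple_cycle_def)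
  have "simple_cycle E\<^sub>2 (\<sigma> ` C)"
    using isometry_cond_Sa[OF assms] C cyc by (simp add: cond_Sa_def)
  then obtain fs where fs: "pre_digraph.cycle (edge_graph E\<^sub>2) fs" "\<sigma> ` C = set fs"
    by (auto simp: simple_cycle_def)
  have ne: "fst (\<sigma> e) \<noteq> snd (\<sigma> e)" if "e \<in> C" for e
    using irr(2) C \<sigma> that by (intro irrefl_distinct) (auto simp: bij_betw_def)
  define c where "c = (\<lambda>f. edge_length (inv_into C \<sigma> f) / edge_length f)"
  have "T (\<Sum>e\<in>C. point_diff e) = (\<Sum>e\<in>C. edge_length e *\<^sub>R molecule (\<sigma> e))"
    using C eq by (auto simp: linear_sum[OF lin] linear_scale[OF lin] point_diff_def intro!: sum.cong)
  also have "\<dots> = (\<Sum>f\<in>\<sigma> ` C. c f *\<^sub>R point_diff f)"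
    using ne by (simp add: sum.reindex[OF inj] scaleR_molecule c_def inv_into_f_f[OF inj])
  finally have "(\<Sum>f\<in>set fs. c f *\<^sub>R point_diff f) = 0"
    using cycle_sum_point_diff[OF es(1)] es(2) fs(2) by (simp add: linear_0[OF lin])
  then obtain k where k: "\<And>f. f \<in> \<sigma> ` C \<Longrightarrow> c f = k"
    using cycle_relation_constant[OF fs(1)] fs(2) unfolding constant_on_def by metis
  have "edge_length e / edge_length (\<sigma> e) = k" if "e \<in> C" for e
    using k[of "\<sigma> e"] that by (simp add: c_def inv_into_f_f[OF inj])
  then show "(\<lambda>e. edge_length e / edge_length (\<sigma> e)) constant_on C"
    by (auto simp: constant_on_def)
qed

lemma isometry_path_norm:
  assumes T: "linear_isometry T" and eq: "\<And>e. e \<in> E \<Longrightarrow> T (molecule e) = molecule (\<sigma> e)"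
    and path: "edge_path E x es y"
  shows "norm (\<Sum>e\<leftarrow>es. edge_length e *\<^sub>R molecule (\<sigma> e)) = dist x y"
proof -
  note lin = conjunct1[OF T[unfolded linear_isometry_def]]
  have "set es \<subseteq> E \<Longrightarrow> (\<Sum>e\<leftarrow>es. edge_length e *\<^sub>R molecule (\<sigma> e)) = T (\<Sum>e\<leftarrow>es. point_diff e)"
    by (induction es) (auto simp: linear_0[OF lin] linear_add[OF lin] linear_scale[OF lin] point_diff_def eq)
  then show ?thesis
    using edge_path_set[OF path] edge_path_sum_point_diff[OF path] T
    by (simp add: linear_isometry_def norm_point_diff edge_length_def)
qed

lemma isometry_cond_Sc:
  assumes T: "linear_isometry T" "surj T" and \<sigma>: "bij_betw \<sigma> E\<^sub>1 E\<^sub>2"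
    and eq: "\<And>e. e \<in> E\<^sub>1 \<Longrightarrow> T (molecule e) = molecule (\<sigma> e)"
  shows "cond_Sc E\<^sub>1 E\<^sub>2 \<sigma>"
proof -
  have "inv T (molecule f) = molecule (inv_into E\<^sub>1 \<sigma> f)" if "f \<in> E\<^sub>2" for f
  proof -
    have "inv_into E\<^sub>1 \<sigma> f \<in> E\<^sub>1" "\<sigma> (inv_into E\<^sub>1 \<sigma> f) = f"
      using \<sigma> that by (auto simp: bij_betw_def inv_into_into f_inv_into_f)
    then show ?thesis
      using eq inv_f_f[OF linear_isometry_inj[OF T(1)]] by metis
  qed
  note inv = isometry_path_norm[OF linear_isometry_inv[OF T] this]
  show ?thesis
    unfolding cond_Sc_def
    by (intro conjI ballI allI impI isometry_path_norm[OF T(1) eq, symmetric] inv[symmetric])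
qed

section \<open>From edge bijections to isometries\<close>

text \<open>
  What the image under \<open>T\<^sub>\<sigma>\<close> of the difference of the endpoints of a path has to be.
\<close>

definition transported_length ::
  "('a::metric_space \<times> 'a \<Rightarrow> 'b::metric_space \<times> 'b) \<Rightarrow> ('a \<times> 'a) list \<Rightarrow> 'b lipfree" where
  "transported_length \<sigma> es = (\<Sum>e\<leftarrow>es. edge_length e *\<^sub>R molecule (\<sigma> e))"

lemma cond_ScD:
  assumes "cond_Sc E\<^sub>1 E\<^sub>2 \<sigma>"
  shows "edge_path E\<^sub>1 x es y \<Longrightarrow> norm (transported_length \<sigma> es) = dist x y"
    and "edge_path E\<^sub>2 x' fs y' \<Longrightarrow> norm (transported_length (inv_into E\<^sub>1 \<sigma>) fs) = dist x' y'"
  using assms edge_path_verts_in[of E\<^sub>1 x es y] edge_path_verts_in[of E\<^sub>2 x' fs y']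
  unfolding cond_Sc_def transported_length_def by simp_all

text \<open>
  Telescoping along paths reduces to differences of vertices, and \<open>m \<mapsto> \<chi>\<^sub>m - \<chi>\<^sub>b\<close> is an isometric
  embedding, so density of the vertices suffices.
\<close>

lemma bounded_linear_eq_on_edges:
  fixes S T :: "'a::metric_space lipfree \<Rightarrow> 'c::real_normed_vector"
  assumes E: "weakly_admissible E" and S: "bounded_linear S" and T: "bounded_linear T"
    and eq: "\<And>e. e \<in> E \<Longrightarrow> S (molecule e) = T (molecule e)"
  shows "S = T"
proof -
  have V: "closure (incident_verts E) = UNIV"
    and conn: "\<And>x y. x \<in> incident_verts E \<Longrightarrow> y \<in> incident_verts E \<Longrightarrow> \<exists>es. edge_path E x es y"
    using E by (auto simp: weakly_admissible_def)
  obtain b where b: "b \<in> incident_verts E"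
    using V by (metis closure_empty empty_iff ex_in_conv UNIV_I)
  have eq_pd: "S (point_diff e) = T (point_diff e)" if "e \<in> E" for e
    using eq[OF that] by (simp add: point_diff_def linear_scale[OF bounded_linear.linear] S T)
  have on_V: "S (point_diff (v, b)) = T (point_diff (v, b))" if v: "v \<in> incident_verts E" for v
  proof -
    obtain es where es: "edge_path E v es b" using conn v b by blast
    have "set es \<subseteq> E \<Longrightarrow> S (\<Sum>e\<leftarrow>es. point_diff e) = T (\<Sum>e\<leftarrow>es. point_diff e)"
      by (induction es) (auto simp: linear_0[OF bounded_linear.linear] linear_add[OF bounded_linear.linear] S T eq_pd)
    then show ?thesis
      using edge_path_set[OF es] by (simp add: edge_path_sum_point_diff[OF es])
  qed
  show ?thesis
  proof (rule bounded_linear_eq_of_point_diff[OF S T])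
    fix m
    obtain v where v: "\<And>n. v n \<in> incident_verts E" "v \<longlonglongrightarrow> m"
      using V closure_sequential[of m "incident_verts E"] by auto
    have "(\<lambda>n. point_diff (v n, b)) \<longlonglongrightarrow> point_diff (m, b)"
    proof (rule LIM_zero_cancel, rule Lim_null_comparison)
      have "point_diff (v n, b) - point_diff (m, b) = point_diff (v n, m)" for n
        using point_diff_add[of "v n" m b] by (simp add: algebra_simps)
      then show "\<forall>\<^sub>F n in sequentially. norm (point_diff (v n, b) - point_diff (m, b)) \<le> dist (v n) m"
        by (simp add: norm_point_diff edge_length_def)
      show "(\<lambda>n. dist (v n) m) \<longlonglongrightarrow> 0"
        using v(2) by (rule tendsto_dist_iff[THEN iffD1])
    qed
    from bounded_linear.tendsto[OF S this] bounded_linear.tendsto[OF T this]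
    show "S (point_diff (m, b)) = T (point_diff (m, b))"
      using LIMSEQ_unique by (simp add: on_V v(1))
  qed
qed

text \<open>
  The bound makes transported lengths of closed paths vanish, because \<open>d(x,x) = 0\<close>. Hence the
  transported length from \<open>v\<close> to a fixed vertex \<open>b\<close> is a function \<open>t\<close> of \<open>v\<close>, and the bound says that \<open>t\<close> is
  \<open>1\<close>-Lipschitz. It extends from the dense set of vertices, and the universal property applies.
\<close>

lemma exists_contraction:
  fixes \<sigma> :: "'a::metric_space \<times> 'a \<Rightarrow> 'b::metric_space \<times> 'b"
  assumes E: "weakly_admissible E"
    and le: "\<And>x es y. edge_path E x es y \<Longrightarrow> norm (transported_length \<sigma> es) \<le> dist x y"
  obtains T :: "'a lipfree \<Rightarrow> 'b lipfree" where "linear T" "\<And>x. norm (T x) \<le> norm x"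
    "\<And>e. e \<in> E \<Longrightarrow> T (molecule e) = molecule (\<sigma> e)"
proof -
  let ?V = "incident_verts E"
  have V: "closure ?V = UNIV" and irr: "irrefl E"
    and conn: "\<And>x y. x \<in> ?V \<Longrightarrow> y \<in> ?V \<Longrightarrow> \<exists>es. edge_path E x es y"
    using E by (auto simp: weakly_admissible_def)
  obtain b where b: "b \<in> ?V"
    using V by (metis closure_empty empty_iff ex_in_conv UNIV_I)
  have append: "transported_length \<sigma> (es @ fs) = transported_length \<sigma> es + transported_length \<sigma> fs" for es fs
    by (simp add: transported_length_def)
  have closed: "transported_length \<sigma> es = 0" if "edge_path E x es x" for x es
    using le[OF that] by simp
  have indep: "transported_length \<sigma> es = transported_length \<sigma> fs"
    if paths: "edge_path E x es y" "edge_path E x fs y" for x y es fs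
  proof -
    obtain gs where gs: "edge_path E y gs x"
      using conn edge_path_verts_in[OF paths(1)] by blast
    then have "transported_length \<sigma> (es @ gs) = 0" "transported_length \<sigma> (fs @ gs) = 0"
      using paths by (auto intro!: closed[of x])
    then show ?thesis unfolding append by (metis add_right_cancel)
  qed
  define t where "t = (\<lambda>v. transported_length \<sigma> (SOME es. edge_path E v es b))"
  have t: "transported_length \<sigma> es = t x - t y" if es: "edge_path E x es y" for x es y
  proof -
    have P: "edge_path E v (SOME es. edge_path E v es b) b" if "v \<in> ?V" for v
      using conn[OF that b] by (rule someI_ex)
    have "transported_length \<sigma> (es @ (SOME es. edge_path E y es b)) = t x"
      unfolding t_def using es P edge_path_verts_in[OF es] by (intro indep[of x _ b]) auto
    then show ?thesis by (simp add: append t_def eq_diff_eq)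
  qed
  have "1-lipschitz_on ?V t"
  proof (rule lipschitz_onI)
    fix x y assume "x \<in> ?V" "y \<in> ?V"
    then obtain es where "edge_path E x es y" using conn by blast
    then show "dist (t x) (t y) \<le> 1 * dist x y"
      using le t by (metis dist_norm mult_1)
  qed simp
  then obtain g where g: "uniformly_continuous_on (closure ?V) g" "\<And>x. x \<in> ?V \<Longrightarrow> t x = g x"
    using uniformly_continuous_on_extension_on_closure[of ?V t] lipschitz_on_uniformly_continuous
    by metis
  have "1-lipschitz_on ?V g"
    using \<open>1-lipschitz_on ?V t\<close> g(2) by (simp add: lipschitz_on_def)
  then have "1-lipschitz_on (closure ?V) g"
    using uniformly_continuous_imp_continuous[OF g(1)] by (intro lipschitz_on_closure)
  then have "norm (g x - g y) \<le> dist x y" for x y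
    using lipschitz_onD[of 1 "closure ?V" g x y] V by (simp add: dist_norm)
  then obtain T where T: "linear T" "\<And>x. norm (T x) \<le> norm x" "\<And>x y. T (point_diff (x, y)) = g x - g y"
    using lipschitz_linear_extension[of g] by blast
  have "T (molecule e) = molecule (\<sigma> e)" if e: "e \<in> E" for e
  proof -
    have "fst e \<in> ?V" "snd e \<in> ?V" using e by (auto simp: incident_verts_def)
    moreover from this have "edge_path E (fst e) [e] (snd e)" using e by simp
    from t[OF this] have "t (fst e) - t (snd e) = edge_length e *\<^sub>R molecule (\<sigma> e)"
      by (simp add: transported_length_def)
    ultimately have "T (point_diff e) = edge_length e *\<^sub>R molecule (\<sigma> e)"
      using T(3)[of "fst e" "snd e"] g(2) by simp
    then show ?thesis
      using irrefl_distinct[OF irr e] by (simp add: point_diff_def linear_scale[OF T(1)] edge_length_def)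
  qed
  then show ?thesis using that T by blast
qed

text \<open>
  The contractions obtained from \<open>\<sigma>\<close> and from its inverse are inverse to each other on the molecules of
  the edges, hence everywhere, and a contraction with contractive inverse is an isometry.
\<close>

lemma exists_isometry:
  fixes \<sigma> :: "'a::metric_space \<times> 'a \<Rightarrow> 'b::metric_space \<times> 'b"
  assumes E: "weakly_admissible E\<^sub>1" "weakly_admissible E\<^sub>2" and \<sigma>: "bij_betw \<sigma> E\<^sub>1 E\<^sub>2"
    and le1: "\<And>x es y. edge_path E\<^sub>1 x es y \<Longrightarrow> norm (transported_length \<sigma> es) \<le> dist x y"
    and le2: "\<And>x es y. edge_path E\<^sub>2 x es y \<Longrightarrow> norm (transported_length (inv_into E\<^sub>1 \<sigma>) es) \<le> dist x y"
  obtains T :: "'a lipfree \<Rightarrow> 'b lipfree" where "linear_isometry T" "surj T"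
    "\<And>e. e \<in> E\<^sub>1 \<Longrightarrow> T (molecule e) = molecule (\<sigma> e)"
proof -
  obtain T :: "'a lipfree \<Rightarrow> 'b lipfree" where T: "linear T" "\<And>x. norm (T x) \<le> norm x"
    "\<And>e. e \<in> E\<^sub>1 \<Longrightarrow> T (molecule e) = molecule (\<sigma> e)"
    using exists_contraction[OF E(1) le1] by blast
  obtain U :: "'b lipfree \<Rightarrow> 'a lipfree" where U: "linear U" "\<And>x. norm (U x) \<le> norm x"
    "\<And>f. f \<in> E\<^sub>2 \<Longrightarrow> U (molecule f) = molecule (inv_into E\<^sub>1 \<sigma> f)"
    using exists_contraction[OF E(2) le2] by blast
  have bl: "bounded_linear T" "bounded_linear U"
    using T U by (auto intro!: bounded_linear_intro[of _ 1] simp: linear_add linear_scale)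
  have in2: "\<sigma> e \<in> E\<^sub>2" "inv_into E\<^sub>1 \<sigma> (\<sigma> e) = e" if "e \<in> E\<^sub>1" for e
    using \<sigma> that by (auto simp: bij_betw_def inv_into_f_f)
  have in1: "inv_into E\<^sub>1 \<sigma> f \<in> E\<^sub>1" "\<sigma> (inv_into E\<^sub>1 \<sigma> f) = f" if "f \<in> E\<^sub>2" for f
    using \<sigma> that by (auto simp: bij_betw_def inv_into_into f_inv_into_f)
  have "(\<lambda>x. U (T x)) = (\<lambda>x. x)"
    by (rule bounded_linear_eq_on_edges[OF E(1) bounded_linear_compose[OF bl(2,1)] bounded_linear_ident])
      (simp add: T U in2)
  then have UT: "U (T x) = x" for x by meson
  have "(\<lambda>y. T (U y)) = (\<lambda>y. y)"
    by (rule bounded_linear_eq_on_edges[OF E(2) bounded_linear_compose[OF bl] bounded_linear_ident])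
      (simp add: T U in1)
  then have TU: "T (U y) = y" for y by meson
  have "norm (T x) = norm x" for x
    using T(2)[of x] U(2)[of "T x"] by (simp add: UT)
  then have "linear_isometry T" using T(1) by (simp add: linear_isometry_def)
  then show ?thesis using that T(3) TU by (metis surjI)
qed

text \<open>
  On a simple cycle the lengths of \<open>e\<close> and \<open>\<sigma>(e)\<close> are proportional, so the transported sum is a multiple of
  the telescoping sum around the image cycle.
\<close>

lemma cycles_imp_closed_path_sum_zero:
  assumes \<sigma>: "inj_on \<sigma> E\<^sub>1" and Sa: "cond_Sa E\<^sub>1 E\<^sub>2 \<sigma>" and Sb: "cond_Sb E\<^sub>1 \<sigma>"
    and irr: "irrefl E\<^sub>1" "irrefl E\<^sub>2" and im: "\<sigma> ` E\<^sub>1 \<subseteq> E\<^sub>2" and path: "edge_path E\<^sub>1 x es x"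
  shows "transported_length \<sigma> es = 0"
  unfolding transported_length_def
proof (rule closed_path_sum_eq_zero[OF _ path])
  fix es assume es: "pre_digraph.cycle (edge_graph E\<^sub>1) es"
  note C = cycle_set[OF es]
  have cyc: "simple_cycle E\<^sub>1 (set es)" using es by (auto simp: simple_cycle_def)
  then have "simple_cycle E\<^sub>2 (\<sigma> ` set es)" using Sa C(3) by (simp add: cond_Sa_def)
  then obtain fs where fs: "pre_digraph.cycle (edge_graph E\<^sub>2) fs" "\<sigma> ` set es = set fs"
    by (auto simp: simple_cycle_def)
  obtain k where k: "\<And>e. e \<in> set es \<Longrightarrow> edge_length e / edge_length (\<sigma> e) = k"
    using Sb C(3) cyc unfolding cond_Sb_def constant_on_def by metis
  have len: "edge_length e = k * edge_length (\<sigma> e)" if "e \<in> set es" for e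
  proof -
    have "\<sigma> e \<in> E\<^sub>2" using that C(3) im by auto
    then have "edge_length (\<sigma> e) \<noteq> 0"
      using irrefl_distinct[OF irr(2)] by (simp add: edge_length_def)
    then show ?thesis using k[OF that] by (simp add: field_simps)
  qed
  have inj: "inj_on \<sigma> (set es)" using \<sigma> C(3) by (rule inj_on_subset)
  have "(\<Sum>e\<leftarrow>es. edge_length e *\<^sub>R molecule (\<sigma> e)) = (\<Sum>e\<in>set es. edge_length e *\<^sub>R molecule (\<sigma> e))"
    using C(4) by (simp add: sum_list_distinct_conv_sum_set)
  also have "\<dots> = (\<Sum>e\<in>set es. k *\<^sub>R point_diff (\<sigma> e))"
    by (intro sum.cong refl) (simp add: len point_diff_def)
  also have "\<dots> = k *\<^sub>R (\<Sum>f\<in>\<sigma> ` set es. point_diff f)"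
    by (simp add: sum.reindex[OF inj] scaleR_sum_right)
  also have "\<dots> = 0" using cycle_sum_point_diff[OF fs(1)] fs(2) by simp
  finally show "(\<Sum>e\<leftarrow>es. edge_length e *\<^sub>R molecule (\<sigma> e)) = 0" .
qed

text \<open>
  All paths from \<open>x\<close> to \<open>y\<close> have the same transported length, whose norm is at most the length of the
  shortest of them; admissibility identifies the infimum with the distance.
\<close>

lemma admissible_path_norm_le:
  assumes E: "admissible E\<^sub>1"
    and closed: "\<And>x es. edge_path E\<^sub>1 x es x \<Longrightarrow> transported_length \<sigma> es = 0"
    and path: "edge_path E\<^sub>1 x es y"
  shows "norm (transported_length \<sigma> es) \<le> dist x y"
proof -
  have xy: "x \<in> incident_verts E\<^sub>1" "y \<in> incident_verts E\<^sub>1"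
    using edge_path_verts_in[OF path] .
  obtain gs where gs: "edge_path E\<^sub>1 y gs x"
    using E xy unfolding admissible_def weakly_admissible_def by blast
  have append: "transported_length \<sigma> (us @ vs) = transported_length \<sigma> us + transported_length \<sigma> vs" for us vs
    by (simp add: transported_length_def)
  have triangle: "norm (transported_length \<sigma> us) \<le> (\<Sum>e\<leftarrow>us. edge_length e)" for us
  proof (induction us)
    case (Cons e us)
    have "norm (edge_length e *\<^sub>R molecule (\<sigma> e)) \<le> edge_length e"
      using norm_molecule_le[of "\<sigma> e"] by (simp add: edge_length_def mult_left_le)
    then show ?case
      using Cons norm_triangle_ineq[of "edge_length e *\<^sub>R molecule (\<sigma> e)" "transported_length \<sigma> us"]
      by (simp add: transported_length_def)
  qed (simp add: transported_length_def)
  have "norm (transported_length \<sigma> es) \<le> (INF es\<in>{es. edge_path E\<^sub>1 x es y}. \<Sum>e\<leftarrow>es. edge_length e)"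
  proof (rule cINF_greatest)
    fix fs assume "fs \<in> {es. edge_path E\<^sub>1 x es y}"
    then have "transported_length \<sigma> (fs @ gs) = 0" "transported_length \<sigma> (es @ gs) = 0"
      using path gs by (auto intro!: closed[of x])
    then have "transported_length \<sigma> es = transported_length \<sigma> fs"
      unfolding append by (metis add_right_cancel)
    then show "norm (transported_length \<sigma> es) \<le> (\<Sum>e\<leftarrow>fs. edge_length e)"
      using triangle[of fs] by simp
  qed (use path in auto)
  then show ?thesis using E xy by (simp add: admissible_def)
qed

lemma cond_Sa_inv:
  assumes \<sigma>: "bij_betw \<sigma> E\<^sub>1 E\<^sub>2" and Sa: "cond_Sa E\<^sub>1 E\<^sub>2 \<sigma>"
  shows "cond_Sa E\<^sub>2 E\<^sub>1 (inv_into E\<^sub>1 \<sigma>)"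
  unfolding cond_Sa_def
proof (intro allI impI)
  fix C assume C: "C \<subseteq> E\<^sub>2"
  have "inv_into E\<^sub>1 \<sigma> ` C \<subseteq> E\<^sub>1"
    using \<sigma> C by (auto simp: bij_betw_def inv_into_into subset_iff)
  moreover have "\<sigma> (inv_into E\<^sub>1 \<sigma> f) = f" if "f \<in> C" for f
    using bij_betw_inv_into_right[OF \<sigma>] C that by blast
  then have "\<sigma> ` inv_into E\<^sub>1 \<sigma> ` C = C"
    by (simp add: image_image)
  ultimately show "simple_cycle E\<^sub>2 C \<longleftrightarrow> simple_cycle E\<^sub>1 (inv_into E\<^sub>1 \<sigma> ` C)"
    using Sa unfolding cond_Sa_def by metis
qed

lemma cond_Sb_inv:
  assumes \<sigma>: "bij_betw \<sigma> E\<^sub>1 E\<^sub>2" and Sa: "cond_Sa E\<^sub>1 E\<^sub>2 \<sigma>" and Sb: "cond_Sb E\<^sub>1 \<sigma>"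
  shows "cond_Sb E\<^sub>2 (inv_into E\<^sub>1 \<sigma>)"
  unfolding cond_Sb_def
proof (intro allI impI)
  fix C assume C: "C \<subseteq> E\<^sub>2" "simple_cycle E\<^sub>2 C"
  let ?\<tau> = "inv_into E\<^sub>1 \<sigma>"
  have \<sigma>\<tau>: "\<sigma> (?\<tau> f) = f" if "f \<in> C" for f
    using bij_betw_inv_into_right[OF \<sigma>] C that by blast
  have "?\<tau> ` C \<subseteq> E\<^sub>1" using \<sigma> C by (auto simp: bij_betw_def inv_into_into subset_iff)
  moreover have "simple_cycle E\<^sub>1 (?\<tau> ` C)"
    using cond_Sa_inv[OF \<sigma> Sa] C by (simp add: cond_Sa_def)
  ultimately obtain k where k: "\<And>e. e \<in> ?\<tau> ` C \<Longrightarrow> edge_length e / edge_length (\<sigma> e) = k"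
    using Sb unfolding cond_Sb_def constant_on_def by metis
  have "edge_length f / edge_length (?\<tau> f) = inverse k" if "f \<in> C" for f
    using k[of "?\<tau> f"] that \<sigma>\<tau>[OF that] by (auto simp: inverse_eq_divide)
  then show "(\<lambda>f. edge_length f / edge_length (?\<tau> f)) constant_on C"
    by (auto simp: constant_on_def)
qed

text \<open>
  The bounds for \<open>\<sigma>\<close> and for its inverse already produce the isometry, and (Sc) is then read off from it.
\<close>

lemma admissible_imp_cond_Sc:
  assumes E: "admissible E\<^sub>1" "admissible E\<^sub>2" and \<sigma>: "bij_betw \<sigma> E\<^sub>1 E\<^sub>2"
    and Sa: "cond_Sa E\<^sub>1 E\<^sub>2 \<sigma>" and Sb: "cond_Sb E\<^sub>1 \<sigma>"
  shows "cond_Sc E\<^sub>1 E\<^sub>2 \<sigma>"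
proof -
  have wa: "weakly_admissible E\<^sub>1" "weakly_admissible E\<^sub>2" using E by (auto simp: admissible_def)
  then have irr: "irrefl E\<^sub>1" "irrefl E\<^sub>2" by (auto simp: weakly_admissible_def)
  let ?\<tau> = "inv_into E\<^sub>1 \<sigma>"
  have \<tau>: "bij_betw ?\<tau> E\<^sub>2 E\<^sub>1" using \<sigma> by (rule bij_betw_inv_into)
  have "transported_length \<sigma> es = 0" if "edge_path E\<^sub>1 x es x" for x es
    using that \<sigma> by (intro cycles_imp_closed_path_sum_zero[OF _ Sa Sb irr]) (auto simp: bij_betw_def)
  then have le1: "norm (transported_length \<sigma> es) \<le> dist x y" if "edge_path E\<^sub>1 x es y" for x es y
    using that by (rule admissible_path_norm_le[OF E(1)])
  have "transported_length ?\<tau> es = 0" if "edge_path E\<^sub>2 x es x" for x es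
    using that \<tau>
    by (intro cycles_imp_closed_path_sum_zero[OF _ cond_Sa_inv[OF \<sigma> Sa] cond_Sb_inv[OF \<sigma> Sa Sb] irr(2,1)])
      (auto simp: bij_betw_def)
  then have le2: "norm (transported_length ?\<tau> es) \<le> dist x y" if "edge_path E\<^sub>2 x es y" for x es y
    using that by (rule admissible_path_norm_le[OF E(2)])
  obtain T where "linear_isometry T" "surj T" "\<And>e. e \<in> E\<^sub>1 \<Longrightarrow> T (molecule e) = molecule (\<sigma> e)"
    using exists_isometry[OF wa \<sigma> le1 le2] by blast
  then show ?thesis by (rule isometry_cond_Sc[OF _ _ \<sigma>])
qed

section \<open>The correspondence\<close>

lemma isometry_induced_by_bijection:
  fixes T :: "'m::metric_space lipfree \<Rightarrow> 'n::metric_space lipfree"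
  assumes "complete (UNIV :: 'm set)" "complete (UNIV :: 'n set)" and T: "linear_isometry T" "surj T"
  obtains \<sigma> where "\<sigma> \<in> edge_bijections ext_edges ext_edges" "induces \<sigma> T"
proof -
  let ?E1 = "ext_edges :: ('m \<times> 'm) set" and ?E2 = "ext_edges :: ('n \<times> 'n) set"
  have "\<forall>e\<in>?E1. \<exists>f\<in>?E2. T (molecule e) = molecule f"
    using isometry_maps_ext_molecule[OF assms(2) T] by blast
  then obtain s where s: "\<And>e. e \<in> ?E1 \<Longrightarrow> s e \<in> ?E2 \<and> T (molecule e) = molecule (s e)"
    by metis
  define \<sigma> where "\<sigma> = restrict s ?E1"
  have \<sigma>: "\<sigma> e \<in> ?E2" "T (molecule e) = molecule (\<sigma> e)" if "e \<in> ?E1" for e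
    using s that by (auto simp: \<sigma>_def)
  have "bij_betw \<sigma> ?E1 ?E2"
  proof (rule bij_betw_imageI)
    show "inj_on \<sigma> ?E1"
    proof (rule inj_onI)
      fix e f assume ef: "e \<in> ?E1" "f \<in> ?E1" "\<sigma> e = \<sigma> f"
      then have "T (molecule e) = T (molecule f)" using \<sigma>(2) by simp
      then have "molecule e = molecule f" using linear_isometry_inj[OF T(1)] by (simp add: inj_eq)
      then show "e = f" using molecule_eq_imp_eq ef ext_edges_distinct by blast
    qed
    show "\<sigma> ` ?E1 = ?E2"
    proof (intro equalityI subsetI)
      fix f assume f: "f \<in> ?E2"
      have "surj (inv T)" using linear_isometry_inj[OF T(1)] by (rule inj_imp_surj_inv)
      then obtain e where e: "e \<in> ?E1" "inv T (molecule f) = molecule e"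
        using isometry_maps_ext_molecule[OF assms(1) linear_isometry_inv[OF T] _ f] by blast
      then have "molecule f = molecule (\<sigma> e)"
        using \<sigma>(2)[OF e(1)] surj_f_inv_f[OF T(2)] by metis
      then have "f = \<sigma> e"
        using molecule_eq_imp_eq f \<sigma>(1)[OF e(1)] ext_edges_distinct by blast
      then show "f \<in> \<sigma> ` ?E1" using e(1) by blast
    qed (use \<sigma>(1) in auto)
  qed
  then have "\<sigma> \<in> edge_bijections ?E1 ?E2"
    by (simp add: edge_bijections_def \<sigma>_def)
  moreover have "induces \<sigma> T" using T(1) \<sigma>(2) by (simp add: induces_def)
  ultimately show ?thesis using that by blast
qed

lemma induces_unique:
  fixes \<sigma> :: "'m::metric_space \<times> 'm \<Rightarrow> 'n::metric_space \<times> 'n"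
  assumes "weak_prague_space TYPE('m)" "induces \<sigma> S" "induces \<sigma> T"
  shows "S = T"
proof (rule bounded_linear_eq_on_edges)
  show "weakly_admissible (ext_edges :: ('m \<times> 'm) set)"
    using assms(1) by (simp add: weak_prague_space_def)
qed (use assms(2,3) linear_isometry_bounded_linear in \<open>auto simp: induces_def\<close>)

theorem theorem3p9:
  assumes "complete (UNIV :: 'm::metric_space set)"
    and "complete (UNIV :: 'n::metric_space set)"
    and "weak_prague_space TYPE('m)"
    and "weak_prague_space TYPE('n)"
  shows
    "((\<forall>\<sigma> \<in> {\<sigma> :: 'm \<times> 'm \<Rightarrow> 'n \<times> 'n. \<sigma> \<in> edge_bijections ext_edges ext_edges \<and>
             cond_Sa ext_edges ext_edges \<sigma> \<and> cond_Sb ext_edges \<sigma> \<and>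
             cond_Sc ext_edges ext_edges \<sigma>}. \<exists>!T. induces \<sigma> T) \<and>
      bij_betw induced_isometry
        {\<sigma> :: 'm \<times> 'm \<Rightarrow> 'n \<times> 'n. \<sigma> \<in> edge_bijections ext_edges ext_edges \<and>
             cond_Sa ext_edges ext_edges \<sigma> \<and> cond_Sb ext_edges \<sigma> \<and>
             cond_Sc ext_edges ext_edges \<sigma>}
        surj_linear_isometries) \<and>
     (prague_space TYPE('m) \<and> prague_space TYPE('n) \<longrightarrow>
      (\<forall>\<sigma> \<in> {\<sigma> :: 'm \<times> 'm \<Rightarrow> 'n \<times> 'n. \<sigma> \<in> edge_bijections ext_edges ext_edges \<and>
             cond_Sa ext_edges ext_edges \<sigma> \<and> cond_Sb ext_edges \<sigma>}. \<exists>!T. induces \<sigma> T) \<and>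
      bij_betw induced_isometry
        {\<sigma> :: 'm \<times> 'm \<Rightarrow> 'n \<times> 'n. \<sigma> \<in> edge_bijections ext_edges ext_edges \<and>
             cond_Sa ext_edges ext_edges \<sigma> \<and> cond_Sb ext_edges \<sigma>}
        surj_linear_isometries)"
proof -
  let ?E1 = "ext_edges :: ('m \<times> 'm) set" and ?E2 = "ext_edges :: ('n \<times> 'n) set"
  have wa: "weakly_admissible ?E1" "weakly_admissible ?E2"
    using assms(3,4) by (simp_all add: weak_prague_space_def)
  then have irr: "irrefl ?E1" "irrefl ?E2" by (simp_all add: weakly_admissible_def)
  define A where "A = {\<sigma>. \<sigma> \<in> edge_bijections ?E1 ?E2 \<and>
    cond_Sa ?E1 ?E2 \<sigma> \<and> cond_Sb ?E1 \<sigma> \<and> cond_Sc ?E1 ?E2 \<sigma>}"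
  define B where "B = {\<sigma>. \<sigma> \<in> edge_bijections ?E1 ?E2 \<and> cond_Sa ?E1 ?E2 \<sigma> \<and> cond_Sb ?E1 \<sigma>}"
  have ex: "\<exists>T. induces \<sigma> T \<and> surj T" if "\<sigma> \<in> A" for \<sigma>
  proof -
    have \<sigma>: "bij_betw \<sigma> ?E1 ?E2" and Sc: "cond_Sc ?E1 ?E2 \<sigma>"
      using that by (auto simp: A_def edge_bijections_def)
    obtain T where "linear_isometry T" "surj T" "\<And>e. e \<in> ?E1 \<Longrightarrow> T (molecule e) = molecule (\<sigma> e)"
      using exists_isometry[OF wa \<sigma> eq_refl[OF cond_ScD(1)[OF Sc]] eq_refl[OF cond_ScD(2)[OF Sc]]]
      by blast
    then show ?thesis by (auto simp: induces_def)
  qed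
  have uniq: "induced_isometry \<sigma> = T" if "induces \<sigma> T" for \<sigma> :: "'m \<times> 'm \<Rightarrow> 'n \<times> 'n" and T
    unfolding induced_isometry_def using that induces_unique[OF assms(3)] by blast
  have ex1: "\<exists>!T. induces \<sigma> T" if "\<sigma> \<in> A" for \<sigma>
    using ex[OF that] induces_unique[OF assms(3)] by blast
  have bij: "bij_betw induced_isometry A surj_linear_isometries"
  proof (rule bij_betw_imageI)
    show "inj_on induced_isometry A"
    proof (rule inj_onI)
      fix \<sigma> \<tau> assume A: "\<sigma> \<in> A" "\<tau> \<in> A" and eq: "induced_isometry \<sigma> = induced_isometry \<tau>"
      obtain T where T: "induces \<sigma> T" "induces \<tau> T"
        using ex[OF A(1)] ex[OF A(2)] uniq eq by metis
      show "\<sigma> = \<tau>"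
      proof (rule extensionalityI)
        show "\<sigma> \<in> extensional ?E1" "\<tau> \<in> extensional ?E1"
          using A by (auto simp: A_def edge_bijections_def)
        fix e assume e: "e \<in> ?E1"
        have "\<sigma> e \<in> ?E2" "\<tau> e \<in> ?E2"
          using A e by (auto simp: A_def edge_bijections_def bij_betw_def)
        moreover have "molecule (\<sigma> e) = molecule (\<tau> e)"
          using T e by (metis induces_def)
        ultimately show "\<sigma> e = \<tau> e"
          using molecule_eq_imp_eq ext_edges_distinct by blast
      qed
    qed
    show "induced_isometry ` A = surj_linear_isometries"
    proof (intro equalityI subsetI)
      fix T assume "T \<in> induced_isometry ` A"
      then obtain \<sigma> where \<sigma>: "\<sigma> \<in> A" "T = induced_isometry \<sigma>" by blast
      then obtain T' where "induces \<sigma> T'" "surj T'" using ex by blast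
      then show "T \<in> surj_linear_isometries"
        using uniq \<sigma>(2) by (simp add: surj_linear_isometries_def induces_def)
    next
      fix T :: "'m lipfree \<Rightarrow> 'n lipfree" assume "T \<in> surj_linear_isometries"
      then have T: "linear_isometry T" "surj T" by (auto simp: surj_linear_isometries_def)
      obtain \<sigma> where \<sigma>: "\<sigma> \<in> edge_bijections ?E1 ?E2" "induces \<sigma> T"
        using isometry_induced_by_bijection[OF assms(1,2) T] by blast
      then have b: "bij_betw \<sigma> ?E1 ?E2" and eq: "\<And>e. e \<in> ?E1 \<Longrightarrow> T (molecule e) = molecule (\<sigma> e)"
        by (auto simp: edge_bijections_def induces_def)
      have "\<sigma> \<in> A"
        using \<sigma>(1) isometry_cond_Sa[OF T(1) b irr eq] isometry_cond_Sb[OF T(1) b irr eq]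
          isometry_cond_Sc[OF T b eq] by (simp add: A_def)
      then show "T \<in> induced_isometry ` A" using uniq[OF \<sigma>(2)] by blast
    qed
  qed
  have AB: "B = A" if "prague_space TYPE('m)" "prague_space TYPE('n)"
    using that admissible_imp_cond_Sc[of ?E1 ?E2]
    by (auto simp: A_def B_def prague_space_def edge_bijections_def)
  have i: "(\<forall>\<sigma>\<in>A. \<exists>!T. induces \<sigma> T) \<and> bij_betw induced_isometry A surj_linear_isometries"
    using ex1 bij by blast
  moreover have "prague_space TYPE('m) \<and> prague_space TYPE('n) \<longrightarrow>
      (\<forall>\<sigma>\<in>B. \<exists>!T. induces \<sigma> T) \<and> bij_betw induced_isometry B surj_linear_isometries"
  proof
    assume "prague_space TYPE('m) \<and> prague_space TYPE('n)"
    then have "B = A" using AB by blast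
    show "(\<forall>\<sigma>\<in>B. \<exists>!T. induces \<sigma> T) \<and> bij_betw induced_isometry B surj_linear_isometries"
      unfolding \<open>B = A\<close> by (rule i)
  qed
  ultimately show ?thesis
    unfolding A_def B_def by (rule conjI)
qed

end
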